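(* Let $X=(x_0,x_1)$ be a bounded interval and $\zeta\in C_{{\rm pw},+}(X)\setminus C_+(X)$. Write $\zeta=\zeta_1\zeta_2$, where $\zeta_1$ is continuous and $\zeta_2\in\mathrm{Step}_+(X)$, and denote by $r_j$ $(1\le j\le n)$ the reflectivities corresponding to the $n\ge1$ jump points of $\zeta_2$. Then $$\lim_{L\to\infty}\frac{1}{2L}\int_{-L}^L-\log\bigl(1-|g_{\zeta}^\omega(0)|^2\bigr)\,d\omega=\sum_{j=1}^n-\log\bigl(1-r_j^2\bigr).$$
   Context: A function on $X$ is regulated if it is a uniform limit of step functions; $\mathrm{Step}_+(X)$ is the set of strictly positive piecewise-constant functions on $X$ with finitely many discontinuities; $\mathrm{Reg}_+(X)$ is the set of regulated $f$ with $f>\varepsilon$ on $X$ for some $\varepsilon>0$. $C_+(X)$ is the set of absolutely continuous $f\in\mathrm{Reg}_+(X)$. $C_{{\rm pw},+}(X)$ is the set of $f\in\mathrm{Reg}_+(X)$ for which there is a finite partition of $X$ such that $f$ is absolutely continuous on each open subinterval of the partition. Functions equal a.e. are identified, and representatives without removable discontinuities are used. Every $\zeta\in C_{{\rm pw},+}(X)$ factors as $\zeta=\zeta_1\zeta_2$ with $\zeta_1$ absolutely continuous and $\zeta_2\in\mathrm{Step}_+(X)$, uniquely if one normalizes $\zeta_2(x_0+)=1$. The reflectivity at a jump point $y_j$ of $\zeta_2$ is $r_j=\dfrac{\zeta_2(y_j-)-\zeta_2(y_j+)}{\zeta_2(y_j-)+\zeta_2(y_j+)}$, where $f(x\pm)$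 are one-sided limits. Generalized reflection coefficient: $\mathbb{D}$ is the open unit disk; for $\omega\in\mathbb{R}\setminus\{0\}$ put $u^{\ell}=\frac12\bigl(u-\frac{1}{i\omega}u'\bigr)$, $u^{\rm r}=\frac12\bigl(u+\frac{1}{i\omega}u'\bigr)$. For $\zeta\in\mathrm{Reg}_+(X)$, for all $\omega\in\mathbb{R}$ outside a countable set (containing $0$) and every $\xi\in\mathbb{D}$, the problem $(\zeta u')'+\omega^2\zeta u=0$ on $X$, $u^{\rm r}(x_0+)=1$, $u^{\ell}(x_1-)=\xi u^{\rm r}(x_1-)$ has a unique solution $u$ with $u$ and $\zeta u'$ absolutely continuous (equation holding a.e.); $g_\zeta^\omega(\xi)=u^{\ell}(x_0+)$. *)

theory Defs
  imports "HOL-Analysis.Analysis"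
begin

definition abs_cont_on :: "real set \<Rightarrow> (real \<Rightarrow> 'a::real_normed_vector) \<Rightarrow> bool" where
  "abs_cont_on S f \<longleftrightarrow>
     (\<forall>\<epsilon>>0. \<exists>\<delta>>0. \<forall>D.
        finite D \<and> (\<forall>(a, b)\<in>D. a < b \<and> {a..b} \<subseteq> S) \<and>
        disjoint_family_on (\<lambda>(a, b). {a<..<b}) D \<and>
        (\<Sum>(a, b)\<in>D. b - a) < \<delta>
        \<longrightarrow> (\<Sum>(a, b)\<in>D. norm (f b - f a)) < \<epsilon>)"

text \<open>
  Throughout, the interval is the open interval from \<open>x0\<close> to \<open>x1\<close>, and only the values of a function on
  that interval matter. A finite partition is given by its finite set \<open>P\<close> of interior points.
\<close>

definition partition_intervals :: "real \<Rightarrow> real \<Rightarrow> real set \<Rightarrow> real set set" where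
  "partition_intervals x0 x1 P =
     {{a<..<b} | a b. a \<in> insert x0 (insert x1 P) \<and> b \<in> insert x0 (insert x1 P) \<and>
                      a < b \<and> {a<..<b} \<inter> P = {}}"

definition Step :: "real \<Rightarrow> real \<Rightarrow> (real \<Rightarrow> real) set" where
  "Step x0 x1 =
     {f. \<exists>P. finite P \<and> P \<subseteq> {x0<..<x1} \<and>
             (\<forall>I\<in>partition_intervals x0 x1 P. f constant_on I)}"

definition Step_pos :: "real \<Rightarrow> real \<Rightarrow> (real \<Rightarrow> real) set" where
  "Step_pos x0 x1 = {f \<in> Step x0 x1. \<forall>x\<in>{x0<..<x1}. f x > 0}"

definition regulated :: "real \<Rightarrow> real \<Rightarrow> (real \<Rightarrow> real) set" where
  "regulated x0 x1 =
     {f. \<exists>s. (\<forall>k::nat. s k \<in> Step x0 x1) \<and> uniform_limit {x0<..<x1} s f sequentially}"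

definition Reg_pos :: "real \<Rightarrow> real \<Rightarrow> (real \<Rightarrow> real) set" where
  "Reg_pos x0 x1 = {f \<in> regulated x0 x1. \<exists>\<epsilon>>0. \<forall>x\<in>{x0<..<x1}. f x > \<epsilon>}"

definition C_pos :: "real \<Rightarrow> real \<Rightarrow> (real \<Rightarrow> real) set" where
  "C_pos x0 x1 = {f \<in> Reg_pos x0 x1. abs_cont_on {x0<..<x1} f}"

definition Cpw_pos :: "real \<Rightarrow> real \<Rightarrow> (real \<Rightarrow> real) set" where
  "Cpw_pos x0 x1 =
     {f \<in> Reg_pos x0 x1.
        \<exists>P. finite P \<and> P \<subseteq> {x0<..<x1} \<and> (\<forall>I\<in>partition_intervals x0 x1 P. abs_cont_on I f)}"

definition no_removable_discontinuity :: "real \<Rightarrow> real \<Rightarrow> (real \<Rightarrow> real) \<Rightarrow> bool" where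
  "no_removable_discontinuity x0 x1 f \<longleftrightarrow> (\<forall>x\<in>{x0<..<x1}. \<forall>l. (f \<longlongrightarrow> l) (at x) \<longrightarrow> f x = l)"

text \<open>
  A jump is detected by one-sided limits, so it does not depend on the value of the step function
  at its (finitely many) points of discontinuity.
\<close>

definition jump_points :: "real \<Rightarrow> real \<Rightarrow> (real \<Rightarrow> real) \<Rightarrow> real set" where
  "jump_points x0 x1 f = {y \<in> {x0<..<x1}. Lim (at_left y) f \<noteq> Lim (at_right y) f}"

definition reflectivity :: "(real \<Rightarrow> real) \<Rightarrow> real \<Rightarrow> real" where
  "reflectivity f y =
     (Lim (at_left y) f - Lim (at_right y) f) / (Lim (at_left y) f + Lim (at_right y) f)"

text \<open>
  In the following definitions \<open>v\<close> plays the role of \<open>u'\<close>. The derivative exists only almost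
  everywhere, and \<open>v\<close> is the representative for which \<open>\<zeta> v\<close> is absolutely continuous; it has
  one-sided limits because \<open>\<zeta>\<close> is regulated and bounded away from 0.
\<close>

definition left_wave :: "real \<Rightarrow> (real \<Rightarrow> complex) \<Rightarrow> (real \<Rightarrow> complex) \<Rightarrow> real \<Rightarrow> complex" where
  "left_wave \<omega> u v x = (u x - v x / (\<i> * of_real \<omega>)) / 2"

definition right_wave :: "real \<Rightarrow> (real \<Rightarrow> complex) \<Rightarrow> (real \<Rightarrow> complex) \<Rightarrow> real \<Rightarrow> complex" where
  "right_wave \<omega> u v x = (u x + v x / (\<i> * of_real \<omega>)) / 2"

definition is_solution ::
    "real \<Rightarrow> real \<Rightarrow> (real \<Rightarrow> real) \<Rightarrow> real \<Rightarrow> complex \<Rightarrow> (real \<Rightarrow> complex) \<Rightarrow> (real \<Rightarrow> complex) \<Rightarrow> bool"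
where
  "is_solution x0 x1 \<zeta> \<omega> \<xi> u v \<longleftrightarrow>
     abs_cont_on {x0<..<x1} u \<and>
     abs_cont_on {x0<..<x1} (\<lambda>x. of_real (\<zeta> x) * v x) \<and>
     (AE x in lborel. x \<in> {x0<..<x1} \<longrightarrow> (u has_vector_derivative v x) (at x)) \<and>
     (AE x in lborel. x \<in> {x0<..<x1} \<longrightarrow>
        (\<exists>d. ((\<lambda>t. of_real (\<zeta> t) * v t) has_vector_derivative d) (at x) \<and>
             d + of_real (\<omega>\<^sup>2 * \<zeta> x) * u x = 0)) \<and>
     Lim (at_right x0) (right_wave \<omega> u v) = 1 \<and>
     Lim (at_left x1) (left_wave \<omega> u v) = \<xi> * Lim (at_left x1) (right_wave \<omega> u v)"

text \<open>
  The boundary value problem has a unique solution for all \<open>\<omega>\<close> outside a countable set and \<open>\<xi>\<close> in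
  the open unit disk; for the other parameters the value is unspecified.
\<close>

definition gen_reflection_coeff ::
    "real \<Rightarrow> real \<Rightarrow> (real \<Rightarrow> real) \<Rightarrow> real \<Rightarrow> complex \<Rightarrow> complex" where
  "gen_reflection_coeff x0 x1 \<zeta> \<omega> \<xi> =
     (THE c. \<exists>u v. is_solution x0 x1 \<zeta> \<omega> \<xi> u v \<and> c = Lim (at_right x0) (left_wave \<omega> u v))"

end

theory Submission
  imports Defs "HOL-Complex_Analysis.Complex_Analysis"
begin

text \<open>
  For a step function with reflectivities \<open>s\<^sub>j\<close>, let \<open>R\<^sub>j\<close> be the reflection coefficient of everything
  to the right of the \<open>j\<close>-th jump. It satisfies a Moebius recursion, and for real \<open>\<omega>\<close> the identity
  \<open>1 - |(s + R) / (1 + s R)|\<^sup>2 = (1 - s\<^sup>2) (1 - |R|\<^sup>2) / |1 + s R|\<^sup>2\<close> telescopes to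
  \<open>- ln (1 - |g|\<^sup>2) = \<Sum> - ln (1 - s\<^sub>j\<^sup>2) + 2 Re H\<close> with \<open>H = \<Sum> Ln (1 + s\<^sub>j R\<^sub>j)\<close>. The function \<open>H\<close> is
  holomorphic in the upper half plane, bounded there by a multiple of \<open>\<Sum> |s\<^sub>j|\<close>, and on the line
  \<open>Im \<omega> = \<eta>\<close> it is bounded by a multiple of \<open>\<Sum> |s\<^sub>i| |s\<^sub>j| exp (- 2 \<eta> |y\<^sub>i - y\<^sub>j|)\<close>. Moving the path of
  integration to that line shows that the mean of \<open>Re H\<close> is small for large \<open>\<eta>\<close>.

  The general impedance is sampled on uniform grids. Absolute continuity between the jumps
  makes the double sum above small uniformly in the grid, and also makes the sampled jumps away
  from the true ones contribute nothing to \<open>\<Sum> - ln (1 - s\<^sub>j\<^sup>2)\<close> in the limit. For fixed real \<open>\<omega>\<close> the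
  reflection coefficients of the step functions converge by Gronwall's inequality, so dominated
  convergence in \<open>\<omega>\<close> transfers the estimate.
\<close>

section \<open>Reflection recursion for layered media\<close>

text \<open>The parameters are fixed in the order \<epsilon>, \<eta>, grid, L: the height \<eta>
  depends on \<epsilon> alone, the estimate then holds for all sufficiently fine grids and every L,
  the grid is refined at fixed L, and L grows last. Hence every bound has to be uniform in the
  number of layers, and the final error has the form \<open>B + 4 * L * \<epsilon>\<close> with B
  independent of L.

  The double sum can be made small because it contains only pairs of distinct interfaces: the
  coefficient multiplied by the reflectivity of an interface comes solely from the interfaces to its
  right. A true jump paired with itself would give a term that no refinement reduces. Two different
  true jumps are a fixed distance apart and are damped by the exponential. Any other close pair
  contains an interface created by sampling, and such interfaces have small total strength on a
  short stretch.

  For \<xi> = 0 conservation of energy makes every nonzero real frequency admissible, so the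
  exceptional set needs no further treatment.\<close>

lemma mobius_norm_identity:
  fixes a :: real and w :: complex
  shows "(cmod (1 + a * w))\<^sup>2 - (cmod (a + w))\<^sup>2 = (1 - a\<^sup>2) * (1 - (cmod w)\<^sup>2)"
  unfolding cmod_power2 by (simp add: power2_eq_square algebra_simps)

text \<open>Positivity of the real part gives more than a nonzero denominator: it keeps the argument
  of \<open>Ln\<close> off its branch cut.\<close>

lemma one_plus_real_mult_nonzero:
  fixes a :: real and w :: complex
  assumes "\<bar>a\<bar> < 1" "cmod w \<le> 1"
  shows "Re (1 + a * w) > 0"
proof -
  have "\<bar>a * Re w\<bar> \<le> \<bar>a\<bar> * 1"
    unfolding abs_mult using abs_Re_le_cmod[of w] assms by (intro mult_left_mono) auto
  then show ?thesis using assms by simp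
qed

lemma mobius_norm_le_1:
  fixes a :: real and w :: complex
  assumes "\<bar>a\<bar> < 1" "cmod w \<le> 1"
  shows "cmod ((a + w) / (1 + a * w)) \<le> 1"
proof -
  have "(cmod (a + w))\<^sup>2 \<le> (cmod (1 + a * w))\<^sup>2"
  proof -
    have "0 \<le> (1 - a\<^sup>2) * (1 - (cmod w)\<^sup>2)"
      using assms by (intro mult_nonneg_nonneg) (auto simp: abs_square_le_1 power_le_one)
    then show ?thesis using mobius_norm_identity[of a w] by linarith
  qed
  then have "cmod (a + w) \<le> cmod (1 + a * w)"
    by (simp add: abs_le_square_iff[symmetric])
  moreover have "1 + a * w \<noteq> 0"
    using one_plus_real_mult_nonzero[OF assms] by (metis less_irrefl zero_complex.sel(1))
  ultimately show ?thesis by (simp add: norm_divide)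
qed

lemma norm_one_plus_real_mult_ge:
  fixes a \<rho> :: real and w :: complex
  assumes "\<bar>a\<bar> \<le> \<rho>" "cmod w \<le> 1"
  shows "1 - \<rho> \<le> cmod (1 + a * w)"
proof -
  have "cmod (a * w) \<le> \<rho>"
    unfolding norm_mult using assms mult_mono[of "\<bar>a\<bar>" \<rho> "cmod w" 1] by auto
  then show ?thesis
    using norm_triangle_ineq2[of 1 "- (a * w)"] by simp
qed

text \<open>The map differs from the identity by \<open>a * (1 - w\<^sup>2) / (1 + a * w)\<close>,
  whose numerator has modulus at most \<open>2 * \<bar>a\<bar>\<close>. This additive form, unlike
  the bound by 1, can be summed along the recursion.\<close>

lemma mobius_norm_le:
  fixes a \<rho> :: real and w :: complex
  assumes "\<bar>a\<bar> \<le> \<rho>" "\<rho> < 1" "cmod w \<le> 1"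
  shows "cmod ((a + w) / (1 + a * w)) \<le> cmod w + 2 / (1 - \<rho>) * \<bar>a\<bar>"
proof -
  have nz: "1 + a * w \<noteq> 0"
    using one_plus_real_mult_nonzero[of a w] assms by (metis less_irrefl zero_complex.sel(1) le_less_trans)
  have "(a + w) / (1 + a * w) = w + a * (1 - w\<^sup>2) / (1 + a * w)"
    using nz by (simp add: field_simps power2_eq_square)
  also have "cmod \<dots> \<le> cmod w + cmod (a * (1 - w\<^sup>2) / (1 + a * w))"
    by (rule norm_triangle_ineq)
  also have "cmod (a * (1 - w\<^sup>2) / (1 + a * w)) = \<bar>a\<bar> * cmod (1 - w\<^sup>2) / cmod (1 + a * w)"
    by (simp add: norm_mult norm_divide)
  also have "\<dots> \<le> \<bar>a\<bar> * 2 / (1 - \<rho>)"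
  proof (intro frac_le mult_left_mono)
    have "cmod (1 - w\<^sup>2) \<le> 1 + cmod (w\<^sup>2)" by (metis norm_triangle_ineq4 norm_one)
    also have "cmod (w\<^sup>2) \<le> 1" using assms by (simp add: norm_power power_le_one)
    finally show "cmod (1 - w\<^sup>2) \<le> 2" by simp
    show "1 - \<rho> \<le> cmod (1 + a * w)" using assms(1,3) by (rule norm_one_plus_real_mult_ge)
  qed (use assms in auto)
  finally show ?thesis by (simp add: mult.commute)
qed

text \<open>Mean value inequality on the disk of radius \<rho>, where the derivative 1 / (1 + z) has
  modulus at most 1 / (1 - \<rho>).\<close>

lemma norm_Ln_one_plus_le:
  assumes "cmod w \<le> \<rho>" "\<rho> < 1"
  shows "cmod (Ln (1 + w)) \<le> cmod w / (1 - \<rho>)"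
proof -
  have "cmod (Ln (1 + w) - Ln (1 + 0)) \<le> 1 / (1 - \<rho>) * cmod (w - 0)"
  proof (rule field_differentiable_bound[where S = "cball 0 \<rho>" and f' = "\<lambda>z. 1 / (1 + z)"])
    fix z :: complex assume z: "z \<in> cball 0 \<rho>"
    then have "cmod z < 1" using assms by simp
    then have "Re (1 + z) > 0" using abs_Re_le_cmod[of z] by simp
    then have "1 + z \<notin> \<real>\<^sub>\<le>\<^sub>0" by (auto simp: complex_nonpos_Reals_iff)
    then show "((\<lambda>z. Ln (1 + z)) has_field_derivative 1 / (1 + z)) (at z within cball 0 \<rho>)"
      by (auto intro!: derivative_eq_intros simp: field_simps)
    have "1 - \<rho> \<le> cmod (1 + z)" using norm_triangle_ineq2[of 1 "- z"] z by simp
    then show "cmod (1 / (1 + z)) \<le> 1 / (1 - \<rho>)"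
      unfolding norm_divide norm_one using assms by (intro frac_le) auto
  qed (use assms in \<open>auto intro: order_trans[OF norm_ge_zero]\<close>)
  then show ?thesis by simp
qed

text \<open>
  Layers of equal thickness \<open>h\<close> are numbered from the right, and \<open>s i\<close> is the reflectivity of the
  interface between layers \<open>i + 1\<close> and \<open>i\<close>; \<open>layer_refl s h i\<close> belongs to the left end of layer \<open>i\<close>.
  The rightmost layer continues to the boundary, hence the initial value \<open>0\<close>.
\<close>

primrec layer_refl :: "(nat \<Rightarrow> real) \<Rightarrow> real \<Rightarrow> nat \<Rightarrow> complex \<Rightarrow> complex" where
  "layer_refl s h 0 z = 0"
| "layer_refl s h (Suc i) z =
     exp (2 * \<i> * z * h) * ((s i + layer_refl s h i z) / (1 + s i * layer_refl s h i z))"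

definition layer_log :: "(nat \<Rightarrow> real) \<Rightarrow> real \<Rightarrow> nat \<Rightarrow> complex \<Rightarrow> complex" where
  "layer_log s h n z = (\<Sum>i<n. Ln (1 + s i * layer_refl s h i z))"

lemma norm_phase:
  fixes h :: real shows "cmod (exp (2 * \<i> * z * h)) = exp (- (2 * Im z * h))"
  by simp

section \<open>Estimates in the closed upper half plane, uniform in the number of layers\<close>

context
  fixes s :: "nat \<Rightarrow> real" and \<rho> h :: real and n :: nat
  assumes s: "\<And>i. i < n \<Longrightarrow> \<bar>s i\<bar> \<le> \<rho>" and \<rho>: "\<rho> < 1" and h: "0 \<le> h"
begin

lemma norm_layer_refl_le_1:
  assumes "Im z \<ge> 0" "i \<le> n"
  shows "cmod (layer_refl s h i z) \<le> 1"
  using assms(2)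
proof (induction i)
  case (Suc i)
  have "cmod (layer_refl s h (Suc i) z) \<le> 1 * 1"
    unfolding layer_refl.simps norm_mult[of "exp _"] norm_phase
    using assms h Suc s[of i] \<rho> by (intro mult_mono mobius_norm_le_1) auto
  then show ?case by simp
qed simp

text \<open>Unrolled recursion: each interface adds at most
  \<open>2 / (1 - \<rho>) * \<bar>s j\<bar>\<close>, and each layer crossed afterwards multiplies by
  the damping factor of one round trip. The contribution of interface j to the left end of layer i
  has crossed i - j layers.\<close>

lemma norm_layer_refl_le:
  assumes "Im z \<ge> 0" "i \<le> n"
  shows "cmod (layer_refl s h i z)
           \<le> 2 / (1 - \<rho>) * (\<Sum>j<i. \<bar>s j\<bar> * exp (- (2 * Im z * h * real (i - j))))"
  using assms(2)
proof (induction i)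
  case (Suc i)
  let ?e = "exp (- (2 * Im z * h))"
  have "cmod (layer_refl s h (Suc i) z) \<le> ?e * (cmod (layer_refl s h i z) + 2 / (1 - \<rho>) * \<bar>s i\<bar>)"
    unfolding layer_refl.simps norm_mult[of "exp _"] norm_phase
    using assms Suc s[of i] \<rho> norm_layer_refl_le_1[of z i]
    by (intro mult_left_mono mobius_norm_le) auto
  also have "\<dots> \<le> ?e * (2 / (1 - \<rho>) * (\<Sum>j<i. \<bar>s j\<bar> * exp (- (2 * Im z * h * real (i - j))))
                      + 2 / (1 - \<rho>) * \<bar>s i\<bar>)"
    using Suc by (intro mult_left_mono add_right_mono) auto
  also have "\<dots> = 2 / (1 - \<rho>) * ((\<Sum>j<i. \<bar>s j\<bar> * (exp (- (2 * Im z * h * real (i - j))) * ?e)) + \<bar>s i\<bar> * ?e)"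
    by (simp add: algebra_simps sum_distrib_left)
  also have "(\<Sum>j<i. \<bar>s j\<bar> * (exp (- (2 * Im z * h * real (i - j))) * ?e)) + \<bar>s i\<bar> * ?e
             = (\<Sum>j<Suc i. \<bar>s j\<bar> * exp (- (2 * Im z * h * real (Suc i - j))))"
    by (simp add: exp_add[symmetric] Suc_diff_le algebra_simps)
  finally show ?case .
qed simp

text \<open>The denominators are nonzero at the point z itself, so real z are covered too, with a
  full complex neighbourhood.\<close>

lemma layer_refl_differentiable:
  assumes "Im z \<ge> 0" "i \<le> n"
  shows "layer_refl s h i field_differentiable at z"
  using assms(2)
proof (induction i)
  case 0
  have "layer_refl s h 0 = (\<lambda>_. 0)" by auto
  then show ?case by (metis field_differentiable_const)
next
  case (Suc i)
  have "Re (1 + s i * layer_refl s h i z) > 0"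
    using assms Suc s[of i] \<rho> norm_layer_refl_le_1[of z i] by (intro one_plus_real_mult_nonzero) auto
  then have nz: "1 + s i * layer_refl s h i z \<noteq> 0" by (metis less_irrefl zero_complex.sel(1))
  have D: "layer_refl s h i field_differentiable at z" using Suc by simp
  have E: "(\<lambda>z. exp (2 * \<i> * z * h)) field_differentiable at z"
    unfolding field_differentiable_def by (rule exI) (rule derivative_eq_intros refl)+
  have "(\<lambda>z. exp (2 * \<i> * z * h) * ((s i + layer_refl s h i z) / (1 + s i * layer_refl s h i z)))
          field_differentiable at z"
    using D nz E by (intro field_differentiable_mult field_differentiable_divide
        field_differentiable_add field_differentiable_const)
  then show ?case by (simp only: layer_refl.simps[abs_def])
qed

lemma layer_log_differentiable:
  assumes "Im z \<ge> 0"
  shows "layer_log s h n field_differentiable at z"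
proof -
  have "(\<lambda>z. \<Sum>i<n. Ln (1 + s i * layer_refl s h i z)) field_differentiable at z"
  proof (rule field_differentiable_sum)
    fix i assume i: "i \<in> {..<n}"
    have "Re (1 + s i * layer_refl s h i z) > 0"
      using assms i s[of i] \<rho> norm_layer_refl_le_1[of z i] by (intro one_plus_real_mult_nonzero) auto
    then have nz: "1 + s i * layer_refl s h i z \<notin> \<real>\<^sub>\<le>\<^sub>0" by (auto simp: complex_nonpos_Reals_iff)
    have "layer_refl s h i field_differentiable at z" using layer_refl_differentiable assms i by simp
    then have "(\<lambda>z. 1 + s i * layer_refl s h i z) field_differentiable at z"
      by (intro field_differentiable_mult field_differentiable_add field_differentiable_const)
    then show "(\<lambda>z. Ln (1 + s i * layer_refl s h i z)) field_differentiable at z"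
      using nz by (rule field_differentiable_compose[of _ _ Ln, unfolded o_def,
            OF _ field_differentiable_at_Ln])
  qed
  then show ?thesis by (simp add: layer_log_def[abs_def])
qed

lemma norm_layer_log_summand_le:
  assumes "Im z \<ge> 0" "i < n"
  shows "cmod (Ln (1 + s i * layer_refl s h i z)) \<le> \<bar>s i\<bar> * cmod (layer_refl s h i z) / (1 - \<rho>)"
proof -
  have R: "cmod (layer_refl s h i z) \<le> 1" using norm_layer_refl_le_1 assms by simp
  have "\<bar>s i\<bar> * cmod (layer_refl s h i z) \<le> \<rho> * 1"
    using R s assms by (intro mult_mono) (auto intro: order_trans[OF abs_ge_zero])
  then have "cmod (s i * layer_refl s h i z) \<le> \<rho>"
    by (simp add: norm_mult)
  from norm_Ln_one_plus_le[OF this \<rho>] show ?thesis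
    by (simp add: norm_mult)
qed

text \<open>The crude bound without damping. It serves on the vertical sides of the contour, and on
  the real axis as the dominating constant for the passage to the limit.\<close>

lemma norm_layer_log_le:
  assumes "Im z \<ge> 0"
  shows "cmod (layer_log s h n z) \<le> (\<Sum>i<n. \<bar>s i\<bar>) / (1 - \<rho>)"
proof -
  have "cmod (layer_log s h n z) \<le> (\<Sum>i<n. \<bar>s i\<bar> * 1 / (1 - \<rho>))"
    unfolding layer_log_def
  proof (rule sum_norm_le)
    fix i assume i: "i \<in> {..<n}"
    have "cmod (Ln (1 + s i * layer_refl s h i z)) \<le> \<bar>s i\<bar> * cmod (layer_refl s h i z) / (1 - \<rho>)"
      using norm_layer_log_summand_le assms i by simp
    also have "\<dots> \<le> \<bar>s i\<bar> * 1 / (1 - \<rho>)"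
      using norm_layer_refl_le_1[of z i] assms i \<rho> by (intro divide_right_mono mult_left_mono) auto
    finally show "cmod (Ln (1 + s i * layer_refl s h i z)) \<le> \<bar>s i\<bar> * 1 / (1 - \<rho>)" .
  qed
  then show ?thesis by (simp add: sum_divide_distrib)
qed

text \<open>Each summand is of size \<open>\<bar>s i\<bar>\<close> times the i-th reflection
  coefficient, which in turn is a damped sum over j < i. The strict inequality is what keeps the
  diagonal out.\<close>

lemma norm_layer_log_le_pairs:
  assumes "Im z \<ge> 0"
  shows "cmod (layer_log s h n z)
     \<le> 2 / (1 - \<rho>)\<^sup>2 * (\<Sum>i<n. \<Sum>j<i. \<bar>s i\<bar> * \<bar>s j\<bar> * exp (- (2 * Im z * h * real (i - j))))"
proof -
  have "cmod (layer_log s h n z) \<le> (\<Sum>i<n. \<bar>s i\<bar> * (2 / (1 - \<rho>) *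
          (\<Sum>j<i. \<bar>s j\<bar> * exp (- (2 * Im z * h * real (i - j))))) / (1 - \<rho>))"
    unfolding layer_log_def
  proof (rule sum_norm_le)
    fix i assume i: "i \<in> {..<n}"
    have "cmod (Ln (1 + s i * layer_refl s h i z)) \<le> \<bar>s i\<bar> * cmod (layer_refl s h i z) / (1 - \<rho>)"
      using norm_layer_log_summand_le assms i by simp
    also have "\<dots> \<le> \<bar>s i\<bar> * (2 / (1 - \<rho>) *
          (\<Sum>j<i. \<bar>s j\<bar> * exp (- (2 * Im z * h * real (i - j))))) / (1 - \<rho>)"
      using norm_layer_refl_le[of z i] assms i \<rho> by (intro divide_right_mono mult_left_mono) auto
    finally show "cmod (Ln (1 + s i * layer_refl s h i z)) \<le> \<dots>" .
  qed
  also have "\<dots> = 2 / (1 - \<rho>)\<^sup>2 *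
      (\<Sum>i<n. \<Sum>j<i. \<bar>s i\<bar> * \<bar>s j\<bar> * exp (- (2 * Im z * h * real (i - j))))"
    by (simp add: sum_distrib_left sum_divide_distrib power2_eq_square mult_ac)
  finally show ?thesis .
qed

text \<open>The strict bound by 1 is carried along in the induction because splitting the logarithm
  of the product needs both factors to be positive.\<close>

lemma minus_ln_layer_refl:
  assumes "i \<le> n"
  shows "cmod (layer_refl s h i (of_real \<omega>)) < 1 \<and>
    - ln (1 - (cmod (layer_refl s h i (of_real \<omega>)))\<^sup>2)
      = (\<Sum>j<i. - ln (1 - (s j)\<^sup>2)) + 2 * Re (layer_log s h i (of_real \<omega>))"
  using assms
proof (induction i)
  case 0
  then show ?case by (simp add: layer_log_def)
next
  case (Suc i)
  define R where "R = layer_refl s h i (of_real \<omega>)"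
  have R: "cmod R < 1" using Suc by (simp add: R_def)
  have si: "\<bar>s i\<bar> < 1" using s[of i] \<rho> Suc by simp
  have pos: "Re (1 + s i * R) > 0" using R si by (intro one_plus_real_mult_nonzero) auto
  then have nz: "1 + s i * R \<noteq> 0" by (metis less_irrefl zero_complex.sel(1))
  have s2: "(s i)\<^sup>2 < 1" using si by (simp add: abs_square_less_1)
  have R2: "(cmod R)\<^sup>2 < 1" using R by (simp add: abs_square_less_1)
  have E: "1 - (cmod (layer_refl s h (Suc i) (of_real \<omega>)))\<^sup>2
            = (1 - (s i)\<^sup>2) * (1 - (cmod R)\<^sup>2) / (cmod (1 + s i * R))\<^sup>2"
  proof -
    have "(cmod (layer_refl s h (Suc i) (of_real \<omega>)))\<^sup>2 = (cmod (s i + R))\<^sup>2 / (cmod (1 + s i * R))\<^sup>2"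
      by (simp add: norm_mult norm_divide R_def power_divide)
    moreover have "(cmod (1 + s i * R))\<^sup>2 > 0" using nz by simp
    ultimately have "1 - (cmod (layer_refl s h (Suc i) (of_real \<omega>)))\<^sup>2
        = ((cmod (1 + s i * R))\<^sup>2 - (cmod (s i + R))\<^sup>2) / (cmod (1 + s i * R))\<^sup>2"
      by (simp add: field_simps)
    then show ?thesis by (simp only: mobius_norm_identity)
  qed
  have "0 < (1 - (s i)\<^sup>2) * (1 - (cmod R)\<^sup>2) / (cmod (1 + s i * R))\<^sup>2"
    using s2 R2 nz by (intro divide_pos_pos mult_pos_pos) auto
  then have "(cmod (layer_refl s h (Suc i) (of_real \<omega>)))\<^sup>2 < 1" using E by linarith
  then have "cmod (layer_refl s h (Suc i) (of_real \<omega>)) < 1"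
    by (metis abs_norm_cancel abs_square_less_1)
  moreover have "ln (1 - (cmod (layer_refl s h (Suc i) (of_real \<omega>)))\<^sup>2)
      = ln (1 - (s i)\<^sup>2) + ln (1 - (cmod R)\<^sup>2) - 2 * Re (Ln (1 + s i * R))"
  proof -
    have "(1 - (s i)\<^sup>2) * (1 - (cmod R)\<^sup>2) > 0" using s2 R2 by simp
    then show ?thesis unfolding E using s2 R2 nz
      by (simp add: ln_div ln_mult ln_realpow Re_Ln del: zero_less_mult_iff)
  qed
  ultimately show ?case using Suc
    by (simp add: layer_log_def R_def del: layer_refl.simps)
qed

text \<open>On the convex half plane \<open>layer_log\<close> has a primitive F, so the integral is
  an increment of F, estimated along the other three sides of the rectangle with base [-L, L] and
  height \<eta>. The two vertical sides have length \<eta> and use the crude bound; the top has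
  length 2 L and uses E.\<close>

lemma integral_Re_layer_log_le:
  assumes \<eta>: "\<eta> > 0" and L: "L > 0"
    and E: "\<And>z. Im z = \<eta> \<Longrightarrow> cmod (layer_log s h n z) \<le> E"
  shows "continuous_on UNIV (\<lambda>\<omega>. Re (layer_log s h n (of_real \<omega>)))"
    and "\<bar>integral {-L..L} (\<lambda>\<omega>. Re (layer_log s h n (of_real \<omega>)))\<bar>
           \<le> 2 * \<eta> * ((\<Sum>i<n. \<bar>s i\<bar>) / (1 - \<rho>)) + 2 * L * E"
proof -
  let ?H = "layer_log s h n" and ?C = "(\<Sum>i<n. \<bar>s i\<bar>) / (1 - \<rho>)"
  let ?S = "{z. Im z \<ge> 0}"
  have conv: "convex ?S" by (rule convex_halfspace_Im_ge)
  have cont: "continuous_on ?S ?H"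
    by (intro continuous_at_imp_continuous_on ballI field_differentiable_imp_continuous_at
        layer_log_differentiable) auto
  show c: "continuous_on UNIV (\<lambda>\<omega>. Re (?H (of_real \<omega>)))"
    by (intro continuous_intros continuous_on_compose2[OF cont]) auto
  obtain F where F: "\<And>z. z \<in> ?S \<Longrightarrow> (F has_field_derivative ?H z) (at z within ?S)"
    using holomorphic_convex_primitive[OF conv finite.emptyI cont]
      layer_log_differentiable interior_subset by (metis (mono_tags) DiffD1 mem_Collect_eq subsetD)
  have bd: "cmod (F b - F a) \<le> B * cmod (b - a)"
    if "closed_segment a b \<subseteq> ?S" "\<And>z. z \<in> closed_segment a b \<Longrightarrow> cmod (?H z) \<le> B" for a b B
    by (rule field_differentiable_bound[where S = "closed_segment a b" and f' = ?H])
      (use that in \<open>auto intro: DERIV_subset[OF F]\<close>)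
  have seg: "closed_segment a b \<subseteq> ?S" if "Im a \<ge> 0" "Im b \<ge> 0" for a b
    using that conv by (intro closed_segment_subset) auto
  have 1: "cmod (F (of_real L) - F (Complex L \<eta>)) \<le> ?C * cmod (of_real L - Complex L \<eta>)"
    using seg[of "Complex L \<eta>" "of_real L"] \<eta>
    by (intro bd norm_layer_log_le) (auto simp: subset_iff)
  have 3: "cmod (F (Complex (-L) \<eta>) - F (of_real (-L))) \<le> ?C * cmod (Complex (-L) \<eta> - of_real (-L))"
    using seg[of "of_real (-L)" "Complex (-L) \<eta>"] \<eta>
    by (intro bd norm_layer_log_le) (auto simp: subset_iff)
  have 2: "cmod (F (Complex L \<eta>) - F (Complex (-L) \<eta>)) \<le> E * cmod (Complex L \<eta> - Complex (-L) \<eta>)"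
  proof (intro bd E)
    show "Im z = \<eta>" if "z \<in> closed_segment (Complex (-L) \<eta>) (Complex L \<eta>)" for z
      using that by (auto simp: closed_segment_def complex_eq_iff algebra_simps)
  qed (use seg \<eta> in auto)
  have m: "cmod (of_real L - Complex L \<eta>) = \<eta>" "cmod (Complex (-L) \<eta> - of_real (-L)) = \<eta>"
    using \<eta> by (simp_all add: cmod_def)
  have "Complex L \<eta> - Complex (-L) \<eta> = of_real (2 * L)" by (simp add: complex_eq_iff)
  then have m2: "cmod (Complex L \<eta> - Complex (-L) \<eta>) = 2 * L"
    using L by (simp only: norm_of_real abs_of_pos mult_pos_pos zero_less_numeral)
  have "cmod (F (of_real L) - F (of_real (-L)))
    \<le> cmod (F (of_real L) - F (Complex L \<eta>)) + cmod (F (Complex L \<eta>) - F (Complex (-L) \<eta>))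
       + cmod (F (Complex (-L) \<eta>) - F (of_real (-L)))"
    by norm
  also have "\<dots> \<le> 2 * \<eta> * ?C + 2 * L * E" using 1 2 3 unfolding m m2 unfolding mult.commute[of ?C \<eta>] mult.commute[of E] by linarith
  finally have FL: "cmod (F (of_real L) - F (of_real (-L))) \<le> 2 * \<eta> * ?C + 2 * L * E" .
  have "((\<lambda>\<omega>. ?H (of_real \<omega>)) has_integral (F (of_real L) - F (of_real (-L)))) {-L..L}"
  proof (rule fundamental_theorem_of_calculus)
    fix \<omega> assume "\<omega> \<in> {-L..L}"
    have 1: "(complex_of_real has_vector_derivative 1) (at \<omega> within {-L..L})"
      using has_vector_derivative_of_real[OF DERIV_ident[of "at \<omega> within {-L..L}"]] by simp
    have 2: "(F has_field_derivative ?H (of_real \<omega>)) (at (of_real \<omega>) within of_real ` {-L..L})"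
      by (rule DERIV_subset[OF F]) auto
    have "((\<lambda>x. F (of_real x)) has_vector_derivative 1 * ?H (of_real \<omega>)) (at \<omega> within {-L..L})"
      using field_vector_diff_chain_within[OF 1 2] by (simp add: o_def)
    then show "((\<lambda>x. F (of_real x)) has_vector_derivative ?H (of_real \<omega>)) (at \<omega> within {-L..L})" by simp
  qed (use L in auto)
  from has_integral_linear[OF this bounded_linear_Re]
  have "integral {-L..L} (\<lambda>\<omega>. Re (?H (of_real \<omega>))) = Re (F (of_real L) - F (of_real (-L)))"
    by (simp add: o_def integral_unique)
  then show "\<bar>integral {-L..L} (\<lambda>\<omega>. Re (?H (of_real \<omega>)))\<bar> \<le> 2 * \<eta> * ?C + 2 * L * E"
    using FL abs_Re_le_cmod[of "F (of_real L) - F (of_real (-L))"] by linarith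
qed

end

section \<open>Absolute continuity\<close>

text \<open>The inner condition of absolute continuity with both parameters exposed, so that a
  common \<delta> can be taken for several functions or finitely many intervals.\<close>

definition small_variation :: "real set \<Rightarrow> (real \<Rightarrow> 'a::real_normed_vector) \<Rightarrow> real \<Rightarrow> real \<Rightarrow> bool" where
  "small_variation S f \<delta> \<epsilon> \<longleftrightarrow>
     (\<forall>D. finite D \<and> (\<forall>(a, b)\<in>D. a < b \<and> {a..b} \<subseteq> S) \<and>
        disjoint_family_on (\<lambda>(a, b). {a<..<b}) D \<and> (\<Sum>(a, b)\<in>D. b - a) < \<delta>
        \<longrightarrow> (\<Sum>(a, b)\<in>D. norm (f b - f a)) < \<epsilon>)"

lemma abs_cont_on_iff: "abs_cont_on S f \<longleftrightarrow> (\<forall>\<epsilon>>0. \<exists>\<delta>>0. small_variation S f \<delta> \<epsilon>)"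
  unfolding abs_cont_on_def small_variation_def ..

lemma abs_cont_onE:
  assumes "abs_cont_on S f" "\<epsilon> > 0"
  obtains \<delta> where "\<delta> > 0" "small_variation S f \<delta> \<epsilon>"
  using assms unfolding abs_cont_on_iff by blast

lemma small_variationD:
  assumes "small_variation S f \<delta> \<epsilon>" "finite D" "\<And>a b. (a, b) \<in> D \<Longrightarrow> a < b \<and> {a..b} \<subseteq> S"
    "disjoint_family_on (\<lambda>(a, b). {a<..<b}) D" "(\<Sum>(a, b)\<in>D. b - a) < \<delta>"
  shows "(\<Sum>(a, b)\<in>D. norm (f b - f a)) < \<epsilon>"
  using assms unfolding small_variation_def by blast

lemma abs_cont_on_subset:
  assumes "abs_cont_on S f" "T \<subseteq> S"
  shows "abs_cont_on T f"
proof -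
  have "small_variation T f \<delta> \<epsilon>" if "small_variation S f \<delta> \<epsilon>" for \<delta> \<epsilon>
    unfolding small_variation_def
    by (intro allI impI small_variationD[OF that]) (use assms(2) in blast)+
  then show ?thesis using assms(1) unfolding abs_cont_on_iff by blast
qed

lemma abs_cont_on_cong:
  assumes "\<And>x. x \<in> S \<Longrightarrow> f x = g x"
  shows "abs_cont_on S f \<longleftrightarrow> abs_cont_on S g"
proof -
  have "(\<Sum>(a, b)\<in>D. norm (f b - f a)) = (\<Sum>(a, b)\<in>D. norm (g b - g a))"
    if "\<forall>(a, b)\<in>D. a < b \<and> {a..b} \<subseteq> S" for D
  proof (rule sum.cong[OF refl], clarify)
    fix a b assume "(a, b) \<in> D"
    then have "a < b" "{a..b} \<subseteq> S" using that by auto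
    then have "a \<in> S" "b \<in> S" by auto
    then show "norm (f b - f a) = norm (g b - g a)" using assms by simp
  qed
  then have "small_variation S f \<delta> \<epsilon> \<longleftrightarrow> small_variation S g \<delta> \<epsilon>" for \<delta> \<epsilon>
    unfolding small_variation_def by (intro all_cong1 imp_cong refl) auto
  then show ?thesis unfolding abs_cont_on_iff by simp
qed

lemma abs_cont_on_add:
  assumes "abs_cont_on S f" "abs_cont_on S g"
  shows "abs_cont_on S (\<lambda>x. f x + g x)"
  unfolding abs_cont_on_iff
proof (intro allI impI)
  fix \<epsilon> :: real assume "\<epsilon> > 0"
  then have e2: "\<epsilon> / 2 > 0" by simp
  obtain \<delta>1 where \<delta>1: "\<delta>1 > 0" "small_variation S f \<delta>1 (\<epsilon> / 2)"
    by (rule abs_cont_onE[OF assms(1) e2])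
  obtain \<delta>2 where \<delta>2: "\<delta>2 > 0" "small_variation S g \<delta>2 (\<epsilon> / 2)"
    by (rule abs_cont_onE[OF assms(2) e2])
  have "small_variation S (\<lambda>x. f x + g x) (min \<delta>1 \<delta>2) \<epsilon>"
    unfolding small_variation_def
  proof (intro allI impI)
    fix D :: "(real \<times> real) set"
    assume D: "finite D \<and> (\<forall>(a, b)\<in>D. a < b \<and> {a..b} \<subseteq> S) \<and>
      disjoint_family_on (\<lambda>(a, b). {a<..<b}) D \<and> (\<Sum>(a, b)\<in>D. b - a) < min \<delta>1 \<delta>2"
    have "(\<Sum>(a, b)\<in>D. norm (f b + g b - (f a + g a)))
        \<le> (\<Sum>(a, b)\<in>D. norm (f b - f a) + norm (g b - g a))"
      by (intro sum_mono) (auto simp: add_diff_add intro: norm_triangle_ineq)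
    also have "\<dots> = (\<Sum>(a, b)\<in>D. norm (f b - f a)) + (\<Sum>(a, b)\<in>D. norm (g b - g a))"
      by (simp add: split_beta sum.distrib)
    also have "\<dots> < \<epsilon> / 2 + \<epsilon> / 2"
      using D by (intro add_strict_mono small_variationD[OF \<delta>1(2)] small_variationD[OF \<delta>2(2)]) auto
    finally show "(\<Sum>(a, b)\<in>D. norm (f b + g b - (f a + g a))) < \<epsilon>" by simp
  qed
  then show "\<exists>\<delta>>0. small_variation S (\<lambda>x. f x + g x) \<delta> \<epsilon>"
    using \<delta>1(1) \<delta>2(1) by (metis min_less_iff_conj)
qed

lemma lipschitz_imp_abs_cont_on:
  fixes f :: "real \<Rightarrow> 'a::real_normed_vector"
  assumes "\<And>x y. x \<in> S \<Longrightarrow> y \<in> S \<Longrightarrow> norm (f y - f x) \<le> B * \<bar>y - x\<bar>"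
  shows "abs_cont_on S f"
  unfolding abs_cont_on_iff
proof (intro allI impI)
  fix \<epsilon> :: real assume e: "\<epsilon> > 0"
  have "small_variation S f (\<epsilon> / (\<bar>B\<bar> + 1)) \<epsilon>"
    unfolding small_variation_def
  proof (intro allI impI)
    fix D :: "(real \<times> real) set"
    assume D: "finite D \<and> (\<forall>(a, b)\<in>D. a < b \<and> {a..b} \<subseteq> S) \<and>
      disjoint_family_on (\<lambda>(a, b). {a<..<b}) D \<and> (\<Sum>(a, b)\<in>D. b - a) < \<epsilon> / (\<bar>B\<bar> + 1)"
    have "(\<Sum>(a, b)\<in>D. norm (f b - f a)) \<le> (\<Sum>(a, b)\<in>D. (\<bar>B\<bar> + 1) * (b - a))"
    proof (rule sum_mono, clarify)
      fix a b assume "(a, b) \<in> D"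
      then have ab: "a < b" "a \<in> S" "b \<in> S" using D by force+
      have "norm (f b - f a) \<le> B * \<bar>b - a\<bar>" using ab(2,3) by (rule assms)
      also have "\<dots> \<le> (\<bar>B\<bar> + 1) * \<bar>b - a\<bar>" by (intro mult_right_mono) auto
      finally show "norm (f b - f a) \<le> (\<bar>B\<bar> + 1) * (b - a)" using ab by simp
    qed
    also have "\<dots> = (\<bar>B\<bar> + 1) * (\<Sum>(a, b)\<in>D. b - a)" by (simp add: sum_distrib_left split_beta)
    also have "\<dots> < (\<bar>B\<bar> + 1) * (\<epsilon> / (\<bar>B\<bar> + 1))"
      using D by (intro mult_strict_left_mono) auto
    finally show "(\<Sum>(a, b)\<in>D. norm (f b - f a)) < \<epsilon>" by simp
  qed
  moreover have "\<epsilon> / (\<bar>B\<bar> + 1) > 0" using e by simp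
  ultimately show "\<exists>\<delta>>0. small_variation S f \<delta> \<epsilon>" by blast
qed

text \<open>A family consisting of one interval suffices; \<open>is_interval\<close> guarantees that
  the segment between two points stays inside S.\<close>

lemma abs_cont_on_uniformly_continuous:
  fixes f :: "real \<Rightarrow> 'a::real_normed_vector"
  assumes "abs_cont_on S f" "is_interval S"
  shows "uniformly_continuous_on S f"
  unfolding uniformly_continuous_on_def
proof (intro allI impI)
  fix \<epsilon> :: real assume "\<epsilon> > 0"
  obtain \<delta> where \<delta>: "\<delta> > 0" "small_variation S f \<delta> \<epsilon>"
    by (rule abs_cont_onE[OF assms(1) \<open>\<epsilon> > 0\<close>])
  have *: "norm (f y - f x) < \<epsilon>" if "x \<in> S" "y \<in> S" "x < y" "y - x < \<delta>" for x y
  proof -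
    have "{x..y} \<subseteq> S" using mem_is_interval_1_I[OF assms(2) that(1,2)] by auto
    then show ?thesis using small_variationD[OF \<delta>(2), of "{(x, y)}"] that(3,4)
      by (simp add: disjoint_family_on_def)
  qed
  show "\<exists>d>0. \<forall>x\<in>S. \<forall>x'\<in>S. dist x' x < d \<longrightarrow> dist (f x') (f x) < \<epsilon>"
  proof (intro exI[of _ \<delta>] conjI ballI impI \<delta>(1))
    fix x x' assume "x \<in> S" "x' \<in> S" "dist x' x < \<delta>"
    then show "dist (f x') (f x) < \<epsilon>"
      using *[of x x'] *[of x' x] \<open>\<epsilon> > 0\<close>
      by (cases x x' rule: linorder_cases) (auto simp: dist_norm norm_minus_commute abs_if)
  qed
qed

text \<open>
  Choose a gauge that puts balls around exceptional points into a small open superset of \<open>N\<close> and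
  uses the zero derivative elsewhere; a fine division then splits \<open>f b - f a\<close> into two small sums.
\<close>

lemma abs_cont_on_derivative_zero_eq:
  fixes f :: "real \<Rightarrow> 'a::real_normed_vector"
  assumes ac: "abs_cont_on {a..b} f" and ab: "a \<le> b"
    and N: "negligible N"
    and D: "\<And>x. x \<in> {a..b} - N \<Longrightarrow> (f has_vector_derivative 0) (at x)"
  shows "f a = f b"
proof (rule ccontr)
  assume "f a \<noteq> f b"
  \<comment> \<open>The \<open>+ 1\<close> keeps the denominator positive when a = b and makes
    \<open>e * (b - a)\<close> strictly smaller than half of the supposed increment.\<close>
  define e where "e = norm (f b - f a) / (2 * (b - a + 1))"
  have e: "e > 0" using \<open>f a \<noteq> f b\<close> ab by (simp add: e_def)
  have half: "norm (f b - f a) / 2 > 0" using \<open>f a \<noteq> f b\<close> by simp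
  obtain \<delta> where \<delta>: "\<delta> > 0" "small_variation {a..b} f \<delta> (norm (f b - f a) / 2)"
    by (rule abs_cont_onE[OF ac half])
  have "N \<in> sets lebesgue" using N by (simp add: negligible_imp_sets)
  then obtain T where T: "open T" "N \<subseteq> T" "T - N \<in> lmeasurable" "emeasure lebesgue (T - N) < ennreal \<delta>"
    using sets_lebesgue_outer_open \<delta>(1) by blast
  have mT: "T \<in> lmeasurable" "measure lebesgue T < \<delta>"
  proof -
    have "N \<in> lmeasurable" "measure lebesgue N = 0" using N by (auto simp: negligible_iff_measure)
    moreover have "T = (T - N) \<union> N" using T by auto
    ultimately show "T \<in> lmeasurable" using T by (metis fmeasurable.Un)
    have "measure lebesgue T \<le> measure lebesgue (T - N) + measure lebesgue N"
      using \<open>T = (T - N) \<union> N\<close> T \<open>N \<in> lmeasurable\<close> by (metis measure_Un_le fmeasurableD)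
    moreover have "measure lebesgue (T - N) < \<delta>"
      using T(3,4) \<delta>(1) by (simp add: emeasure_eq_measure2 ennreal_less_iff)
    ultimately show "measure lebesgue T < \<delta>" using \<open>measure lebesgue N = 0\<close> by simp
  qed
  have "\<exists>d>0. \<forall>y. \<bar>y - x\<bar> < d \<longrightarrow> norm (f y - f x) \<le> e * \<bar>y - x\<bar>" if "x \<in> {a..b} - N" for x
  proof -
    have "\<forall>e>0. \<exists>d>0. \<forall>y. norm (y - x) < d \<longrightarrow> norm (f y - f x - (y - x) *\<^sub>R 0) \<le> e * norm (y - x)"
      using D[OF that] unfolding has_vector_derivative_def has_derivative_at_alt by blast
    then show ?thesis using e by (auto simp: real_norm_def)
  qed
  then obtain d where d: "\<And>x. x \<in> {a..b} - N \<Longrightarrow> d x > 0"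
    "\<And>x y. x \<in> {a..b} - N \<Longrightarrow> \<bar>y - x\<bar> < d x \<Longrightarrow> norm (f y - f x) \<le> e * \<bar>y - x\<bar>"
    by metis
  \<comment> \<open>At a tag in N the gauge forces the interval into T, whose measure is below
    \<delta>; at other tags it forces the slope of f to be at most e.\<close>
  define g where "g x = (if x \<in> N then T else if x \<in> {a..b} then ball x (d x) else UNIV)" for x
  have "gauge g" unfolding gauge_def g_def using T d by auto
  then obtain p where p: "p tagged_division_of {a..b}" "g fine p"
    using fine_division_exists_real by blast
  have fin: "finite p" using p(1) by (rule tagged_division_of_finite)
  note td = tagged_division_ofD[OF p(1)]
  define h where "h K = f (Sup K) - f (Inf K)" for K :: "real set"
  have K: "\<exists>u v. K = {u..v} \<and> u \<le> v \<and> x \<in> {u..v} \<and> a \<le> u \<and> v \<le> b" if xK: "(x, K) \<in> p" for x K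
  proof -
    obtain u v where "K = {u..v}" using td(4)[OF xK] by (auto simp: box_real)
    moreover have "x \<in> K" "K \<subseteq> {a..b}" using td(2,3)[OF xK] by (auto simp: box_real)
    ultimately show ?thesis by (intro exI[of _ u] exI[of _ v]) auto
  qed
  have sum: "(\<Sum>(x, K)\<in>p. h K) = f b - f a"
    unfolding h_def using additive_tagged_division_1[OF ab p(1), of f] by simp
  define p1 where "p1 = {xK \<in> p. fst xK \<in> N}"
  define p2 where "p2 = p - p1"
  have p12: "p = p1 \<union> p2" "p1 \<inter> p2 = {}" "finite p1" "finite p2"
    using fin by (auto simp: p1_def p2_def)
  have s2: "norm (\<Sum>(x, K)\<in>p2. h K) \<le> (\<Sum>(x, K)\<in>p2. e * measure lborel K)"
  proof (rule sum_norm_le, clarify)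
    fix x K assume xK: "(x, K) \<in> p2"
    then have "(x, K) \<in> p" "x \<notin> N" by (auto simp: p1_def p2_def)
    obtain u v where uv: "K = {u..v}" "u \<le> v" "x \<in> {u..v}" "a \<le> u" "v \<le> b"
      using K[OF \<open>(x, K) \<in> p\<close>] by blast
    have "K \<subseteq> g x" using p(2) \<open>(x, K) \<in> p\<close> by (auto simp: fine_def)
    then have "K \<subseteq> ball x (d x)" using \<open>x \<notin> N\<close> uv by (auto simp: g_def)
    moreover have "u \<in> K" "v \<in> K" using uv by auto
    ultimately have "u \<in> ball x (d x)" "v \<in> ball x (d x)" by blast+
    then have "\<bar>u - x\<bar> < d x" "\<bar>v - x\<bar> < d x" by (simp_all add: dist_real_def abs_minus_commute)
    then have "norm (f u - f x) \<le> e * \<bar>u - x\<bar>" "norm (f v - f x) \<le> e * \<bar>v - x\<bar>"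
      using d(2)[of x u] d(2)[of x v] \<open>x \<notin> N\<close> uv by simp_all
    moreover have "norm (f v - f u) \<le> norm (f v - f x) + norm (f u - f x)"
      using norm_triangle_ineq4[of "f v - f x" "f u - f x"] by simp
    moreover have "e * \<bar>u - x\<bar> + e * \<bar>v - x\<bar> = e * (v - u)" using uv by (simp add: algebra_simps abs_if)
    ultimately show "norm (h K) \<le> e * measure lborel K" using uv by (simp add: h_def)
  qed
  also have "\<dots> \<le> (\<Sum>(x, K)\<in>p. e * measure lborel K)"
    using p12 e by (intro sum_mono2) auto
  also have "\<dots> = e * (b - a)"
    using additive_content_tagged_division[of p a b] p(1) ab
    by (simp add: sum_distrib_left[symmetric] split_beta box_real)
  also have "\<dots> < norm (f b - f a) / 2"
  proof -
    have "e * (b - a) < e * (b - a + 1)" using e by simp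
    also have "\<dots> = norm (f b - f a) / 2" using ab by (simp add: e_def field_simps)
    finally show ?thesis .
  qed
  finally have s2: "norm (\<Sum>(x, K)\<in>p2. h K) < norm (f b - f a) / 2" .
  define p3 where "p3 = {xK \<in> p1. Inf (snd xK) < Sup (snd xK)}"
  define E where "E = (\<lambda>xK. (Inf (snd xK), Sup (snd xK))) ` p3"
  have p3: "\<exists>u v. K = {u..v} \<and> u < v \<and> a \<le> u \<and> v \<le> b \<and> K \<subseteq> T" if "(x, K) \<in> p3" for x K
  proof -
    have xp: "(x, K) \<in> p" "x \<in> N" using that by (auto simp: p3_def p1_def)
    obtain u v where uv: "K = {u..v}" "u \<le> v" "x \<in> {u..v}" "a \<le> u" "v \<le> b"
      using K[OF xp(1)] by blast
    have "K \<subseteq> g x" using p(2) xp by (auto simp: fine_def)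
    then have "K \<subseteq> T" using xp by (auto simp: g_def)
    moreover have "u < v" using that uv by (auto simp: p3_def)
    ultimately show ?thesis using uv by blast
  qed
  have disj: "interior K \<inter> interior K' = {}" if "(x, K) \<in> p3" "(x', K') \<in> p3" "(x, K) \<noteq> (x', K')" for x K x' K'
    using td(5)[of x K x' K'] that by (auto simp: p3_def p1_def)
  have injE: "inj_on (\<lambda>xK. (Inf (snd xK), Sup (snd xK))) p3"
  proof (rule inj_onI, clarsimp)
    fix x K x' K' assume a: "(x, K) \<in> p3" "(x', K') \<in> p3" "Inf K = Inf K'" "Sup K = Sup K'"
    obtain u v where uv: "K = {u..v}" "u < v" using p3[OF a(1)] by blast
    obtain u' v' where uv': "K' = {u'..v'}" "u' < v'" using p3[OF a(2)] by blast
    have "K = K'" using a uv uv' by simp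
    moreover have "interior K \<noteq> {}" using uv by simp
    ultimately show "x = x' \<and> K = K'" using disj[OF a(1,2)] by auto
  qed
  have fE: "finite E" using p12 by (simp add: E_def p3_def)
  have E1: "u < v \<and> {u..v} \<subseteq> {a..b}" if uv: "(u, v) \<in> E" for u v
  proof -
    obtain x K where "(x, K) \<in> p3" "u = Inf K" "v = Sup K" using uv by (auto simp: E_def)
    then show "u < v \<and> {u..v} \<subseteq> {a..b}" using p3[of x K] by auto
  qed
  have E2: "disjoint_family_on (\<lambda>(u, v). {u<..<v}) E"
    unfolding disjoint_family_on_def
  proof (intro ballI impI)
    fix I J assume IJ: "I \<in> E" "J \<in> E" "I \<noteq> J"
    obtain x K where K1: "(x, K) \<in> p3" "I = (Inf K, Sup K)" using IJ(1) by (auto simp: E_def)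
    obtain x' K' where K2: "(x', K') \<in> p3" "J = (Inf K', Sup K')" using IJ(2) by (auto simp: E_def)
    have "(x, K) \<noteq> (x', K')" using IJ K1 K2 by auto
    from disj[OF K1(1) K2(1) this] have "interior K \<inter> interior K' = {}" .
    moreover obtain u v where "K = {u..v}" "u < v" using p3[OF K1(1)] by blast
    moreover obtain u' v' where "K' = {u'..v'}" "u' < v'" using p3[OF K2(1)] by blast
    ultimately show "(case I of (u, v) \<Rightarrow> {u<..<v}) \<inter> (case J of (u, v) \<Rightarrow> {u<..<v}) = {}"
      using K1(2) K2(2) by (simp add: interior_atLeastAtMost_real)
  qed
  have E3: "(\<Sum>(u, v)\<in>E. v - u) < \<delta>"
  proof -
    have "(\<Sum>(u, v)\<in>E. v - u) = (\<Sum>I\<in>E. measure lebesgue (case I of (u, v) \<Rightarrow> {u<..<v}))"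
      using E1 by (intro sum.cong refl) force
    also have "\<dots> = measure lebesgue (\<Union>I\<in>E. case I of (u, v) \<Rightarrow> {u<..<v})"
      using E2 fE by (intro measure_finite_Union[symmetric]) (auto dest!: E1 simp: less_imp_le)
    also have "\<dots> \<le> measure lebesgue T"
    proof (rule measure_mono_fmeasurable[OF _ _ mT(1)])
      show "(\<Union>I\<in>E. case I of (u, v) \<Rightarrow> {u<..<v}) \<subseteq> T"
      proof (rule UN_least)
        fix I assume "I \<in> E"
        then obtain x K where K1: "(x, K) \<in> p3" "I = (Inf K, Sup K)" by (auto simp: E_def)
        obtain u v where "K = {u..v}" "u < v" "K \<subseteq> T" using p3[OF K1(1)] by blast
        then show "(case I of (u, v) \<Rightarrow> {u<..<v}) \<subseteq> T"
          using K1(2) greaterThanLessThan_subseteq_atLeastAtMost_iff[of u v u v] by auto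
      qed
    qed (use fE in \<open>auto intro!: sets.finite_UN\<close>)
    finally show ?thesis using mT by simp
  qed
  have "norm (\<Sum>(x, K)\<in>p1. h K) \<le> (\<Sum>xK\<in>p1. norm (h (snd xK)))"
    by (rule sum_norm_le) auto
  also have "\<dots> = (\<Sum>xK\<in>p3. norm (h (snd xK)))"
  proof (rule sum.mono_neutral_right)
    show "\<forall>i\<in>p1 - p3. norm (h (snd i)) = 0"
    proof clarify
      fix x K assume xK: "(x, K) \<in> p1" "(x, K) \<notin> p3"
      then have "(x, K) \<in> p" by (auto simp: p1_def)
      from K[OF this] xK show "norm (h (snd (x, K))) = 0" by (auto simp: p3_def h_def)
    qed
  qed (auto simp: p3_def p12)
  also have "\<dots> = (\<Sum>(u, v)\<in>E. norm (f v - f u))"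
    unfolding E_def sum.reindex[OF injE] by (simp add: h_def)
  also have "\<dots> < norm (f b - f a) / 2"
    by (rule small_variationD[OF \<delta>(2) fE E1 E2 E3])
  finally have s1: "norm (\<Sum>(x, K)\<in>p1. h K) < norm (f b - f a) / 2" .
  have "f b - f a = (\<Sum>(x, K)\<in>p1. h K) + (\<Sum>(x, K)\<in>p2. h K)"
    unfolding sum[symmetric] using sum.union_disjoint[OF p12(3,4,2)] by (simp only: p12(1)[symmetric])
  then have "norm (f b - f a) \<le> norm (\<Sum>(x, K)\<in>p1. h K) + norm (\<Sum>(x, K)\<in>p2. h K)"
    by (simp only: norm_triangle_ineq)
  with s1 s2 show False by linarith
qed

section \<open>Linear differential equations with terminal data\<close>

text \<open>The integrating factor exp (K x) turns the right-hand side of the hypothesis into a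
  nondecreasing function G: its derivative is K exp (K x) times the nonnegative slack in the
  hypothesis. Comparing G x with G b gives the bound.\<close>

lemma gronwall_backward:
  fixes \<phi> :: "real \<Rightarrow> real"
  assumes cont: "continuous_on {a..b} \<phi>" and K: "K \<ge> 0"
    and le: "\<And>x. x \<in> {a..b} \<Longrightarrow> \<phi> x \<le> c + K * integral {x..b} \<phi>"
    and x: "x \<in> {a..b}"
  shows "\<phi> x \<le> c * exp (K * (b - x))"
proof -
  define G where "G = (\<lambda>x. (c + K * integral {x..b} \<phi>) * exp (K * x))"
  have int: "\<phi> integrable_on {a..b}" using cont by (rule integrable_continuous_real)
  have contG: "continuous_on {a..b} G"
    unfolding G_def by (intro continuous_intros indefinite_integral_continuous_1' int)
  have "G x \<le> G b"
  proof (rule DERIV_nonneg_imp_increasing_open[of x b])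
    fix t assume t: "x < t" "t < b"
    then have tab: "t \<in> {a<..<b}" using x by auto
    have "((\<lambda>u. integral {a..u} \<phi>) has_real_derivative \<phi> t) (at t within {a..b})"
      using cont tab by (intro integral_has_real_derivative) auto
    then have "((\<lambda>u. integral {a..u} \<phi>) has_real_derivative \<phi> t) (at t)"
      using tab by (simp add: at_within_Icc_at)
    then have "((\<lambda>u. integral {a..b} \<phi> - integral {a..u} \<phi>) has_real_derivative - \<phi> t) (at t)"
      by (auto intro!: derivative_eq_intros)
    then have d: "((\<lambda>u. integral {u..b} \<phi>) has_real_derivative - \<phi> t) (at t)"
    proof (rule has_field_derivative_transform_within_open[of _ _ _ "{a<..<b}"])
      show "integral {a..b} \<phi> - integral {a..u} \<phi> = integral {u..b} \<phi>" if "u \<in> {a<..<b}" for u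
        using Henstock_Kurzweil_Integration.integral_combine[of a u b \<phi>] int that by auto
    qed (use tab in auto)
    have "(G has_real_derivative K * (c + K * integral {t..b} \<phi> - \<phi> t) * exp (K * t)) (at t)"
      unfolding G_def by (rule derivative_eq_intros d refl | simp)+ (simp add: algebra_simps)
    moreover have "K * (c + K * integral {t..b} \<phi> - \<phi> t) * exp (K * t) \<ge> 0"
      using K le[of t] tab by simp
    ultimately show "\<exists>y. (G has_real_derivative y) (at t) \<and> 0 \<le> y" by blast
  qed (use x contG in \<open>auto intro: continuous_on_subset\<close>)
  then have "(c + K * integral {x..b} \<phi>) * exp (K * x) \<le> c * exp (K * b)" by (simp add: G_def)
  then have "c + K * integral {x..b} \<phi> \<le> c * exp (K * b) / exp (K * x)"
    by (simp add: pos_le_divide_eq)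
  also have "\<dots> = c * exp (K * (b - x))" by (simp add: exp_diff algebra_simps)
  finally show ?thesis using le[OF x] by linarith
qed

text \<open>
  Initial value problems are posed backwards from the right end point \<open>b\<close>, since the condition
  \<open>\<xi> = 0\<close> there fixes the solution up to a scalar.
\<close>

definition terminal_solution ::
    "real \<Rightarrow> real \<Rightarrow> (real \<Rightarrow> 'a \<Rightarrow> 'a::euclidean_space) \<Rightarrow> 'a \<Rightarrow> (real \<Rightarrow> 'a) \<Rightarrow> bool" where
  "terminal_solution a b A Y1 Y \<longleftrightarrow>
     continuous_on {a..b} Y \<and> (\<forall>x\<in>{a..b}. Y x = Y1 - integral {x..b} (\<lambda>t. A t (Y t)))"

text \<open>Since the impedance may jump, dependence on t is controlled through integrability along
  continuous curves, which is what the successive integrals below require.\<close>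

locale linear_ode =
  fixes a b K :: real and A :: "real \<Rightarrow> 'a \<Rightarrow> 'a::euclidean_space"
  assumes ab: "a \<le> b" and K: "K \<ge> 0"
    and lin: "\<And>x. linear (A x)"
    and bound: "\<And>x y. x \<in> {a..b} \<Longrightarrow> norm (A x y) \<le> K * norm y"
    and int: "\<And>\<phi>. continuous_on {a..b} \<phi> \<Longrightarrow> (\<lambda>t. A t (\<phi> t)) integrable_on {a..b}"
begin

lemma int_sub:
  assumes "continuous_on {a..b} \<phi>" "x \<in> {a..b}"
  shows "(\<lambda>t. A t (\<phi> t)) integrable_on {x..b}"
  using int[OF assms(1)] by (rule integrable_on_subinterval) (use assms in auto)

text \<open>The terms of the Neumann series, that is, the increments between successive Picard
  iterates.\<close>

primrec picard :: "'a \<Rightarrow> nat \<Rightarrow> real \<Rightarrow> 'a" where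
  "picard Y1 0 = (\<lambda>_. Y1)"
| "picard Y1 (Suc n) = (\<lambda>x. - integral {x..b} (\<lambda>t. A t (picard Y1 n t)))"

lemma continuous_picard: "continuous_on {a..b} (picard Y1 n)"
  by (induction n) (auto intro!: continuous_intros indefinite_integral_continuous_1' int)

lemma norm_picard_le:
  assumes "x \<in> {a..b}"
  shows "norm (picard Y1 n x) \<le> norm Y1 * ((K * (b - x)) ^ n / fact n)"
  using assms
proof (induction n arbitrary: x)
  case (Suc n)
  define P where "P = (\<lambda>t. norm Y1 * ((K * (b - t)) ^ n / fact n))"
  have "((\<lambda>t. K * P t) has_integral
      (- (norm Y1 * ((K * (b - b)) ^ Suc n / fact (Suc n))) - - (norm Y1 * ((K * (b - x)) ^ Suc n / fact (Suc n))))) {x..b}"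
  proof (rule fundamental_theorem_of_calculus)
    fix t assume "t \<in> {x..b}"
    have "((\<lambda>t. - (norm Y1 * ((K * (b - t)) ^ Suc n / fact (Suc n)))) has_real_derivative
        - (norm Y1 * (of_nat (Suc n) * (K * (b - t)) ^ n * (- K) / fact (Suc n)))) (at t within {x..b})"
      by (rule derivative_eq_intros refl | simp)+
    also have "- (norm Y1 * (of_nat (Suc n) * (K * (b - t)) ^ n * (- K) / fact (Suc n))) = K * P t"
      unfolding P_def fact_Suc by (simp add: field_simps del: of_nat_Suc)
    finally show "((\<lambda>t. - (norm Y1 * ((K * (b - t)) ^ Suc n / fact (Suc n)))) has_vector_derivative K * P t)
        (at t within {x..b})"
      by (simp add: has_real_derivative_iff_has_vector_derivative)
  qed (use Suc in auto)
  then have P: "((\<lambda>t. K * P t) has_integral norm Y1 * ((K * (b - x)) ^ Suc n / fact (Suc n))) {x..b}"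
    by simp
  have "norm (integral {x..b} (\<lambda>t. A t (picard Y1 n t))) \<le> integral {x..b} (\<lambda>t. K * P t)"
  proof (rule integral_norm_bound_integral)
    fix t assume t: "t \<in> {x..b}"
    have "norm (A t (picard Y1 n t)) \<le> K * norm (picard Y1 n t)" using bound t Suc by auto
    also have "\<dots> \<le> K * P t" unfolding P_def using Suc t K by (intro mult_left_mono Suc.IH) auto
    finally show "norm (A t (picard Y1 n t)) \<le> K * P t" .
  qed (use int_sub[OF continuous_picard] Suc P in auto)
  then show ?case unfolding integral_unique[OF P] by (simp only: picard.simps norm_minus_cancel)
qed simp

text \<open>The terms are dominated by those of an exponential series, so the partial sums converge
  uniformly. By linearity they satisfy the Picard iteration, and uniform convergence lets the limit
  pass under the integral.\<close>

lemma terminal_solution_exists: "\<exists>Y. terminal_solution a b A Y1 Y"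
proof -
  define Y where "Y = (\<lambda>x. \<Sum>n. picard Y1 n x)"
  define S where "S = (\<lambda>n x. \<Sum>k<n. picard Y1 k x)"
  have lim: "uniform_limit {a..b} S Y sequentially"
    unfolding S_def Y_def
  proof (rule Weierstrass_m_test)
    fix n x assume x: "x \<in> {a..b}"
    have "norm (picard Y1 n x) \<le> norm Y1 * ((K * (b - x)) ^ n / fact n)"
      using x by (rule norm_picard_le)
    also have "\<dots> \<le> norm Y1 * ((K * (b - a)) ^ n / fact n)"
      using x K by (intro mult_left_mono divide_right_mono power_mono) auto
    finally show "norm (picard Y1 n x) \<le> norm Y1 * ((K * (b - a)) ^ n / fact n)" .
  next
    show "summable (\<lambda>n. norm Y1 * ((K * (b - a)) ^ n / fact n))"
      using summable_exp_generic[of "K * (b - a)"]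
      by (intro summable_mult) (simp add: divide_inverse mult.commute)
  qed
  have contS: "continuous_on {a..b} (S n)" for n
    unfolding S_def by (intro continuous_intros continuous_picard)
  have contY: "continuous_on {a..b} Y"
    by (rule uniform_limit_theorem[OF _ lim]) (auto simp: contS)
  have rec: "S (Suc n) x = Y1 - integral {x..b} (\<lambda>t. A t (S n t))" if x: "x \<in> {a..b}" for n x
  proof -
    have "(\<lambda>t. A t (S n t)) = (\<lambda>t. \<Sum>k<n. A t (picard Y1 k t))"
      using lin by (simp add: S_def linear_sum)
    then have "integral {x..b} (\<lambda>t. A t (S n t)) = (\<Sum>k<n. integral {x..b} (\<lambda>t. A t (picard Y1 k t)))"
      using int_sub[OF continuous_picard x] by (simp add: integral_sum)
    then show ?thesis unfolding S_def by (simp add: sum.lessThan_Suc_shift sum_negf del: sum.lessThan_Suc)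
  qed
  have "Y x = Y1 - integral {x..b} (\<lambda>t. A t (Y t))" if x: "x \<in> {a..b}" for x
  proof (rule LIMSEQ_unique)
    show "(\<lambda>n. S (Suc n) x) \<longlonglongrightarrow> Y x"
      using tendsto_uniform_limitI[OF lim x] by (rule LIMSEQ_Suc)
    have "(\<lambda>n. integral {x..b} (\<lambda>t. A t (S n t))) \<longlonglongrightarrow> integral {x..b} (\<lambda>t. A t (Y t))"
    proof (rule tendstoI)
      fix e :: real assume "e > 0"
      define e' where "e' = e / (K * (b - a) + 1)"
      have pos: "K * (b - a) + 1 > 0" using K ab by (simp add: add_nonneg_pos)
      then have "e' > 0" using \<open>e > 0\<close> by (simp add: e'_def)
      from uniform_limitD[OF lim this]
      show "\<forall>\<^sub>F n in sequentially. dist (integral {x..b} (\<lambda>t. A t (S n t))) (integral {x..b} (\<lambda>t. A t (Y t))) < e"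
      proof eventually_elim
        case (elim n)
        have "integral {x..b} (\<lambda>t. A t (S n t)) - integral {x..b} (\<lambda>t. A t (Y t))
            = integral {x..b} (\<lambda>t. A t (S n t) - A t (Y t))"
          by (intro integral_diff[symmetric] int_sub contS contY x)
        also have "norm \<dots> \<le> integral {x..b} (\<lambda>t. K * e')"
        proof (rule integral_norm_bound_integral)
          fix t assume t: "t \<in> {x..b}"
          have "A t (S n t) - A t (Y t) = A t (S n t - Y t)" using lin by (simp add: linear_diff)
          also have "norm \<dots> \<le> K * norm (S n t - Y t)" using bound t x by auto
          also have "\<dots> \<le> K * e'" using elim t x K by (intro mult_left_mono) (auto simp: dist_norm less_imp_le)
          finally show "norm (A t (S n t) - A t (Y t)) \<le> K * e'" .
        qed (auto intro!: integrable_diff int_sub contS contY x)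
        also have "\<dots> = (b - x) * (K * e')" using x by simp
        also have "\<dots> \<le> (b - a) * (K * e')" using x K \<open>e' > 0\<close> by (intro mult_right_mono) auto
        also have "\<dots> < (K * (b - a) + 1) * e'" using \<open>e' > 0\<close> by (simp add: algebra_simps)
        also have "\<dots> = e" using pos by (simp add: e'_def)
        finally show ?case by (simp add: dist_norm)
      qed
    qed
    then show "(\<lambda>n. S (Suc n) x) \<longlonglongrightarrow> Y1 - integral {x..b} (\<lambda>t. A t (Y t))"
      unfolding rec[OF x] by (intro tendsto_intros)
  qed
  with contY show ?thesis unfolding terminal_solution_def by blast
qed

text \<open>The difference of the right-hand sides is split as (B - A) Y + A (Y - Z). The
  coefficient error is thus measured along Y only, while the Lipschitz bound comes from A. With B =
  A this gives uniqueness.\<close>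

lemma terminal_solution_perturb:
  assumes Z: "terminal_solution a b A Z1 Z" and Y: "terminal_solution a b B Y1 Y"
    and BY: "(\<lambda>t. B t (Y t)) integrable_on {a..b}"
    and D: "(\<lambda>t. norm (B t (Y t) - A t (Y t))) integrable_on {a..b}"
    and x: "x \<in> {a..b}"
  shows "norm (Y x - Z x)
     \<le> (norm (Y1 - Z1) + integral {a..b} (\<lambda>t. norm (B t (Y t) - A t (Y t)))) * exp (K * (b - x))"
proof (rule gronwall_backward[OF _ K _ x])
  let ?d = "\<lambda>t. norm (B t (Y t) - A t (Y t))"
  have contY: "continuous_on {a..b} Y" and contZ: "continuous_on {a..b} Z"
    using Y Z by (auto simp: terminal_solution_def)
  show cont: "continuous_on {a..b} (\<lambda>x. norm (Y x - Z x))"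
    by (intro continuous_intros contY contZ)
  fix x assume x: "x \<in> {a..b}"
  have sub: "{x..b} \<subseteq> {a..b}" using x by auto
  have iBY: "(\<lambda>t. B t (Y t)) integrable_on {x..b}" by (rule integrable_on_subinterval[OF BY sub])
  have iD: "?d integrable_on {x..b}" by (rule integrable_on_subinterval[OF D sub])
  have iN: "(\<lambda>t. norm (Y t - Z t)) integrable_on {x..b}"
    by (rule integrable_on_subinterval[OF integrable_continuous_real[OF cont] sub])
  have "Y x - Z x = (Y1 - Z1) - integral {x..b} (\<lambda>t. B t (Y t) - A t (Z t))"
    using Y Z x iBY int_sub[OF contZ x] by (simp add: terminal_solution_def integral_diff)
  also have "norm \<dots> \<le> norm (Y1 - Z1) + norm (integral {x..b} (\<lambda>t. B t (Y t) - A t (Z t)))"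
    by (rule norm_triangle_ineq4)
  also have "norm (integral {x..b} (\<lambda>t. B t (Y t) - A t (Z t)))
      \<le> integral {x..b} (\<lambda>t. ?d t + K * norm (Y t - Z t))"
  proof (rule integral_norm_bound_integral)
    fix t assume t: "t \<in> {x..b}"
    have "B t (Y t) - A t (Z t) = (B t (Y t) - A t (Y t)) + A t (Y t - Z t)"
      using lin by (simp add: linear_diff)
    also have "norm \<dots> \<le> ?d t + norm (A t (Y t - Z t))" by (rule norm_triangle_ineq)
    also have "norm (A t (Y t - Z t)) \<le> K * norm (Y t - Z t)" using bound t x by auto
    finally show "norm (B t (Y t) - A t (Z t)) \<le> ?d t + K * norm (Y t - Z t)" by simp
  qed (use iBY int_sub[OF contZ x] iD iN in \<open>auto intro!: integrable_diff integrable_add integrable_on_mult_right\<close>)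
  also have "\<dots> = integral {x..b} ?d + K * integral {x..b} (\<lambda>t. norm (Y t - Z t))"
    using iD iN by (subst integral_add) (auto intro!: integrable_on_mult_right)
  also have "integral {x..b} ?d \<le> integral {a..b} ?d"
    by (rule integral_subset_le[OF sub iD D]) auto
  finally show "norm (Y x - Z x) \<le> norm (Y1 - Z1) + integral {a..b} ?d
      + K * integral {x..b} (\<lambda>t. norm (Y t - Z t))"
    by simp
qed

lemma terminal_solution_unique:
  assumes Y: "terminal_solution a b A Y1 Y" and Z: "terminal_solution a b A Y1 Z" and "x \<in> {a..b}"
  shows "Y x = Z x"
proof -
  have "continuous_on {a..b} Y" using Y by (simp add: terminal_solution_def)
  then show ?thesis
    using terminal_solution_perturb[OF Z Y int _ assms(3)] by (simp add: integrable_0)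
qed

end

text \<open>The perturbation estimate is applied with \<open>An n\<close> as the controlled system
  and the limit system as its perturbation. The error is then measured along the one fixed curve Y,
  and K bounds it independently of n.\<close>

lemma terminal_solution_converges:
  fixes A :: "real \<Rightarrow> 'a \<Rightarrow> 'a::euclidean_space"
  assumes A: "linear_ode a b K A" and An: "\<And>n. linear_ode a b K (An n)"
    and Y: "terminal_solution a b A Y1 Y" and Yn: "\<And>n. terminal_solution a b (An n) (Y1n n) (Yn n)"
    and N: "negligible N"
    and lim: "\<And>t y. t \<in> {a..b} - N \<Longrightarrow> (\<lambda>n. An n t y) \<longlonglongrightarrow> A t y"
    and lim1: "Y1n \<longlonglongrightarrow> Y1"
    and x: "x \<in> {a..b}"
  shows "(\<lambda>n. Yn n x) \<longlonglongrightarrow> Y x"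
proof -
  interpret A: linear_ode a b K A by fact
  interpret An: linear_ode a b K "An n" for n by fact
  have contY: "continuous_on {a..b} Y" using Y by (auto simp: terminal_solution_def)
  obtain M where M: "\<And>t. t \<in> {a..b} \<Longrightarrow> norm (Y t) \<le> M"
    using compact_imp_bounded[OF compact_continuous_image[OF contY]] compact_Icc
    unfolding bounded_iff by blast
  define D where "D n t = norm (A t (Y t) - An n t (Y t))" for n t
  have Dle: "norm (A t (Y t) - An n t (Y t)) \<le> 2 * K * M" if "t \<in> {a..b}" for n t
  proof -
    have "norm (A t (Y t) - An n t (Y t)) \<le> norm (A t (Y t)) + norm (An n t (Y t))"
      by (rule norm_triangle_ineq4)
    also have "\<dots> \<le> K * norm (Y t) + K * norm (Y t)"
      using that by (intro add_mono A.bound An.bound)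
    also have "\<dots> \<le> K * M + K * M" using that M A.K by (intro add_mono mult_left_mono) auto
    finally show ?thesis by simp
  qed
  have Dint: "D n integrable_on {a..b}" for n
  proof -
    have "(\<lambda>t. A t (Y t) - An n t (Y t)) absolutely_integrable_on {a..b}"
      by (rule absolutely_integrable_integrable_bound[where g = "\<lambda>_. 2 * K * M"])
        (auto intro!: Dle integrable_diff A.int An.int contY)
    then show ?thesis by (simp add: D_def[abs_def] absolutely_integrable_on_def)
  qed
  \<comment> \<open>The dominated convergence rule asks for convergence at every point, so the error
    is set to 0 on N, which does not change its integral.\<close>
  define D' where "D' n t = (if t \<in> N then 0 else D n t)" for n t
  have D'int: "D' n integrable_on {a..b}" for n
    by (rule integrable_spike[OF Dint N]) (auto simp: D'_def)
  have "(\<lambda>n. integral {a..b} (D' n)) \<longlonglongrightarrow> integral {a..b} (\<lambda>_. 0)"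
  proof (rule dominated_convergence(2)[where h = "\<lambda>_. 2 * K * \<bar>M\<bar>"])
    fix n t assume "t \<in> {a..b}"
    moreover have "2 * K * M \<le> 2 * K * \<bar>M\<bar>" using A.K by (intro mult_left_mono) auto
    moreover have "0 \<le> 2 * K * \<bar>M\<bar>" using A.K by simp
    ultimately show "norm (D' n t) \<le> 2 * K * \<bar>M\<bar>" using Dle[of t n] by (auto simp: D'_def D_def)
  next
    fix t assume t: "t \<in> {a..b}"
    show "(\<lambda>n. D' n t) \<longlonglongrightarrow> 0"
    proof (cases "t \<in> N")
      case False
      have "(\<lambda>n. norm (A t (Y t) - An n t (Y t))) \<longlonglongrightarrow> norm (A t (Y t) - A t (Y t))"
        using lim[of t] t False by (intro tendsto_intros) auto
      then show ?thesis using False by (simp add: D'_def D_def)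
    qed (simp add: D'_def)
  qed (use D'int in auto)
  moreover have "integral {a..b} (D' n) = integral {a..b} (D n)" for n
    by (rule integral_spike[OF N]) (auto simp: D'_def)
  ultimately have Dlim: "(\<lambda>n. integral {a..b} (D n)) \<longlonglongrightarrow> 0" by simp
  have "(\<lambda>n. (norm (Y1 - Y1n n) + integral {a..b} (D n)) * exp (K * (b - x))) \<longlonglongrightarrow>
      (norm (Y1 - Y1) + 0) * exp (K * (b - x))"
    by (intro tendsto_intros lim1 Dlim)
  then have "(\<lambda>n. (norm (Y1 - Y1n n) + integral {a..b} (D n)) * exp (K * (b - x))) \<longlonglongrightarrow> 0" by simp
  then have "(\<lambda>n. norm (Y x - Yn n x)) \<longlonglongrightarrow> 0"
  proof (rule Lim_null_comparison[rotated], intro always_eventually allI)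
    fix n
    show "norm (norm (Y x - Yn n x)) \<le> (norm (Y1 - Y1n n) + integral {a..b} (D n)) * exp (K * (b - x))"
      using An.terminal_solution_perturb[OF Yn Y A.int[OF contY] _ x] Dint[of n]
      by (simp add: D_def[abs_def])
  qed
  then have "(\<lambda>n. Y x - Yn n x) \<longlonglongrightarrow> 0" by (rule tendsto_norm_zero_cancel)
  from tendsto_diff[OF tendsto_const[of "Y x"] this] show ?thesis by simp
qed

section \<open>The wave equation as a first-order system\<close>

lemma bounded_piecewise_continuous_integrable:
  fixes f :: "real \<Rightarrow> 'a::euclidean_space"
  assumes "finite S" "\<And>x. x \<in> {a..b} - S \<Longrightarrow> isCont f x" "\<And>x. x \<in> {a..b} \<Longrightarrow> norm (f x) \<le> B"
  shows "f integrable_on {a..b}"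
proof -
  let ?T = "{a..b} - S"
  have T: "?T \<in> sets lebesgue" using negligible_imp_sets[OF negligible_finite[OF assms(1)]] by auto
  have "f integrable_on ?T"
  proof (rule measurable_bounded_by_integrable_imp_integrable[where g = "\<lambda>_. B"])
    show "f \<in> borel_measurable (lebesgue_on ?T)"
      using assms(2) T by (intro continuous_imp_measurable_on_sets_lebesgue continuous_at_imp_continuous_on) auto
    show "(\<lambda>_. B) integrable_on ?T"
      by (rule integrable_spike_set[where S = "{a..b}"])
        (auto intro: negligible_subset[OF negligible_finite[OF assms(1)]])
  qed (use assms(3) T in auto)
  then show ?thesis
    by (rule integrable_spike_set) (auto intro: negligible_subset[OF negligible_finite[OF assms(1)]])
qed

lemma negligible_of_AE_lborel:
  assumes "AE x in lborel. P (x::real)"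
  obtains N where "negligible N" "\<And>x. x \<notin> N \<Longrightarrow> P x"
proof -
  from AE_E[OF assms] obtain N where N: "{x \<in> space lborel. \<not> P x} \<subseteq> N" "emeasure lborel N = 0" "N \<in> sets lborel" .
  then have "negligible N"
    by (metis negligible_iff_null_sets null_sets_completionI null_setsI)
  then show ?thesis using that N by auto
qed

lemma AE_lborel_not_in_finite:
  assumes "finite (S::real set)" shows "AE x in lborel. x \<notin> S"
  using assms by (intro AE_not_in finite_imp_null_set_lborel)

text \<open>For y = (u, c u') these are the right and left waves of u. The pair y is continuous
  across a jump of the impedance while the waves are not; hence the impedance value c is a separate
  argument.\<close>

definition fwd :: "real \<Rightarrow> real \<Rightarrow> complex \<times> complex \<Rightarrow> complex" where
  "fwd \<omega> c y = (fst y + snd y / (of_real c * (\<i> * of_real \<omega>))) / 2"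

definition bwd :: "real \<Rightarrow> real \<Rightarrow> complex \<times> complex \<Rightarrow> complex" where
  "bwd \<omega> c y = (fst y - snd y / (of_real c * (\<i> * of_real \<omega>))) / 2"

text \<open>The imaginary part on the right is the flux conserved by the equation for real \<omega>.
  It links the balance of the two waves at one end of the interval to that at the other.\<close>

lemma energy_flux:
  assumes "\<omega> \<noteq> 0" "c \<noteq> 0"
  shows "(cmod (fwd \<omega> c y))\<^sup>2 - (cmod (bwd \<omega> c y))\<^sup>2 = Im (cnj (fst y) * snd y) / (c * \<omega>)"
proof -
  define k where "k = 1 / (c * \<omega>)"
  have "snd y / (of_real c * (\<i> * of_real \<omega>)) = - \<i> * (of_real k * snd y)"
    using assms by (simp add: field_simps k_def)
  then have *: "snd y / (of_real c * (\<i> * of_real \<omega>)) = Complex (k * Im (snd y)) (- k * Re (snd y))"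
    by (simp add: complex_eq_iff)
  have "(cmod (fwd \<omega> c y))\<^sup>2 - (cmod (bwd \<omega> c y))\<^sup>2 = k * Im (cnj (fst y) * snd y)"
    unfolding fwd_def bwd_def cmod_power2 * by (simp add: field_simps power2_eq_square)
  then show ?thesis by (simp add: k_def)
qed

text \<open>One state y is decomposed for the impedances c' on the left and c on the right of a
  jump; r is the reflectivity. The factor k cancels in the quotient of the waves, leaving the
  Moebius map (r + R) / (1 + r R).\<close>

lemma interface_waves:
  assumes "\<omega> \<noteq> 0" "c > 0" "c' > 0"
  defines "k \<equiv> complex_of_real ((c' + c) / (2 * c'))"
    and "r \<equiv> complex_of_real ((c' - c) / (c' + c))"
  shows "fwd \<omega> c' y = k * (fwd \<omega> c y + r * bwd \<omega> c y)"
    and "bwd \<omega> c' y = k * (r * fwd \<omega> c y + bwd \<omega> c y)"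
proof -
  define X where "X = snd y / (\<i> * of_real \<omega>)"
  have X: "snd y / (of_real d * (\<i> * of_real \<omega>)) = X / of_real d" for d
    by (simp add: X_def)
  have k: "k = (1 + of_real c / of_real c') / 2"
    using assms unfolding k_def by (simp add: field_simps)
  have "(c' + c) / (2 * c') * ((c' - c) / (c' + c)) = (1 - c / c') / 2"
  proof -
    have "c' + c \<noteq> 0" using assms by simp
    then have "(c' + c) / (2 * c') * ((c' - c) / (c' + c)) = (c' - c) / (2 * c')" by simp
    then show ?thesis using assms by (simp add: diff_divide_distrib)
  qed
  then have "k * r = of_real ((1 - c / c') / 2)"
    unfolding k_def r_def of_real_mult[symmetric] by (simp only:)
  then have kr: "k * r = (1 - of_real c / of_real c') / 2" by simp
  have "fwd \<omega> c' y = k * fwd \<omega> c y + (k * r) * bwd \<omega> c y"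
    unfolding kr unfolding k fwd_def bwd_def X using assms(2,3) by (simp add: field_simps)
  then show "fwd \<omega> c' y = k * (fwd \<omega> c y + r * bwd \<omega> c y)" by (simp add: algebra_simps)
  have "bwd \<omega> c' y = (k * r) * fwd \<omega> c y + k * bwd \<omega> c y"
    unfolding kr unfolding k fwd_def bwd_def X using assms(2,3) by (simp add: field_simps)
  then show "bwd \<omega> c' y = k * (r * fwd \<omega> c y + bwd \<omega> c y)" by (simp add: algebra_simps)
qed

text \<open>
  The system for \<open>y = (u, z u')\<close>. It is switched off at the end points, where \<open>z\<close> is uncontrolled.
\<close>

definition wave_op :: "real \<Rightarrow> real \<Rightarrow> (real \<Rightarrow> real) \<Rightarrow> real \<Rightarrow> real \<Rightarrow> complex \<times> complex \<Rightarrow> complex \<times> complex" where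
  "wave_op a b z \<omega> t y =
     (if a < t \<and> t < b then (snd y / of_real (z t), - of_real (\<omega>\<^sup>2 * z t) * fst y) else 0)"

text \<open>Covers both the given impedance and its sampled step functions. The end values are
  one-sided limits because z itself is uncontrolled at a and b.\<close>

locale impedance =
  fixes a b m M za zb :: real and z :: "real \<Rightarrow> real" and Q :: "real set"
  assumes ab: "a < b" and Q: "finite Q" and m: "m > 0"
    and bounds: "\<And>x. a < x \<Longrightarrow> x < b \<Longrightarrow> m \<le> z x \<and> z x \<le> M"
    and cont: "\<And>x. a < x \<Longrightarrow> x < b \<Longrightarrow> x \<notin> Q \<Longrightarrow> isCont z x"
    and lima: "(z \<longlongrightarrow> za) (at_right a)" and limb: "(z \<longlongrightarrow> zb) (at_left b)"
begin

lemma mM: "m \<le> M"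
  using bounds[of "(a + b) / 2"] ab by auto

lemma za: "za \<ge> m" and zb: "zb \<ge> m"
proof -
  have "eventually (\<lambda>x. x \<in> {a<..<b}) (at_right a)" using ab by (rule eventually_at_right_real)
  then have "eventually (\<lambda>x. m \<le> z x) (at_right a)" by eventually_elim (use bounds in auto)
  then show "za \<ge> m" using lima by (intro tendsto_lowerbound) auto
  have "eventually (\<lambda>x. x \<in> {a<..<b}) (at_left b)" using ab by (rule eventually_at_left_real)
  then have "eventually (\<lambda>x. m \<le> z x) (at_left b)" by eventually_elim (use bounds in auto)
  then show "zb \<ge> m" using limb by (intro tendsto_lowerbound) auto
qed

abbreviation "A \<equiv> wave_op a b z"

lemma norm_wave_op_le: "norm (A \<omega> t y) \<le> (1 / m + \<omega>\<^sup>2 * M) * norm y"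
proof (cases "a < t \<and> t < b")
  case True
  have zt: "m \<le> z t" "z t \<le> M" using bounds True by auto
  have "norm (A \<omega> t y) \<le> norm (snd y / of_real (z t)) + norm (- of_real (\<omega>\<^sup>2 * z t) * fst y)"
    using True norm_Pair_le[of "snd y / of_real (z t)" "- of_real (\<omega>\<^sup>2 * z t) * fst y"]
    by (simp add: wave_op_def)
  also have "norm (snd y / of_real (z t)) = norm (snd y) / z t" using zt m by (simp add: norm_divide)
  also have "\<dots> \<le> norm y / m" using zt m norm_snd_le[of "snd y" "fst y"] by (intro frac_le) auto
  also have "norm (- of_real (\<omega>\<^sup>2 * z t) * fst y) = (\<omega>\<^sup>2 * z t) * norm (fst y)"
    using zt m by (simp add: norm_mult norm_power)
  also have "\<dots> \<le> (\<omega>\<^sup>2 * M) * norm y" using zt m norm_fst_le[of "fst y" "snd y"] by (intro mult_mono mult_left_mono) auto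
  finally show ?thesis by (simp add: algebra_simps)
next
  case False
  then show ?thesis using m mM by (auto simp: wave_op_def)
qed

lemma linear_wave_op: "linear (A \<omega> t)"
  by (rule linearI) (auto simp: wave_op_def algebra_simps add_divide_distrib scaleR_conv_of_real)

lemma isCont_wave_op:
  assumes "a < x" "x < b" "x \<notin> Q" "isCont \<phi> x"
  shows "isCont (\<lambda>t. A \<omega> t (\<phi> t)) x"
proof -
  have "z x \<noteq> 0" using bounds[of x] assms m by auto
  then have "isCont (\<lambda>t. (snd (\<phi> t) / of_real (z t), - of_real (\<omega>\<^sup>2 * z t) * fst (\<phi> t))) x"
    using cont[OF assms(1-3)] assms(4) by (intro continuous_intros) auto
  moreover have "eventually (\<lambda>t. A \<omega> t (\<phi> t) =
      (snd (\<phi> t) / of_real (z t), - of_real (\<omega>\<^sup>2 * z t) * fst (\<phi> t))) (nhds x)"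
  proof -
    have "eventually (\<lambda>t. t \<in> {a<..<b}) (nhds x)"
      using assms by (intro eventually_nhds_in_open) auto
    then show ?thesis by eventually_elim (simp add: wave_op_def)
  qed
  ultimately show ?thesis by (simp add: isCont_cong)
qed

lemma wave_op_integrable:
  assumes "continuous_on {a..b} \<phi>"
  shows "(\<lambda>t. A \<omega> t (\<phi> t)) integrable_on {a..b}"
proof -
  obtain B where B: "\<And>t. t \<in> {a..b} \<Longrightarrow> norm (\<phi> t) \<le> B"
    using compact_imp_bounded[OF compact_continuous_image[OF assms]] compact_Icc
    unfolding bounded_iff by blast
  show ?thesis
  proof (rule bounded_piecewise_continuous_integrable[where S = "insert a (insert b Q)"])
    fix x assume "x \<in> {a..b} - insert a (insert b Q)"
    then have x: "a < x" "x < b" "x \<notin> Q" by auto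
    then have "isCont \<phi> x" using assms by (simp add: continuous_on_interior)
    then show "isCont (\<lambda>t. A \<omega> t (\<phi> t)) x" using x by (intro isCont_wave_op)
  next
    fix x assume "x \<in> {a..b}"
    have "norm (A \<omega> x (\<phi> x)) \<le> (1 / m + \<omega>\<^sup>2 * M) * norm (\<phi> x)" by (rule norm_wave_op_le)
    also have "\<dots> \<le> (1 / m + \<omega>\<^sup>2 * M) * B"
      using B[OF \<open>x \<in> {a..b}\<close>] m mM by (intro mult_left_mono) auto
    finally show "norm (A \<omega> x (\<phi> x)) \<le> (1 / m + \<omega>\<^sup>2 * M) * B" .
  qed (use Q in auto)
qed

lemma linear_ode_wave_op: "linear_ode a b (1 / m + \<omega>\<^sup>2 * M) (A \<omega>)"
  using ab m mM by (intro linear_ode.intro norm_wave_op_le linear_wave_op wave_op_integrable) auto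

lemma integral_wave_op_lipschitz:
  assumes "continuous_on {a..b} Y"
  obtains B where "\<And>x y. x \<in> {a..b} \<Longrightarrow> y \<in> {a..b} \<Longrightarrow>
    norm (integral {y..b} (\<lambda>t. A \<omega> t (Y t)) - integral {x..b} (\<lambda>t. A \<omega> t (Y t))) \<le> B * \<bar>y - x\<bar>"
proof -
  let ?f = "\<lambda>t. A \<omega> t (Y t)"
  obtain B where B: "\<And>t. t \<in> {a..b} \<Longrightarrow> norm (Y t) \<le> B"
    using compact_imp_bounded[OF compact_continuous_image[OF assms]] compact_Icc
    unfolding bounded_iff by blast
  let ?C = "(1 / m + \<omega>\<^sup>2 * M) * B"
  have fB: "norm (?f t) \<le> ?C" if "t \<in> {a..b}" for t
  proof -
    have "norm (?f t) \<le> (1 / m + \<omega>\<^sup>2 * M) * norm (Y t)" by (rule norm_wave_op_le)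
    also have "\<dots> \<le> ?C" using B[OF that] m mM by (intro mult_left_mono) auto
    finally show ?thesis .
  qed
  note int = wave_op_integrable[OF assms, of \<omega>]
  have *: "norm (integral {y..b} ?f - integral {x..b} ?f) \<le> ?C * (y - x)"
    if "a \<le> x" "x \<le> y" "y \<le> b" for x y
  proof -
    have "integral {x..y} ?f + integral {y..b} ?f = integral {x..b} ?f"
      using that by (intro Henstock_Kurzweil_Integration.integral_combine
          integrable_on_subinterval[OF int]) auto
    then have "norm (integral {y..b} ?f - integral {x..b} ?f) = norm (integral {x..y} ?f)"
      by (metis add_diff_cancel_right' norm_minus_commute)
    also have "\<dots> \<le> integral {x..y} (\<lambda>_. ?C)"
      using that fB by (intro integral_norm_bound_integral integrable_on_subinterval[OF int]) auto
    also have "\<dots> = ?C * (y - x)" using that by simp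
    finally show ?thesis .
  qed
  show ?thesis
  proof (rule that[of ?C])
    fix x y assume "x \<in> {a..b}" "y \<in> {a..b}"
    then show "norm (integral {y..b} ?f - integral {x..b} ?f) \<le> ?C * \<bar>y - x\<bar>"
      using *[of x y] *[of y x] by (cases "x \<le> y") (auto simp: norm_minus_commute)
  qed
qed

lemma integral_wave_op_derivative:
  assumes "continuous_on {a..b} Y" "a < x" "x < b" "x \<notin> Q"
  shows "((\<lambda>x. integral {x..b} (\<lambda>t. A \<omega> t (Y t))) has_vector_derivative - A \<omega> x (Y x)) (at x)"
proof -
  let ?f = "\<lambda>t. A \<omega> t (Y t)"
  note int = wave_op_integrable[OF assms(1), of \<omega>]
  have "isCont Y x" using assms by (simp add: continuous_on_interior)
  then have "isCont ?f x" using assms by (intro isCont_wave_op)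
  then have "((\<lambda>u. integral {a..u} ?f) has_vector_derivative ?f x) (at x within ({a..b} - {}))"
    using assms(2,3) int by (intro integral_has_vector_derivative_continuous_at)
      (auto intro: continuous_at_imp_continuous_at_within)
  then have "((\<lambda>u. integral {a..u} ?f) has_vector_derivative ?f x) (at x)"
    using assms(2,3) by (simp add: at_within_Icc_at)
  then have "((\<lambda>u. integral {a..b} ?f - integral {a..u} ?f) has_vector_derivative - ?f x) (at x)"
    by (auto intro!: derivative_eq_intros)
  then show ?thesis
  proof (rule has_vector_derivative_transform_within_open[where S = "{a<..<b}"])
    fix u assume "u \<in> {a<..<b}"
    then show "integral {a..b} ?f - integral {a..u} ?f = integral {u..b} ?f"
      using Henstock_Kurzweil_Integration.integral_combine[OF _ _ int, of u]
      by (auto simp: algebra_simps)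
  qed (use assms in auto)
qed

lemma terminal_solution_derivative:
  assumes "terminal_solution a b (A \<omega>) Y1 Y" "a < x" "x < b" "x \<notin> Q"
  shows "(Y has_vector_derivative A \<omega> x (Y x)) (at x)"
proof -
  have c: "continuous_on {a..b} Y" using assms by (simp add: terminal_solution_def)
  have "((\<lambda>x. Y1 - integral {x..b} (\<lambda>t. A \<omega> t (Y t))) has_vector_derivative A \<omega> x (Y x)) (at x)"
    using integral_wave_op_derivative[OF c assms(2-4), of \<omega>] by (auto intro!: derivative_eq_intros)
  then show ?thesis
    by (rule has_vector_derivative_transform_within_open[where S = "{a<..<b}"])
      (use assms in \<open>auto simp: terminal_solution_def\<close>)
qed

lemma terminal_solution_derivative_components:
  assumes "terminal_solution a b (A \<omega>) Y1 Y" "a < x" "x < b" "x \<notin> Q"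
  shows "((\<lambda>x. fst (Y x)) has_vector_derivative snd (Y x) / of_real (z x)) (at x)"
    and "((\<lambda>x. snd (Y x)) has_vector_derivative - of_real (\<omega>\<^sup>2 * z x) * fst (Y x)) (at x)"
  using bounded_linear.has_vector_derivative[OF bounded_linear_fst terminal_solution_derivative[OF assms]]
    bounded_linear.has_vector_derivative[OF bounded_linear_snd terminal_solution_derivative[OF assms]]
    assms(2,3) by (simp_all add: wave_op_def)

text \<open>\<open>linear\<close> is linearity over the reals, but normalising the incident wave
  means dividing by a complex number.\<close>

lemma terminal_solution_scale:
  assumes "terminal_solution a b (A \<omega>) Y1 Y"
  shows "terminal_solution a b (A \<omega>) (c * fst Y1, c * snd Y1) (\<lambda>x. (c * fst (Y x), c * snd (Y x)))"
proof -
  let ?s = "\<lambda>y. (c * fst y, c * snd y) :: complex \<times> complex"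
  have bl: "bounded_linear ?s"
    by (intro bounded_linear_Pair bounded_linear_mult_right[THEN bounded_linear_compose]
        bounded_linear_fst bounded_linear_snd)
  have c: "continuous_on {a..b} Y" using assms by (simp add: terminal_solution_def)
  have "?s (Y x) = ?s Y1 - integral {x..b} (\<lambda>t. A \<omega> t (?s (Y t)))" if x: "x \<in> {a..b}" for x
  proof -
    have i: "(\<lambda>t. A \<omega> t (Y t)) integrable_on {x..b}"
      using integrable_on_subinterval[OF wave_op_integrable[OF c]] x by auto
    have "Y x = Y1 - integral {x..b} (\<lambda>t. A \<omega> t (Y t))"
      using assms x by (simp add: terminal_solution_def)
    then have "?s (Y x) = ?s Y1 - ?s (integral {x..b} (\<lambda>t. A \<omega> t (Y t)))"
      by (simp add: right_diff_distrib)
    also have "?s (integral {x..b} (\<lambda>t. A \<omega> t (Y t))) = integral {x..b} (\<lambda>t. ?s (A \<omega> t (Y t)))"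
      using integral_linear[OF i bl] by (simp add: o_def)
    also have "(\<lambda>t. ?s (A \<omega> t (Y t))) = (\<lambda>t. A \<omega> t (?s (Y t)))"
      by (auto simp: wave_op_def fun_eq_iff zero_prod_def)
    finally show ?thesis .
  qed
  then show ?thesis using c unfolding terminal_solution_def by (auto intro!: continuous_intros)
qed

text \<open>With y = (u, w), the derivative of cnj u * w off Q is \<bar>w\<bar>^2 / z - \<omega>^2 z
  \<bar>u\<bar>^2, which is real.\<close>

lemma energy_flux_const:
  assumes Y: "terminal_solution a b (A \<omega>) Y1 Y"
  shows "Im (cnj (fst (Y a)) * snd (Y a)) = Im (cnj (fst (Y b)) * snd (Y b))"
proof -
  let ?J = "\<lambda>x. Im (cnj (fst (Y x)) * snd (Y x))"
  have c: "continuous_on {a..b} Y" using Y by (simp add: terminal_solution_def)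
  have "?J b = ?J a"
  proof (rule has_derivative_zero_unique_strong_interval[where k = "insert a (insert b Q)" and f = ?J])
    show "continuous_on {a..b} ?J" by (intro continuous_intros c)
    fix x assume "x \<in> {a..b} - insert a (insert b Q)"
    then have x: "a < x" "x < b" "x \<notin> Q" by auto
    note d = terminal_solution_derivative_components[OF Y x]
    have "((\<lambda>x. cnj (fst (Y x)) * snd (Y x)) has_vector_derivative
        cnj (fst (Y x)) * (- of_real (\<omega>\<^sup>2 * z x) * fst (Y x)) + cnj (snd (Y x) / of_real (z x)) * snd (Y x)) (at x)"
      by (intro has_vector_derivative_mult d has_vector_derivative_cnj)
    from bounded_linear.has_vector_derivative[OF bounded_linear_Im this]
    have "(?J has_vector_derivative 0) (at x)"
      by (simp add: algebra_simps)
    then show "(?J has_derivative (\<lambda>h. 0)) (at x within {a..b})"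
      by (auto simp: has_vector_derivative_def intro: has_derivative_at_withinI)
  qed (use Q ab in auto)
  then show ?thesis by simp
qed

text \<open>For constant impedance the waves are multiples of exp (i \<omega> x) and exp (- i
  \<omega> x). Multiplying each by the opposite exponential gives a function with zero
  derivative.\<close>

lemma waves_const_layer:
  assumes Y: "terminal_solution a b (A \<omega>) Y1 Y" and \<omega>: "\<omega> \<noteq> 0"
    and lr: "a \<le> l" "l < r" "r \<le> b" and zc: "\<And>x. l < x \<Longrightarrow> x < r \<Longrightarrow> z x = c"
    and Qlr: "Q \<inter> {l<..<r} = {}"
  shows "fwd \<omega> c (Y l) = exp (- \<i> * of_real (\<omega> * (r - l))) * fwd \<omega> c (Y r)"
    and "bwd \<omega> c (Y l) = exp (\<i> * of_real (\<omega> * (r - l))) * bwd \<omega> c (Y r)"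
proof -
  have "c > 0" using zc[of "(l + r) / 2"] bounds[of "(l + r) / 2"] m lr by auto
  have c: "continuous_on {l..r} Y"
    using Y lr by (auto simp: terminal_solution_def intro: continuous_on_subset)
  have d: "((\<lambda>x. fst (Y x)) has_vector_derivative snd (Y x) / of_real c) (at x)"
    "((\<lambda>x. snd (Y x)) has_vector_derivative - of_real (\<omega>\<^sup>2 * c) * fst (Y x)) (at x)"
    if "l < x" "x < r" for x
  proof -
    have "a < x" "x < b" "x \<notin> Q" using that lr Qlr by auto
    from terminal_solution_derivative_components[OF Y this] zc[OF that]
    show "((\<lambda>x. fst (Y x)) has_vector_derivative snd (Y x) / of_real c) (at x)"
      "((\<lambda>x. snd (Y x)) has_vector_derivative - of_real (\<omega>\<^sup>2 * c) * fst (Y x)) (at x)"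
      by simp_all
  qed
  have e: "((\<lambda>x. exp (k * of_real x)) has_vector_derivative k * exp (k * of_real x)) (at x)" for k :: complex and x
  proof -
    have 1: "(complex_of_real has_vector_derivative 1) (at x)"
      using has_vector_derivative_of_real[OF DERIV_ident[of "at x"]] by simp
    have 2: "((\<lambda>w. exp (k * w)) has_field_derivative k * exp (k * of_real x)) (at (of_real x))"
      by (auto intro!: derivative_eq_intros)
    show ?thesis using field_vector_diff_chain_at[OF 1 2] by (simp add: o_def)
  qed
  \<comment> \<open>The sign k treats both waves at once: k = 1 is \<open>fwd\<close>, k = -1 is
    \<open>bwd\<close>.\<close>
  define W where "W k y = (fst y + k * (snd y / (of_real c * (\<i> * of_real \<omega>)))) / 2" for k y
  have key: "W k (Y l) = exp (- (k * \<i>) * of_real (\<omega> * (r - l))) * W k (Y r)" if k: "k = 1 \<or> k = - 1" for k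
  proof -
    let ?k = "- (k * \<i> * of_real \<omega>)"
    have "W k (Y r) * exp (?k * of_real r) = W k (Y l) * exp (?k * of_real l)"
    proof (rule has_derivative_zero_unique_strong_interval[where k = "{l, r}"])
      show "continuous_on {l..r} (\<lambda>x. W k (Y x) * exp (?k * of_real x))"
        unfolding W_def by (intro continuous_intros c) (use \<open>c > 0\<close> \<omega> in auto)
      fix x assume "x \<in> {l..r} - {l, r}"
      then have x: "l < x" "x < r" by auto
      have "((\<lambda>x. W k (Y x) * exp (?k * of_real x)) has_vector_derivative
          (W k (Y x) * (?k * exp (?k * of_real x))
          + (snd (Y x) / of_real c + k * (- of_real (\<omega>\<^sup>2 * c) * fst (Y x) / (of_real c * (\<i> * of_real \<omega>)))) / 2
            * exp (?k * of_real x))) (at x)"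
        unfolding W_def
        by (intro has_vector_derivative_mult e has_vector_derivative_divide has_vector_derivative_add
            has_vector_derivative_mult_right d x)
      also have "(W k (Y x) * (?k * exp (?k * of_real x))
          + (snd (Y x) / of_real c + k * (- of_real (\<omega>\<^sup>2 * c) * fst (Y x) / (of_real c * (\<i> * of_real \<omega>)))) / 2
            * exp (?k * of_real x)) = 0"
        using k \<open>c > 0\<close> \<omega> unfolding W_def by (elim disjE) (simp_all add: field_simps power2_eq_square)
      finally show "((\<lambda>x. W k (Y x) * exp (?k * of_real x)) has_derivative (\<lambda>h. 0)) (at x within {l..r})"
        by (auto simp: has_vector_derivative_def intro: has_derivative_at_withinI)
    qed (use lr in auto)
    then have "W k (Y l) = W k (Y r) * (exp (?k * of_real r) * exp (- (?k * of_real l)))"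
      by (simp add: exp_minus field_simps)
    also have "exp (?k * of_real r) * exp (- (?k * of_real l)) = exp (- (k * \<i>) * of_real (\<omega> * (r - l)))"
      by (simp add: exp_add[symmetric] algebra_simps)
    finally show ?thesis by simp
  qed
  have W: "W 1 y = fwd \<omega> c y" "W (- 1) y = bwd \<omega> c y" for y
    by (simp_all add: W_def fwd_def bwd_def)
  show "fwd \<omega> c (Y l) = exp (- \<i> * of_real (\<omega> * (r - l))) * fwd \<omega> c (Y r)"
    using key[of 1] unfolding W by simp
  show "bwd \<omega> c (Y l) = exp (\<i> * of_real (\<omega> * (r - l))) * bwd \<omega> c (Y r)"
    using key[of "- 1"] unfolding W by simp
qed

end

section \<open>The reflection coefficient\<close>

context impedance
begin

text \<open>Turns the almost-everywhere formulation into the integral equation. Absolute continuity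
  extends u and \<zeta> v continuously to the closed interval; the defect F of the integral equation
  is absolutely continuous with derivative 0 almost everywhere, hence constant.\<close>

lemma is_solution_imp_terminal_solution:
  assumes sol: "is_solution a b z \<omega> \<xi> u v"
  obtains Y1 Y where "terminal_solution a b (A \<omega>) Y1 Y"
    "\<And>x. a < x \<Longrightarrow> x < b \<Longrightarrow> Y x = (u x, of_real (z x) * v x)"
proof -
  define w where "w = (\<lambda>x. of_real (z x) * v x)"
  let ?I = "{a<..<b}"
  have acu: "abs_cont_on ?I u" and acw: "abs_cont_on ?I w"
    and du: "AE x in lborel. x \<in> ?I \<longrightarrow> (u has_vector_derivative v x) (at x)"
    and dw: "AE x in lborel. x \<in> ?I \<longrightarrow>
        (\<exists>d. (w has_vector_derivative d) (at x) \<and> d + of_real (\<omega>\<^sup>2 * z x) * u x = 0)"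
    using sol by (auto simp: is_solution_def w_def)
  have int: "is_interval ?I" by (simp add: is_interval_oo)
  have cl: "closure ?I = {a..b}" using ab by simp
  obtain U where U: "uniformly_continuous_on {a..b} U" "\<And>x. x \<in> ?I \<Longrightarrow> u x = U x"
    using uniformly_continuous_on_extension_on_closure[OF abs_cont_on_uniformly_continuous[OF acu int]]
    unfolding cl by metis
  obtain W where W: "uniformly_continuous_on {a..b} W" "\<And>x. x \<in> ?I \<Longrightarrow> w x = W x"
    using uniformly_continuous_on_extension_on_closure[OF abs_cont_on_uniformly_continuous[OF acw int]]
    unfolding cl by metis
  define Y where "Y = (\<lambda>x. (U x, W x))"
  have contY: "continuous_on {a..b} Y"
    unfolding Y_def using U(1) W(1) by (intro continuous_on_Pair uniformly_continuous_imp_continuous)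
  define F where "F = (\<lambda>x. Y x + integral {x..b} (\<lambda>t. A \<omega> t (Y t)))"
  have contF: "continuous_on {a..b} F"
    unfolding F_def
    by (intro continuous_intros contY indefinite_integral_continuous_1' wave_op_integrable)
  have acF: "abs_cont_on ?I F"
  proof -
    obtain B where B: "\<And>x y. x \<in> {a..b} \<Longrightarrow> y \<in> {a..b} \<Longrightarrow>
      norm (integral {y..b} (\<lambda>t. A \<omega> t (Y t)) - integral {x..b} (\<lambda>t. A \<omega> t (Y t))) \<le> B * \<bar>y - x\<bar>"
      using integral_wave_op_lipschitz[OF contY] by blast
    have 1: "abs_cont_on ?I (\<lambda>x. integral {x..b} (\<lambda>t. A \<omega> t (Y t)))"
      by (rule lipschitz_imp_abs_cont_on[where B = B]) (intro B; auto)
    have "abs_cont_on ?I (\<lambda>x. (u x, 0::complex))" "abs_cont_on ?I (\<lambda>x. (0::complex, w x))"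
      using acu acw unfolding abs_cont_on_def by simp_all
    from abs_cont_on_add[OF abs_cont_on_add[OF this] 1]
    have "abs_cont_on ?I (\<lambda>x. (u x, w x) + integral {x..b} (\<lambda>t. A \<omega> t (Y t)))" by simp
    then show ?thesis
      by (rule abs_cont_on_cong[THEN iffD1, rotated]) (simp add: F_def Y_def U(2) W(2))
  qed
  obtain N1 where N1: "negligible N1" "\<And>x. x \<notin> N1 \<Longrightarrow> x \<in> ?I \<Longrightarrow> (u has_vector_derivative v x) (at x)"
    by (rule negligible_of_AE_lborel[OF du]) blast
  obtain N2 where N2: "negligible N2" "\<And>x. x \<notin> N2 \<Longrightarrow> x \<in> ?I \<Longrightarrow>
      (\<exists>d. (w has_vector_derivative d) (at x) \<and> d + of_real (\<omega>\<^sup>2 * z x) * u x = 0)"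
    by (rule negligible_of_AE_lborel[OF dw]) blast
  have neg: "negligible (N1 \<union> N2 \<union> Q)" using N1 N2 negligible_finite[OF Q] by (intro negligible_Un)
  have dF: "(F has_vector_derivative 0) (at x)" if x: "x \<in> ?I" "x \<notin> N1 \<union> N2 \<union> Q" for x
  proof -
    have zx: "z x \<noteq> 0" using bounds[of x] x m by auto
    have "((\<lambda>x. (u x, w x)) has_vector_derivative A \<omega> x (Y x)) (at x)"
    proof -
      have "(u has_vector_derivative v x) (at x)" using N1(2) x by auto
      moreover obtain d where "(w has_vector_derivative d) (at x)" "d + of_real (\<omega>\<^sup>2 * z x) * u x = 0"
        using N2(2)[of x] x by auto
      ultimately have "((\<lambda>x. (u x, w x)) has_vector_derivative (v x, d)) (at x)"
        by (intro has_vector_derivative_Pair)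
      also have "(v x, d) = A \<omega> x (Y x)"
        using x zx \<open>d + _ = 0\<close> U(2)[OF x(1), symmetric] W(2)[OF x(1), symmetric]
        by (simp add: wave_op_def Y_def w_def eq_neg_iff_add_eq_0)
      finally show ?thesis .
    qed
    moreover have "((\<lambda>x. integral {x..b} (\<lambda>t. A \<omega> t (Y t))) has_vector_derivative - A \<omega> x (Y x)) (at x)"
      using x by (intro integral_wave_op_derivative contY) auto
    ultimately have "((\<lambda>x. (u x, w x) + integral {x..b} (\<lambda>t. A \<omega> t (Y t)))
        has_vector_derivative A \<omega> x (Y x) + - A \<omega> x (Y x)) (at x)"
      by (rule has_vector_derivative_add)
    then have "((\<lambda>x. (u x, w x) + integral {x..b} (\<lambda>t. A \<omega> t (Y t))) has_vector_derivative 0) (at x)"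
      by simp
    then show ?thesis
      by (rule has_vector_derivative_transform_within_open[where S = ?I])
        (use x in \<open>auto simp: F_def Y_def U(2) W(2)\<close>)
  qed
  \<comment> \<open>Absolute continuity of F is known on the open interval only, so constancy is
    shown on compact subintervals first and reaches the end points by continuity.\<close>
  have Feq: "F x = F y" if "x \<in> ?I" "y \<in> ?I" "x \<le> y" for x y
  proof (rule abs_cont_on_derivative_zero_eq[OF _ that(3) neg])
    show "abs_cont_on {x..y} F" using acF by (rule abs_cont_on_subset) (use that in auto)
  qed (use dF that in auto)
  define c where "c = (a + b) / 2"
  have c: "c \<in> ?I" using ab by (simp add: c_def)
  have FI: "F x = F c" if "x \<in> ?I" for x
  proof (cases "x \<le> c")
    case True
    show ?thesis by (rule Feq[OF that c True])
  next
    case False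
    then show ?thesis using Feq[OF c that] by simp
  qed
  have Fc: "F x = F c" if "x \<in> {a..b}" for x
    using continuous_constant_on_closure[of ?I F "F c" x] contF cl FI that by simp
  have "F x = F b" if "x \<in> {a..b}" for x using Fc[OF that] Fc[of b] ab by simp
  moreover have "F b = Y b" by (simp add: F_def)
  ultimately have "Y x = Y b - integral {x..b} (\<lambda>t. A \<omega> t (Y t))" if "x \<in> {a..b}" for x
    using that by (simp add: F_def eq_diff_eq)
  then have "terminal_solution a b (A \<omega>) (Y b) Y"
    using contY unfolding terminal_solution_def by blast
  moreover have "Y x = (u x, of_real (z x) * v x)" if "a < x" "x < b" for x
    using U(2)[of x] W(2)[of x] that by (simp add: Y_def w_def)
  ultimately show ?thesis by (rule that)
qed

lemma wave_limits:
  assumes Y: "terminal_solution a b (A \<omega>) Y1 Y"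
    and uv: "\<And>x. a < x \<Longrightarrow> x < b \<Longrightarrow> Y x = (u x, of_real (z x) * v x)"
    and \<omega>: "\<omega> \<noteq> 0"
  shows "(right_wave \<omega> u v \<longlongrightarrow> fwd \<omega> za (Y a)) (at_right a)"
    and "(left_wave \<omega> u v \<longlongrightarrow> bwd \<omega> za (Y a)) (at_right a)"
    and "(left_wave \<omega> u v \<longlongrightarrow> bwd \<omega> zb (Y b)) (at_left b)"
proof -
  have c: "continuous_on {a..b} Y" using Y by (simp add: terminal_solution_def)
  have rw: "right_wave \<omega> u v x = fwd \<omega> (z x) (Y x)" and lw: "left_wave \<omega> u v x = bwd \<omega> (z x) (Y x)"
    if "a < x" "x < b" for x
    using uv[OF that] bounds[OF that] m by (auto simp: right_wave_def left_wave_def fwd_def bwd_def)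
  have Ya: "(Y \<longlongrightarrow> Y a) (at_right a)"
    using c ab by (simp add: continuous_on_Icc_at_rightD)
  have Yb: "(Y \<longlongrightarrow> Y b) (at_left b)"
    using c ab by (simp add: continuous_on_Icc_at_leftD)
  have ea: "eventually (\<lambda>x. a < x \<and> x < b) (at_right a)"
    using eventually_at_right_real[OF ab] by simp
  have eb: "eventually (\<lambda>x. a < x \<and> x < b) (at_left b)"
    using eventually_at_left_real[OF ab] by simp
  have nz: "za \<noteq> 0" "zb \<noteq> 0" using za zb m by auto
  have "((\<lambda>x. fwd \<omega> (z x) (Y x)) \<longlongrightarrow> fwd \<omega> za (Y a)) (at_right a)"
    unfolding fwd_def by (intro tendsto_intros Ya lima) (use nz \<omega> in auto)
  then show "(right_wave \<omega> u v \<longlongrightarrow> fwd \<omega> za (Y a)) (at_right a)"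
    by (rule Lim_transform_eventually) (use ea in eventually_elim, simp add: rw)
  have "((\<lambda>x. bwd \<omega> (z x) (Y x)) \<longlongrightarrow> bwd \<omega> za (Y a)) (at_right a)"
    unfolding bwd_def by (intro tendsto_intros Ya lima) (use nz \<omega> in auto)
  then show "(left_wave \<omega> u v \<longlongrightarrow> bwd \<omega> za (Y a)) (at_right a)"
    by (rule Lim_transform_eventually) (use ea in eventually_elim, simp add: lw)
  have "((\<lambda>x. bwd \<omega> (z x) (Y x)) \<longlongrightarrow> bwd \<omega> zb (Y b)) (at_left b)"
    unfolding bwd_def by (intro tendsto_intros Yb limb) (use nz \<omega> in auto)
  then show "(left_wave \<omega> u v \<longlongrightarrow> bwd \<omega> zb (Y b)) (at_left b)"
    by (rule Lim_transform_eventually) (use eb in eventually_elim, simp add: lw)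
qed

text \<open>The state at b of the purely right-going wave exp (i \<omega> (x - b)) in a medium of
  impedance \<open>zb\<close>.\<close>

definition "outgoing \<omega> = (1 :: complex, \<i> * of_real (\<omega> * zb))"

lemma bwd_outgoing: "\<omega> \<noteq> 0 \<Longrightarrow> bwd \<omega> zb y = 0 \<longleftrightarrow> y = (fst y * fst (outgoing \<omega>), fst y * snd (outgoing \<omega>))"
  using zb m by (cases y) (auto simp: bwd_def outgoing_def field_simps)

text \<open>The flux at b equals \<omega> zb, so at a the squared moduli of the right and left waves
  differ by zb / za > 0.\<close>

lemma outgoing_solution_reflection:
  assumes \<omega>: "\<omega> \<noteq> 0" and Y: "terminal_solution a b (A \<omega>) (outgoing \<omega>) Y"
  shows "fwd \<omega> za (Y a) \<noteq> 0" "cmod (bwd \<omega> za (Y a) / fwd \<omega> za (Y a)) < 1"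
proof -
  have Yb: "Y b = outgoing \<omega>" using Y ab by (simp add: terminal_solution_def)
  have "Im (cnj (fst (Y b)) * snd (Y b)) = \<omega> * zb" by (simp add: Yb outgoing_def)
  then have "(cmod (fwd \<omega> za (Y a)))\<^sup>2 - (cmod (bwd \<omega> za (Y a)))\<^sup>2 = \<omega> * zb / (za * \<omega>)"
    using energy_flux[OF \<omega>, of za "Y a"] energy_flux_const[OF Y] za m by simp
  also have "\<dots> > 0" using \<omega> za zb m by simp
  finally have pos: "(cmod (bwd \<omega> za (Y a)))\<^sup>2 < (cmod (fwd \<omega> za (Y a)))\<^sup>2" by simp
  then show "fwd \<omega> za (Y a) \<noteq> 0" by auto
  moreover have "cmod (bwd \<omega> za (Y a)) < cmod (fwd \<omega> za (Y a))"
    using pos by (rule power2_less_imp_less) simp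
  ultimately show "cmod (bwd \<omega> za (Y a) / fwd \<omega> za (Y a)) < 1" by (simp add: norm_divide)
qed

lemma terminal_solution_imp_is_solution:
  assumes \<omega>: "\<omega> \<noteq> 0" and Y: "terminal_solution a b (A \<omega>) Y1 Y"
    and p: "fwd \<omega> za (Y a) = 1" and q: "bwd \<omega> zb (Y b) = 0"
  shows "is_solution a b z \<omega> 0 (\<lambda>x. fst (Y x)) (\<lambda>x. snd (Y x) / of_real (z x))"
proof -
  let ?u = "\<lambda>x. fst (Y x)" and ?v = "\<lambda>x. snd (Y x) / of_real (z x)"
  let ?I = "{a<..<b}"
  have cY: "continuous_on {a..b} Y" using Y by (simp add: terminal_solution_def)
  have zx: "z x \<noteq> 0" if "x \<in> ?I" for x using bounds[of x] that m by auto
  have uv: "Y x = (?u x, of_real (z x) * ?v x)" if "a < x" "x < b" for x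
    using zx[of x] that by (simp add: prod_eq_iff)
  obtain B where B: "\<And>x y. x \<in> {a..b} \<Longrightarrow> y \<in> {a..b} \<Longrightarrow>
      norm (integral {y..b} (\<lambda>t. A \<omega> t (Y t)) - integral {x..b} (\<lambda>t. A \<omega> t (Y t))) \<le> B * \<bar>y - x\<bar>"
    using integral_wave_op_lipschitz[OF cY] by blast
  have LY: "norm (Y y - Y x) \<le> B * \<bar>y - x\<bar>" if "x \<in> ?I" "y \<in> ?I" for x y
  proof -
    have e: "Y t = Y1 - integral {t..b} (\<lambda>t. A \<omega> t (Y t))" if "t \<in> ?I" for t
      using Y that by (simp add: terminal_solution_def)
    have "Y y - Y x = integral {x..b} (\<lambda>t. A \<omega> t (Y t)) - integral {y..b} (\<lambda>t. A \<omega> t (Y t))"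
      by (subst e[OF that(1)], subst e[OF that(2)]) simp
    then show ?thesis using B[of x y] that by (simp only: norm_minus_commute) simp
  qed
  have nf: "norm (fst d) \<le> norm d" and ns: "norm (snd d) \<le> norm d" for d :: "complex \<times> complex"
    by (cases d; simp add: norm_fst_le norm_snd_le)+
  have Lu: "norm (fst (Y y) - fst (Y x)) \<le> B * \<bar>y - x\<bar>"
    and Lw: "norm (snd (Y y) - snd (Y x)) \<le> B * \<bar>y - x\<bar>" if "x \<in> ?I" "y \<in> ?I" for x y
    using order_trans[OF nf LY[OF that]] order_trans[OF ns LY[OF that]] by simp_all
  have "abs_cont_on ?I ?u" using Lu by (rule lipschitz_imp_abs_cont_on)
  moreover have "abs_cont_on ?I (\<lambda>x. of_real (z x) * ?v x)"
  proof -
    have "abs_cont_on ?I (\<lambda>x. snd (Y x))" using Lw by (rule lipschitz_imp_abs_cont_on)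
    then show ?thesis by (rule abs_cont_on_cong[THEN iffD1, rotated]) (simp add: zx)
  qed
  moreover have "AE x in lborel. x \<in> ?I \<longrightarrow> (?u has_vector_derivative ?v x) (at x)"
    using AE_lborel_not_in_finite[OF Q]
    by eventually_elim (use terminal_solution_derivative_components(1)[OF Y] in auto)
  moreover have "AE x in lborel. x \<in> ?I \<longrightarrow>
        (\<exists>d. ((\<lambda>t. of_real (z t) * ?v t) has_vector_derivative d) (at x) \<and>
             d + of_real (\<omega>\<^sup>2 * z x) * ?u x = 0)"
    using AE_lborel_not_in_finite[OF Q]
  proof eventually_elim
    case (elim x)
    have "((\<lambda>t. of_real (z t) * ?v t) has_vector_derivative - of_real (\<omega>\<^sup>2 * z x) * ?u x) (at x)" if x: "x \<in> ?I"
      by (rule has_vector_derivative_transform_within_open[where S = ?I,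
            OF terminal_solution_derivative_components(2)[OF Y, of x]]) (use x elim zx in auto)
    then show ?case by (intro impI exI[of _ "- of_real (\<omega>\<^sup>2 * z x) * ?u x"]) auto
  qed
  moreover have "Lim (at_right a) (right_wave \<omega> ?u ?v) = 1"
    using tendsto_Lim[OF _ wave_limits(1)[OF Y uv \<omega>]] p by simp
  moreover have "Lim (at_left b) (left_wave \<omega> ?u ?v) = 0 * Lim (at_left b) (right_wave \<omega> ?u ?v)"
    using tendsto_Lim[OF _ wave_limits(3)[OF Y uv \<omega>]] q by simp
  ultimately show ?thesis unfolding is_solution_def by blast
qed

text \<open>The condition with \<xi> = 0 confines the state at b to the complex line through
  \<open>outgoing\<close>. Uniqueness for the terminal problem makes every solution a multiple of Y,
  and the normalisation of the incident wave fixes the factor.\<close>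

lemma gen_reflection_coeff_eq:
  assumes \<omega>: "\<omega> \<noteq> 0" and Y: "terminal_solution a b (A \<omega>) (outgoing \<omega>) Y"
  shows "gen_reflection_coeff a b z \<omega> 0 = bwd \<omega> za (Y a) / fwd \<omega> za (Y a)"
  unfolding gen_reflection_coeff_def
proof (rule the_equality)
  define p where "p = fwd \<omega> za (Y a)"
  have p0: "p \<noteq> 0" using outgoing_solution_reflection(1)[OF \<omega> Y] by (simp add: p_def)
  have fwd_scale: "fwd \<omega> c (k * fst y, k * snd y) = k * fwd \<omega> c y"
    and bwd_scale: "bwd \<omega> c (k * fst y, k * snd y) = k * bwd \<omega> c y" for c k y
    by (simp_all add: fwd_def bwd_def algebra_simps)
  have Yb: "Y b = outgoing \<omega>" using Y ab by (simp add: terminal_solution_def)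
  have bwdb: "bwd \<omega> zb (outgoing \<omega>) = 0" using bwd_outgoing[OF \<omega>] by (simp add: outgoing_def)
  show "\<exists>u v. is_solution a b z \<omega> 0 u v \<and> bwd \<omega> za (Y a) / fwd \<omega> za (Y a) = Lim (at_right a) (left_wave \<omega> u v)"
  proof -
    define Y' where "Y' = (\<lambda>x. (inverse p * fst (Y x), inverse p * snd (Y x)))"
    have Y': "terminal_solution a b (A \<omega>) (inverse p * fst (outgoing \<omega>), inverse p * snd (outgoing \<omega>)) Y'"
      unfolding Y'_def by (rule terminal_solution_scale[OF Y])
    have 1: "fwd \<omega> za (Y' a) = 1" using p0 by (simp add: Y'_def fwd_scale p_def)
    have 2: "bwd \<omega> zb (Y' b) = 0" by (simp add: Y'_def bwd_scale Yb bwdb)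
    have uv: "Y' x = (fst (Y' x), of_real (z x) * (snd (Y' x) / of_real (z x)))" if "a < x" "x < b" for x
      using bounds[of x] m that by (auto simp: prod_eq_iff)
    have "Lim (at_right a) (left_wave \<omega> (\<lambda>x. fst (Y' x)) (\<lambda>x. snd (Y' x) / of_real (z x))) = bwd \<omega> za (Y' a)"
      by (rule tendsto_Lim[OF _ wave_limits(2)[OF Y' uv \<omega>]]) simp_all
    also have "\<dots> = bwd \<omega> za (Y a) / fwd \<omega> za (Y a)"
      unfolding Y'_def bwd_scale by (simp add: p_def divide_inverse mult.commute)
    finally show ?thesis using terminal_solution_imp_is_solution[OF \<omega> Y' 1 2] by metis
  qed
  fix c assume "\<exists>u v. is_solution a b z \<omega> 0 u v \<and> c = Lim (at_right a) (left_wave \<omega> u v)"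
  then obtain u v where uv: "is_solution a b z \<omega> 0 u v" and c: "c = Lim (at_right a) (left_wave \<omega> u v)"
    by blast
  obtain Z1 Z where Z: "terminal_solution a b (A \<omega>) Z1 Z"
    and Zuv: "\<And>x. a < x \<Longrightarrow> x < b \<Longrightarrow> Z x = (u x, of_real (z x) * v x)"
    using is_solution_imp_terminal_solution[OF uv] by blast
  note lims = wave_limits[OF Z Zuv \<omega>]
  have fa: "fwd \<omega> za (Z a) = 1"
    using tendsto_Lim[OF _ lims(1)] uv by (simp add: is_solution_def)
  have bb: "bwd \<omega> zb (Z b) = 0"
    using tendsto_Lim[OF _ lims(3)] uv by (simp add: is_solution_def)
  have ca: "c = bwd \<omega> za (Z a)" using tendsto_Lim[OF _ lims(2)] c by simp
  have "Z b = Z1" using Z ab by (simp add: terminal_solution_def)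
  then have Z1: "Z1 = (fst Z1 * fst (outgoing \<omega>), fst Z1 * snd (outgoing \<omega>))"
    using bb bwd_outgoing[OF \<omega>] by metis
  interpret ode: linear_ode a b "1 / m + \<omega>\<^sup>2 * M" "A \<omega>" by (rule linear_ode_wave_op)
  have "Z a = (fst Z1 * fst (Y a), fst Z1 * snd (Y a))"
    by (rule ode.terminal_solution_unique[OF Z])
      (use terminal_solution_scale[OF Y, of "fst Z1"] Z1 ab in auto)
  then have "fst Z1 * p = 1" "c = fst Z1 * bwd \<omega> za (Y a)"
    using fa ca by (simp_all add: fwd_scale bwd_scale p_def)
  then show "c = bwd \<omega> za (Y a) / fwd \<omega> za (Y a)"
    using p0 by (simp add: p_def field_simps)
qed

text \<open>The point b - (i + 1) h is the left end of layer i, so the quotient of the waves there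
  is \<open>layer_refl\<close> at i. In the rightmost layer the left wave vanishes. An interface
  acts by the Moebius map, and crossing a layer gives the two waves opposite phases, hence their
  quotient twice the phase.\<close>

lemma layered_reflection:
  assumes \<omega>: "\<omega> \<noteq> 0" and Y: "terminal_solution a b (A \<omega>) (outgoing \<omega>) Y"
    and h: "h > 0" "b - a = real n * h" and zs: "zs 0 = zb" "\<And>i. i < n \<Longrightarrow> zs i > 0"
    and z: "\<And>i x. i < n \<Longrightarrow> b - real (Suc i) * h < x \<Longrightarrow> x < b - real i * h \<Longrightarrow> z x = zs i"
    and Qn: "\<And>i. i < n \<Longrightarrow> Q \<inter> {b - real (Suc i) * h<..<b - real i * h} = {}"
    and i: "i < n"
  defines "s \<equiv> \<lambda>i. (zs (Suc i) - zs i) / (zs (Suc i) + zs i)"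
  shows "fwd \<omega> (zs i) (Y (b - real (Suc i) * h)) \<noteq> 0 \<and>
    bwd \<omega> (zs i) (Y (b - real (Suc i) * h)) =
      layer_refl s h i (of_real \<omega>) * fwd \<omega> (zs i) (Y (b - real (Suc i) * h)) \<and>
    cmod (layer_refl s h i (of_real \<omega>)) \<le> 1"
  using i
proof (induction i)
  case 0
  have l: "a \<le> b - real (Suc 0) * h"
    using h 0 mult_right_mono[of 1 "real n" h] by (simp add: algebra_simps)
  have Yb: "Y b = outgoing \<omega>" using Y ab by (simp add: terminal_solution_def)
  have q: "bwd \<omega> zb (Y b) = 0" using bwd_outgoing[OF \<omega>] by (simp add: Yb outgoing_def)
  have p: "fwd \<omega> zb (Y b) = 1" using \<omega> zb m by (simp add: Yb outgoing_def fwd_def)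
  have zz: "z x = zb" if "b - real (Suc 0) * h < x" "x < b" for x
    using z[OF 0, of x] that zs by simp
  have "Q \<inter> {b - real (Suc 0) * h<..<b} = {}" using Qn[OF 0] by simp
  from waves_const_layer[OF Y \<omega> l _ order_refl zz this] h q p zs(1)
  show ?case by simp
next
  case (Suc i)
  define t where "t = b - real (Suc i) * h"
  define R where "R = layer_refl s h i (of_real \<omega>)"
  have IH: "fwd \<omega> (zs i) (Y t) \<noteq> 0" "bwd \<omega> (zs i) (Y t) = R * fwd \<omega> (zs i) (Y t)" "cmod R \<le> 1"
    using Suc by (simp_all add: t_def R_def)
  have pos: "zs i > 0" "zs (Suc i) > 0" using zs(2) Suc.prems by simp_all
  have s1: "\<bar>s i\<bar> < 1" using pos by (simp add: s_def abs_if field_simps)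
  have nz: "1 + s i * R \<noteq> 0"
    using one_plus_real_mult_nonzero[OF s1 IH(3)] by (metis less_irrefl zero_complex.sel(1))
  define k where "k = complex_of_real ((zs (Suc i) + zs i) / (2 * zs (Suc i)))"
  have k: "k \<noteq> 0" using pos by (simp add: k_def add_pos_pos less_imp_neq[symmetric] del: of_real_divide of_real_add)
  have f: "fwd \<omega> (zs (Suc i)) (Y t) = k * fwd \<omega> (zs i) (Y t) * (1 + s i * R)"
    using interface_waves(1)[OF \<omega> pos, of "Y t"] IH(2) by (simp add: k_def s_def algebra_simps del: of_real_divide of_real_add of_real_diff)
  have g: "bwd \<omega> (zs (Suc i)) (Y t) = k * fwd \<omega> (zs i) (Y t) * (s i + R)"
    using interface_waves(2)[OF \<omega> pos, of "Y t"] IH(2) by (simp add: k_def s_def algebra_simps del: of_real_divide of_real_add of_real_diff)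
  have l: "a \<le> t - h"
  proof -
    have "real (Suc (Suc i)) * h \<le> real n * h" using Suc.prems h by (intro mult_right_mono) auto
    then show ?thesis using h by (simp add: t_def algebra_simps)
  qed
  have r: "t \<le> b" using h by (simp add: t_def)
  have eq: "b - real (Suc (Suc i)) * h = t - h" by (simp add: t_def algebra_simps)
  have zz: "z x = zs (Suc i)" if "t - h < x" "x < t" for x
    using z[OF Suc.prems, of x] that unfolding eq by (simp add: t_def)
  have "Q \<inter> {t - h<..<t} = {}" using Qn[OF Suc.prems] unfolding eq t_def .
  note wv = waves_const_layer[OF Y \<omega> l _ r zz this]
  have hh: "t - (t - h) = h" by simp
  have F: "fwd \<omega> (zs (Suc i)) (Y (t - h)) = exp (- \<i> * of_real (\<omega> * h)) * fwd \<omega> (zs (Suc i)) (Y t)"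
    and G: "bwd \<omega> (zs (Suc i)) (Y (t - h)) = exp (\<i> * of_real (\<omega> * h)) * bwd \<omega> (zs (Suc i)) (Y t)"
    using wv h unfolding hh by simp_all
  have rec: "layer_refl s h (Suc i) (of_real \<omega>) = exp (2 * \<i> * of_real \<omega> * h) * ((s i + R) / (1 + s i * R))"
    by (simp add: R_def)
  have ee: "exp (2 * \<i> * of_real \<omega> * of_real h) * exp (- \<i> * of_real (\<omega> * h)) = exp (\<i> * of_real (\<omega> * h))"
    by (simp add: exp_add[symmetric] algebra_simps)
  have "bwd \<omega> (zs (Suc i)) (Y (t - h)) =
      exp (2 * \<i> * of_real \<omega> * h) * exp (- \<i> * of_real (\<omega> * h)) * (k * fwd \<omega> (zs i) (Y t) * (s i + R))"
    unfolding ee G g ..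
  also have "\<dots> = layer_refl s h (Suc i) (of_real \<omega>) * fwd \<omega> (zs (Suc i)) (Y (t - h))"
    unfolding rec F f using nz by (simp add: field_simps)
  finally have b': "bwd \<omega> (zs (Suc i)) (Y (t - h)) = layer_refl s h (Suc i) (of_real \<omega>) * fwd \<omega> (zs (Suc i)) (Y (t - h))" .
  have "cmod (layer_refl s h (Suc i) (of_real \<omega>)) \<le> 1"
    using mobius_norm_le_1[OF s1 IH(3)] unfolding rec norm_mult by simp
  moreover have "fwd \<omega> (zs (Suc i)) (Y (t - h)) \<noteq> 0"
    unfolding F f using k IH(1) nz by simp
  ultimately show ?case using b' unfolding eq by blast
qed

end

section \<open>Sampling on uniform grids\<close>

lemma small_variation_mono: "small_variation S f \<delta> \<epsilon> \<Longrightarrow> \<delta>' \<le> \<delta> \<Longrightarrow> small_variation S f \<delta>' \<epsilon>"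
  unfolding small_variation_def by (meson order_less_le_trans)

section \<open>Intervals of a finite partition\<close>

lemma finite_partition_intervals: "finite P \<Longrightarrow> finite (partition_intervals a b P)"
  unfolding partition_intervals_def
  by (rule finite_subset[of _ "(\<lambda>(u, v). {u<..<v}) ` (insert a (insert b P) \<times> insert a (insert b P))"]) auto

lemma partition_interval_left:
  fixes a b c :: real
  assumes P: "finite P" "P \<subseteq> {a<..<b}" and c: "c \<in> insert b P" and ab: "a < b"
  obtains u where "u < c" "a \<le> u" "{u<..<c} \<in> partition_intervals a b P"
proof -
  let ?S = "{q \<in> insert a P. q < c}"
  have f: "finite ?S" "a \<in> ?S" using P c ab by auto
  define u where "u = Max ?S"
  have u: "u \<in> ?S" unfolding u_def using f by (intro Max_in) auto
  have max: "q \<le> u" if "q \<in> ?S" for q unfolding u_def using f that by (intro Max_ge)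
  have "{u<..<c} \<inter> P = {}" using max by force
  then have "{u<..<c} \<in> partition_intervals a b P"
    unfolding partition_intervals_def using u c by blast
  moreover have "u < c" using u by simp
  ultimately show ?thesis using that max f by blast
qed

lemma partition_interval_right:
  fixes a b c :: real
  assumes P: "finite P" "P \<subseteq> {a<..<b}" and c: "c \<in> insert a P" and ab: "a < b"
  obtains v where "c < v" "v \<le> b" "{c<..<v} \<in> partition_intervals a b P"
proof -
  let ?S = "{q \<in> insert b P. c < q}"
  have f: "finite ?S" "b \<in> ?S" using P c ab by auto
  define v where "v = Min ?S"
  have v: "v \<in> ?S" unfolding v_def using f by (intro Min_in) auto
  have min: "v \<le> q" if "q \<in> ?S" for q unfolding v_def using f that by (intro Min_le)
  have "{c<..<v} \<inter> P = {}" using min by force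
  then have "{c<..<v} \<in> partition_intervals a b P"
    unfolding partition_intervals_def using v c by blast
  moreover have "c < v" using v by simp
  ultimately show ?thesis using that min f by blast
qed

lemma partition_interval_containing:
  fixes a b l r :: real
  assumes P: "finite P" and lr: "a < l" "l \<le> r" "r < b" "{l..r} \<inter> P = {}"
  obtains I where "I \<in> partition_intervals a b P" "{l..r} \<subseteq> I"
proof -
  let ?S = "{q \<in> insert a P. q < l}"
  let ?T = "{q \<in> insert b P. r < q}"
  have f: "finite ?S" "a \<in> ?S" "finite ?T" "b \<in> ?T" using P lr by auto
  define u where "u = Max ?S"
  define v where "v = Min ?T"
  have u: "u \<in> ?S" unfolding u_def using f by (intro Max_in) auto
  have v: "v \<in> ?T" unfolding v_def using f by (intro Min_in) auto
  have max: "q \<le> u" if "q \<in> ?S" for q unfolding u_def using f that by (intro Max_ge)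
  have min: "v \<le> q" if "q \<in> ?T" for q unfolding v_def using f that by (intro Min_le)
  have "q \<notin> {u<..<v}" if "q \<in> P" for q
  proof
    assume q: "q \<in> {u<..<v}"
    have "q \<notin> {l..r}" using lr(4) that by blast
    then have "q < l \<or> r < q" by auto
    then show False using max[of q] min[of q] q that by auto
  qed
  then have "{u<..<v} \<inter> P = {}" by blast
  moreover have "u < v" using u v lr by auto
  ultimately have "{u<..<v} \<in> partition_intervals a b P"
    unfolding partition_intervals_def using u v by blast
  moreover have "{l..r} \<subseteq> {u<..<v}" using u v by auto
  ultimately show ?thesis by (rule that)
qed

text \<open>The strengths are split into a diffuse part \<open>bv\<close>, small on every window of
  w consecutive indices, and a concentrated part \<open>sp\<close>, two of which never meet within
  w. For near pairs this leaves three products, diffuse-diffuse giving V \<epsilon> and the two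
  mixed ones q \<epsilon> each; far pairs carry the weight e and are bounded by the square of the
  total.\<close>

lemma pair_sum_bound:
  fixes s bv sp :: "nat \<Rightarrow> real"
  assumes s: "\<And>i. i < n \<Longrightarrow> 0 \<le> s i \<and> s i \<le> bv i + sp i"
    and nn: "\<And>i. bv i \<ge> 0" "\<And>i. sp i \<ge> 0"
    and V: "(\<Sum>i<n. bv i) \<le> V" and q: "(\<Sum>i<n. sp i) \<le> q"
    and win: "\<And>p. (\<Sum>i\<in>{p..<p + w}. bv i) \<le> \<epsilon>"
    and sep: "\<And>i j. j < i \<Longrightarrow> i \<le> j + w \<Longrightarrow> i < n \<Longrightarrow> sp i * sp j = 0"
    and c: "\<And>i j. j < i \<Longrightarrow> i < n \<Longrightarrow> 0 \<le> c i j \<and> c i j \<le> 1"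
    and far: "\<And>i j. j < i \<Longrightarrow> i < n \<Longrightarrow> j + w < i \<Longrightarrow> c i j \<le> e"
    and e: "e \<ge> 0" and \<epsilon>: "\<epsilon> \<ge> 0"
  shows "(\<Sum>i<n. \<Sum>j<i. s i * s j * c i j) \<le> (V + 2 * q) * \<epsilon> + e * (V + q)\<^sup>2"
proof -
  \<comment> \<open>A 0/1 weight in place of a restricted index set, so that the triangular sum can
    be enlarged to a square and its order of summation exchanged.\<close>
  define near where "near i j = (if j < i \<and> i \<le> j + w then 1 else 0 :: real)" for i j
  let ?t = "\<lambda>i. bv i + sp i"
  have V0: "V \<ge> 0" and q0: "q \<ge> 0"
    using order_trans[OF sum_nonneg V] order_trans[OF sum_nonneg q] nn by auto
  have 1: "s i * s j * c i j \<le> bv i * (near i j * bv j) + sp i * (near i j * bv j)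
        + bv i * (near i j * sp j) + e * (?t i * ?t j)" if ij: "i < n" "j < i" for i j
  proof -
    have ss: "s i * s j \<le> ?t i * ?t j" "0 \<le> s i * s j" "0 \<le> ?t i * ?t j"
      using s[of i] s[of j] ij nn by (auto intro!: mult_mono add_nonneg_nonneg mult_nonneg_nonneg)
    show ?thesis
    proof (cases "i \<le> j + w")
      case True
      have "s i * s j * c i j \<le> (?t i * ?t j) * 1" using c[of j i] ij by (intro mult_mono[OF ss(1)] ss(3)) auto
      also have "\<dots> = bv i * bv j + sp i * bv j + bv i * sp j"
        using sep[of j i] True ij by (simp add: algebra_simps)
      finally show ?thesis using True ij e ss(3) by (simp add: near_def add_increasing2)
    next
      case False
      have "s i * s j * c i j \<le> (?t i * ?t j) * e"
        using c[of j i] far[of j i] ij False by (intro mult_mono[OF ss(1)] ss(3)) auto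
      then show ?thesis using False by (simp add: near_def mult.commute)
    qed
  qed
  have win1: "(\<Sum>j<n. near i j * bv j) \<le> \<epsilon>" for i
  proof -
    \<comment> \<open>For i < w the truncated difference i - w is 0, and the window still contains
      every j < i.\<close>
    have "(\<Sum>j<n. near i j * bv j) \<le> (\<Sum>j\<in>{i - w..<i - w + w}. bv j)"
    proof -
      have "(\<Sum>j<n. near i j * bv j) = (\<Sum>j\<in>{j. j < n \<and> j < i \<and> i \<le> j + w}. bv j)"
        by (rule sum.mono_neutral_cong_right) (auto simp: near_def)
      also have "\<dots> \<le> (\<Sum>j\<in>{i - w..<i - w + w}. bv j)"
        using nn by (intro sum_mono2) auto
      finally show ?thesis .
    qed
    then show ?thesis using win[of "i - w"] by simp
  qed
  have win2: "(\<Sum>i<n. near i j * bv i) \<le> \<epsilon>" for j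
  proof -
    have "(\<Sum>i<n. near i j * bv i) = (\<Sum>i\<in>{i. i < n \<and> j < i \<and> i \<le> j + w}. bv i)"
      by (rule sum.mono_neutral_cong_right) (auto simp: near_def)
    also have "\<dots> \<le> (\<Sum>i\<in>{Suc j..<Suc j + w}. bv i)"
      using nn by (intro sum_mono2) auto
    also have "\<dots> \<le> \<epsilon>" by (rule win)
    finally show ?thesis .
  qed
  have nearnn: "near i j \<ge> 0" for i j by (simp add: near_def)
  have "(\<Sum>i<n. \<Sum>j<i. s i * s j * c i j) \<le> (\<Sum>i<n. \<Sum>j<i. bv i * (near i j * bv j) + sp i * (near i j * bv j)
        + bv i * (near i j * sp j) + e * (?t i * ?t j))"
    by (intro sum_mono 1) auto
  also have "\<dots> \<le> (\<Sum>i<n. \<Sum>j<n. bv i * (near i j * bv j) + sp i * (near i j * bv j)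
        + bv i * (near i j * sp j) + e * (?t i * ?t j))"
    using nn nearnn e by (intro sum_mono sum_mono2) (auto intro!: add_nonneg_nonneg mult_nonneg_nonneg)
  also have "\<dots> = (\<Sum>i<n. bv i * (\<Sum>j<n. near i j * bv j)) + (\<Sum>i<n. sp i * (\<Sum>j<n. near i j * bv j))
        + (\<Sum>i<n. \<Sum>j<n. sp j * (near i j * bv i)) + e * ((\<Sum>i<n. ?t i) * (\<Sum>j<n. ?t j))"
  proof -
    have "(\<Sum>i<n. \<Sum>j<n. e * (?t i * ?t j)) = e * ((\<Sum>i<n. ?t i) * (\<Sum>j<n. ?t j))"
      unfolding sum_product by (simp only: sum_distrib_left)
    moreover have "(\<Sum>i<n. \<Sum>j<n. bv i * (near i j * sp j)) = (\<Sum>i<n. \<Sum>j<n. sp j * (near i j * bv i))"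
      by (simp only: mult_ac)
    moreover have "(\<Sum>i<n. \<Sum>j<n. f1 i j + f2 i j + f3 i j + f4 i j) = (\<Sum>i<n. \<Sum>j<n. f1 i j)
        + (\<Sum>i<n. \<Sum>j<n. f2 i j) + (\<Sum>i<n. \<Sum>j<n. f3 i j) + (\<Sum>i<n. \<Sum>j<n. f4 i j)"
      for f1 f2 f3 f4 :: "nat \<Rightarrow> nat \<Rightarrow> real"
      by (simp only: sum.distrib)
    ultimately show ?thesis by (simp only: sum_distrib_left[symmetric])
  qed
  also have "(\<Sum>i<n. \<Sum>j<n. sp j * (near i j * bv i)) = (\<Sum>j<n. sp j * (\<Sum>i<n. near i j * bv i))"
    unfolding sum_distrib_left by (rule sum.swap)
  also have "(\<Sum>i<n. bv i * (\<Sum>j<n. near i j * bv j)) \<le> V * \<epsilon>"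
  proof -
    have "(\<Sum>i<n. bv i * (\<Sum>j<n. near i j * bv j)) \<le> (\<Sum>i<n. bv i) * \<epsilon>"
      unfolding sum_distrib_right by (intro sum_mono mult_left_mono win1 nn)
    also have "\<dots> \<le> V * \<epsilon>" using V \<epsilon> by (rule mult_right_mono)
    finally show ?thesis .
  qed
  also have "(\<Sum>i<n. sp i * (\<Sum>j<n. near i j * bv j)) \<le> q * \<epsilon>"
  proof -
    have "(\<Sum>i<n. sp i * (\<Sum>j<n. near i j * bv j)) \<le> (\<Sum>i<n. sp i) * \<epsilon>"
      unfolding sum_distrib_right by (intro sum_mono mult_left_mono win1 nn)
    also have "\<dots> \<le> q * \<epsilon>" using q \<epsilon> by (rule mult_right_mono)
    finally show ?thesis .
  qed
  also have "(\<Sum>j<n. sp j * (\<Sum>i<n. near i j * bv i)) \<le> q * \<epsilon>"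
  proof -
    have "(\<Sum>j<n. sp j * (\<Sum>i<n. near i j * bv i)) \<le> (\<Sum>i<n. sp i) * \<epsilon>"
      unfolding sum_distrib_right by (intro sum_mono mult_left_mono win2 nn)
    also have "\<dots> \<le> q * \<epsilon>" using q \<epsilon> by (rule mult_right_mono)
    finally show ?thesis .
  qed
  also have "e * ((\<Sum>i<n. ?t i) * (\<Sum>j<n. ?t j)) \<le> e * (V + q)\<^sup>2"
    unfolding power2_eq_square sum.distrib using V q nn V0 q0 e
    by (intro mult_left_mono mult_mono add_mono add_nonneg_nonneg sum_nonneg) auto
  finally show ?thesis by (simp add: algebra_simps)
qed

text \<open>
  The grid has \<open>n + 1\<close> cells numbered from the right; \<open>\<sigma> n i\<close> is a sample point of cell \<open>i\<close> that avoids
  the partition points \<open>Q\<close>, so that consecutive samples are separated by a point of \<open>Q\<close> or lie in a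
  common interval of absolute continuity.
\<close>

locale sampled_impedance = impedance +
  fixes zl zr :: "real \<Rightarrow> real" and \<sigma> :: "nat \<Rightarrow> nat \<Rightarrow> real"
  assumes Qab: "Q \<subseteq> {a<..<b}"
    and ac: "\<And>I. I \<in> partition_intervals a b Q \<Longrightarrow> abs_cont_on I z"
    and zl: "\<And>c. c \<in> Q \<Longrightarrow> (z \<longlongrightarrow> zl c) (at_left c)"
    and zr: "\<And>c. c \<in> Q \<Longrightarrow> (z \<longlongrightarrow> zr c) (at_right c)"
    and \<sigma>: "\<And>n i. i \<le> n \<Longrightarrow> b - real (Suc i) * ((b - a) / real (Suc n)) < \<sigma> n i"
       "\<And>n i. i \<le> n \<Longrightarrow> \<sigma> n i < b - real i * ((b - a) / real (Suc n))"
       "\<And>n i. i \<le> n \<Longrightarrow> \<sigma> n i \<notin> Q"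
begin

section \<open>Sampled reflectivities: diffuse ones and those across a partition point\<close>

definition "h n = (b - a) / real (Suc n)"
definition "s n i = (z (\<sigma> n (Suc i)) - z (\<sigma> n i)) / (z (\<sigma> n (Suc i)) + z (\<sigma> n i))"
text \<open>The largest reflectivity between two impedance values in [m, M].\<close>

definition "\<rho> = (M - m) / (M + m)"
text \<open>Such a step may cross a point of Q at which z does not jump; its reflectivity then tends
  to 0, so the limit is not affected.\<close>

definition "special n i \<longleftrightarrow> (\<exists>c\<in>Q. \<sigma> n (Suc i) < c \<and> c < \<sigma> n i)"
definition "bv n i = (if i < n \<and> \<not> special n i then \<bar>s n i\<bar> else 0)"
text \<open>The value 1 dominates the reflectivity, and the sum becomes a count of points of
  Q.\<close>

definition "sp n i = (if i < n \<and> special n i then 1 else 0 :: real)"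

lemma h_pos: "h n > 0" using ab by (simp add: h_def)
lemma Suc_n_h: "real (Suc n) * h n = b - a" by (simp add: h_def del: of_nat_Suc)
lemma h_lim: "h \<longlonglongrightarrow> 0"
  unfolding h_def by (rule LIMSEQ_Suc[OF lim_const_over_n])

lemma eventually_h_less: "d > 0 \<Longrightarrow> eventually (\<lambda>n. h n < d) sequentially"
  using order_tendstoD(2)[OF h_lim] by simp

lemma \<sigma>_bounds: "i \<le> n \<Longrightarrow> b - real (Suc i) * h n < \<sigma> n i" "i \<le> n \<Longrightarrow> \<sigma> n i < b - real i * h n"
  using \<sigma>(1,2)[of i n] by (simp_all add: h_def)

lemma \<sigma>_in: "i \<le> n \<Longrightarrow> a < \<sigma> n i \<and> \<sigma> n i < b"
proof -
  assume i: "i \<le> n"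
  have "real (Suc i) * h n \<le> real (Suc n) * h n" using i h_pos[of n] by (intro mult_right_mono) auto
  moreover have "real i * h n \<ge> 0" using h_pos[of n] by simp
  ultimately show ?thesis using \<sigma>_bounds[OF i] Suc_n_h[of n] by linarith
qed

lemma \<sigma>_decr: "i < j \<Longrightarrow> j \<le> n \<Longrightarrow> \<sigma> n j < \<sigma> n i"
proof -
  assume ij: "i < j" "j \<le> n"
  have "real (Suc i) * h n \<le> real j * h n" using ij h_pos[of n] by (intro mult_right_mono) auto
  then show ?thesis using \<sigma>_bounds(1)[of i n] \<sigma>_bounds(2)[of j n] ij by simp
qed

lemma \<sigma>_mono: "i \<le> j \<Longrightarrow> j \<le> n \<Longrightarrow> \<sigma> n j \<le> \<sigma> n i"
  using \<sigma>_decr[of i j n] by (cases "i = j") auto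

lemma \<sigma>_gap: "i < j \<Longrightarrow> j \<le> n \<Longrightarrow> \<sigma> n i - \<sigma> n j < (real (j - i) + 1) * h n"
  using \<sigma>_bounds(1)[of j n] \<sigma>_bounds(2)[of i n] by (simp add: of_nat_diff algebra_simps)

lemma z\<sigma>: "i \<le> n \<Longrightarrow> m \<le> z (\<sigma> n i)" "i \<le> n \<Longrightarrow> z (\<sigma> n i) \<le> M"
  using bounds \<sigma>_in by blast+

lemma \<rho>: "0 \<le> \<rho>" "\<rho> < 1"
  using m mM by (auto simp: \<rho>_def field_simps)

lemma s_le: assumes "i < n" shows "\<bar>s n i\<bar> \<le> \<rho>"
proof -
  have *: "(x - y) / (x + y) \<le> \<rho>" if "m \<le> x" "x \<le> M" "m \<le> y" "y \<le> M" for x y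
  proof -
    have "x * m \<le> M * y" using that m by (intro mult_mono) auto
    then have "(x - y) * (M + m) \<le> (M - m) * (x + y)" by (simp add: algebra_simps)
    then show ?thesis unfolding \<rho>_def using that m by (simp add: divide_le_eq le_divide_eq mult.commute)
  qed
  have r: "m \<le> z (\<sigma> n i)" "z (\<sigma> n i) \<le> M" "m \<le> z (\<sigma> n (Suc i))" "z (\<sigma> n (Suc i)) \<le> M"
    using z\<sigma> assms by auto
  have "- s n i = (z (\<sigma> n i) - z (\<sigma> n (Suc i))) / (z (\<sigma> n i) + z (\<sigma> n (Suc i)))"
    by (simp add: s_def minus_divide_left add.commute)
  then have "- s n i \<le> \<rho>" using *[OF r] by simp
  moreover have "s n i \<le> \<rho>" unfolding s_def using *[OF r(3,4,1,2)] .
  ultimately show ?thesis by simp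
qed

lemma s_le_diff: assumes "i < n" shows "\<bar>s n i\<bar> \<le> \<bar>z (\<sigma> n i) - z (\<sigma> n (Suc i))\<bar> / (2 * m)"
proof -
  have r: "m \<le> z (\<sigma> n i)" "m \<le> z (\<sigma> n (Suc i))" using z\<sigma> assms by auto
  have "\<bar>s n i\<bar> = \<bar>z (\<sigma> n i) - z (\<sigma> n (Suc i))\<bar> / (z (\<sigma> n (Suc i)) + z (\<sigma> n i))"
    using r m by (simp add: s_def abs_divide abs_minus_commute)
  also have "\<dots> \<le> \<bar>z (\<sigma> n i) - z (\<sigma> n (Suc i))\<bar> / (2 * m)"
    using r m by (intro frac_le) auto
  finally show ?thesis .
qed

lemma bv_nonneg: "bv n i \<ge> 0" and sp_nonneg: "sp n i \<ge> 0" by (auto simp: bv_def sp_def)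

lemma s_le_bv_sp: "i < n \<Longrightarrow> \<bar>s n i\<bar> \<le> bv n i + sp n i"
  using s_le[of i n] \<rho> by (auto simp: bv_def sp_def)

text \<open>Absolute continuity made uniform in the grid and in the position of the window. A
  diffuse reflectivity is at most the increment of z over its step divided by 2 m, and the step lies
  within one partition interval; the steps are grouped by interval and
  \<open>small_variation\<close> is applied to each group.\<close>

lemma window_bound:
  assumes "\<epsilon> > 0"
  obtains \<delta> where "\<delta> > 0" "\<And>n p w. real w * h n \<le> \<delta> \<Longrightarrow> (\<Sum>i\<in>{p..<p + w}. bv n i) \<le> \<epsilon>"
proof -
  let ?\<P> = "partition_intervals a b Q"
  have fin: "finite ?\<P>" using Q by (rule finite_partition_intervals)
  define k where "k = real (card ?\<P>) + 1"
  have k: "k > 0" by (simp add: k_def add_nonneg_pos)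
  \<comment> \<open>Shared among at most k intervals; the factor 2 m cancels the denominator in
    \<open>s_le_diff\<close>.\<close>
  define \<epsilon>' where "\<epsilon>' = 2 * m * \<epsilon> / k"
  have \<epsilon>': "\<epsilon>' > 0" using assms m k by (simp add: \<epsilon>'_def)
  have "\<forall>I\<in>?\<P>. \<exists>\<delta>>0. small_variation I z \<delta> \<epsilon>'"
    using ac \<epsilon>' unfolding abs_cont_on_iff by blast
  then obtain d where d: "\<And>I. I \<in> ?\<P> \<Longrightarrow> d I > 0 \<and> small_variation I z (d I) \<epsilon>'" by metis
  define \<delta>' where "\<delta>' = Min (insert 1 (d ` ?\<P>))"
  have \<delta>': "\<delta>' > 0" unfolding \<delta>'_def using fin d by (subst Min_gr_iff) auto
  have sv: "small_variation I z \<delta>' \<epsilon>'" if "I \<in> ?\<P>" for I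
  proof (rule small_variation_mono)
    show "small_variation I z (d I) \<epsilon>'" using d that by blast
    show "\<delta>' \<le> d I" unfolding \<delta>'_def using fin that by (intro Min_le) auto
  qed
  show ?thesis
  \<comment> \<open>Sample points lie anywhere in their cells, so a step can be almost 2 h long. A
    window of w steps then has total length at most 2 \<delta>' / 3.\<close>
  proof (rule that[of "\<delta>' / 3"])
    fix n p w assume w: "real w * h n \<le> \<delta>' / 3"
    define X where "X = {i \<in> {p..<p + w}. i < n \<and> \<not> special n i}"
    define XI where "XI I = {i \<in> X. {\<sigma> n (Suc i)..\<sigma> n i} \<subseteq> I}" for I
    let ?D = "\<lambda>i. \<bar>z (\<sigma> n i) - z (\<sigma> n (Suc i))\<bar>"
    have fX: "finite X" by (simp add: X_def)
    have cover: "\<exists>I\<in>?\<P>. i \<in> XI I" if "i \<in> X" for i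
    proof -
      have i: "i < n" "\<not> special n i" using that by (auto simp: X_def)
      have "{\<sigma> n (Suc i)..\<sigma> n i} \<inter> Q = {}"
      proof -
        have "\<sigma> n i \<notin> Q" "\<sigma> n (Suc i) \<notin> Q" using \<sigma>(3) i(1) by auto
        then have "c \<notin> {\<sigma> n (Suc i)..\<sigma> n i}" if "c \<in> Q" for c
          using i that unfolding special_def by (auto simp: le_less)
        then show ?thesis by blast
      qed
      then obtain I where "I \<in> ?\<P>" "{\<sigma> n (Suc i)..\<sigma> n i} \<subseteq> I"
        using partition_interval_containing[OF Q, of a "\<sigma> n (Suc i)" "\<sigma> n i" b] i \<sigma>_in \<sigma>_mono[of i "Suc i" n]
        by auto
      then show ?thesis using that by (auto simp: XI_def)
    qed
    have piece: "(\<Sum>i\<in>XI I. ?D i) \<le> \<epsilon>'" if I: "I \<in> ?\<P>" for I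
    proof -
      let ?g = "\<lambda>i. (\<sigma> n (Suc i), \<sigma> n i)"
      let ?E = "?g ` XI I"
      have XIn: "i < n \<and> i \<in> {p..<p + w} \<and> {\<sigma> n (Suc i)..\<sigma> n i} \<subseteq> I" if "i \<in> XI I" for i
        using that by (auto simp: XI_def X_def)
      have inj: "inj_on ?g (XI I)"
      proof (rule inj_onI)
        fix i j assume ij: "i \<in> XI I" "j \<in> XI I" "?g i = ?g j"
        show "i = j"
          using \<sigma>_decr[of i j n] \<sigma>_decr[of j i n] XIn[OF ij(1)] XIn[OF ij(2)] ij(3)
          by (cases i j rule: linorder_cases) auto
      qed
      have "(\<Sum>(u, v)\<in>?E. norm (z v - z u)) < \<epsilon>'"
      proof (rule small_variationD[OF sv[OF I]])
        show "finite ?E" using fX by (simp add: XI_def)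
        show "u < v \<and> {u..v} \<subseteq> I" if uv: "(u, v) \<in> ?E" for u v
        proof -
          obtain i where i: "i \<in> XI I" "u = \<sigma> n (Suc i)" "v = \<sigma> n i" using uv by auto
          then show ?thesis using XIn[OF i(1)] \<sigma>_decr[of i "Suc i" n] by simp
        qed
        show "disjoint_family_on (\<lambda>(u, v). {u<..<v}) ?E"
          unfolding disjoint_family_on_def
        proof (intro ballI impI)
          fix K L assume KL: "K \<in> ?E" "L \<in> ?E" "K \<noteq> L"
          obtain i where i: "i \<in> XI I" "K = ?g i" using KL(1) by auto
          obtain j where j: "j \<in> XI I" "L = ?g j" using KL(2) by auto
          have "i \<noteq> j" using KL(3) i j by auto
          then show "(case K of (u, v) \<Rightarrow> {u<..<v}) \<inter> (case L of (u, v) \<Rightarrow> {u<..<v}) = {}"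
            using \<sigma>_mono[of "Suc i" j n] \<sigma>_mono[of "Suc j" i n] XIn[OF i(1)] XIn[OF j(1)] i(2) j(2)
            by (cases i j rule: linorder_cases) auto
        qed
        have "(\<Sum>(u, v)\<in>?E. v - u) = (\<Sum>i\<in>XI I. \<sigma> n i - \<sigma> n (Suc i))"
          by (subst sum.reindex[OF inj]) simp
        also have "\<dots> \<le> (\<Sum>i\<in>XI I. 2 * h n)"
        proof (rule sum_mono)
          fix i assume "i \<in> XI I"
          then show "\<sigma> n i - \<sigma> n (Suc i) \<le> 2 * h n"
            using \<sigma>_gap[of i "Suc i" n] XIn[of i] by (simp add: less_imp_le)
        qed
        also have "\<dots> \<le> (\<Sum>i\<in>{p..<p + w}. 2 * h n)"
          using XIn h_pos[of n] by (intro sum_mono2) (auto simp: less_imp_le)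
        also have "\<dots> = 2 * (real w * h n)" by simp
        also have "\<dots> < \<delta>'" using w \<delta>' by linarith
        finally show "(\<Sum>(u, v)\<in>?E. v - u) < \<delta>'" .
      qed
      moreover have "(\<Sum>(u, v)\<in>?E. norm (z v - z u)) = (\<Sum>i\<in>XI I. ?D i)"
        by (subst sum.reindex[OF inj]) simp
      ultimately show ?thesis by simp
    qed
    have "(\<Sum>i\<in>{p..<p + w}. bv n i) = (\<Sum>i\<in>X. \<bar>s n i\<bar>)"
      by (rule sum.mono_neutral_cong_right) (auto simp: X_def bv_def)
    also have "\<dots> \<le> (\<Sum>i\<in>X. ?D i / (2 * m))"
      by (intro sum_mono s_le_diff) (auto simp: X_def)
    also have "\<dots> = (\<Sum>i\<in>X. ?D i) / (2 * m)" by (simp add: sum_divide_distrib)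
    also have "(\<Sum>i\<in>X. ?D i) \<le> (\<Sum>I\<in>?\<P>. \<Sum>i\<in>XI I. ?D i)"
    proof -
      obtain J where J: "\<And>i. i \<in> X \<Longrightarrow> J i \<in> ?\<P> \<and> i \<in> XI (J i)" using cover by metis
      have "(\<Sum>i\<in>X. ?D i) = (\<Sum>I\<in>?\<P>. \<Sum>i\<in>{i \<in> X. J i = I}. ?D i)"
        by (rule sum.group[symmetric]) (use fX fin J in auto)
      also have "\<dots> \<le> (\<Sum>I\<in>?\<P>. \<Sum>i\<in>XI I. ?D i)"
        using J fX by (intro sum_mono sum_mono2) (auto simp: XI_def)
      finally show ?thesis .
    qed
    also have "\<dots> \<le> (\<Sum>I\<in>?\<P>. \<epsilon>')" by (intro sum_mono piece)
    also have "\<dots> = real (card ?\<P>) * \<epsilon>'" by simp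
    also have "\<dots> \<le> k * \<epsilon>'" using \<epsilon>' by (simp add: k_def)
    also have "\<dots> / (2 * m) = \<epsilon>" using k m by (simp add: \<epsilon>'_def)
    finally show "(\<Sum>i\<in>{p..<p + w}. bv n i) \<le> \<epsilon>" using m by (simp add: divide_right_mono)
  qed (use \<delta>' in auto)
qed

text \<open>Bounded variation from absolute continuity: the grid is cut into windows of length about
  \<delta>, each contributing at most 1.\<close>

lemma total_bound:
  obtains V where "V \<ge> 0" "\<And>n. (\<Sum>i<n. bv n i) \<le> V"
proof -
  obtain \<delta> where \<delta>: "\<delta> > 0" "\<And>n p w. real w * h n \<le> \<delta> \<Longrightarrow> (\<Sum>i\<in>{p..<p + w}. bv n i) \<le> 1"
    using window_bound[of 1] by auto
  \<comment> \<open>The factor 2 is lost in rounding w down, as w h is at least \<delta> / 2; the 1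
    pays for the last, incomplete window.\<close>
  define V where "V = 2 * (b - a) / \<delta> + 1"
  have "V \<ge> 0" using \<delta> ab by (simp add: V_def)
  moreover have "(\<Sum>i<n. bv n i) \<le> V" for n
  proof (cases "h n \<le> \<delta>")
    case False
    \<comment> \<open>A grid too coarse for a window has few cells, and each term is at most \<rho>
      < 1.\<close>
    have "(\<Sum>i<n. bv n i) \<le> (\<Sum>i<n. 1)"
      using s_le \<rho> by (intro sum_mono) (force simp: bv_def)
    also have "\<dots> \<le> real (Suc n)" by simp
    also have "\<dots> \<le> (b - a) / \<delta>"
    proof -
      have "real (Suc n) * \<delta> \<le> real (Suc n) * h n" using False by (intro mult_left_mono) auto
      then show ?thesis unfolding Suc_n_h pos_le_divide_eq[OF \<delta>(1)] .
    qed
    also have "\<dots> \<le> V" using ab \<delta> by (simp add: V_def divide_right_mono add_increasing2)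
    finally show ?thesis .
  next
    case True
    define w where "w = nat \<lfloor>\<delta> / h n\<rfloor>"
    have quot: "\<delta> / h n \<ge> 1" using True h_pos[of n] by simp
    have w1: "real w \<le> \<delta> / h n" and w2: "\<delta> / h n < real w + 1" using quot by (auto simp: w_def)
    have wpos: "w \<ge> 1" using quot by (simp add: w_def le_nat_iff)
    have wh: "real w * h n \<le> \<delta>" using w1 h_pos[of n] by (simp add: pos_le_divide_eq)
    have wh2: "\<delta> \<le> 2 * real w * h n"
    proof -
      have "\<delta> / h n \<le> 2 * real w" using w2 wpos by simp
      then show ?thesis using h_pos[of n] by (simp add: pos_divide_le_eq)
    qed
    define q where "q = Suc (n div w)"
    have nq: "n \<le> q * w"
      using dividend_less_div_times[of w n] wpos by (simp add: q_def)
    have "(\<Sum>i<n. bv n i) \<le> (\<Sum>i<q * w. bv n i)"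
      using nq bv_nonneg by (intro sum_mono2) auto
    also have "\<dots> = (\<Sum>l<q. \<Sum>i\<in>{l * w..<l * w + w}. bv n i)" by (simp add: sum.nat_group)
    also have "\<dots> \<le> (\<Sum>l<q. 1)" by (intro sum_mono \<delta>(2) wh)
    also have "\<dots> = real (n div w) + 1" by (simp add: q_def)
    also have "real (n div w) \<le> real n / real w" by (rule of_nat_div_le_of_nat)
    also have "\<dots> \<le> 2 * (b - a) / \<delta>"
    proof -
      have "real n * \<delta> \<le> real n * (2 * real w * h n)" using wh2 by (intro mult_left_mono) auto
      also have "\<dots> \<le> 2 * real w * (real (Suc n) * h n)" using h_pos[of n] by (simp add: algebra_simps)
      also have "\<dots> = 2 * (b - a) * real w" unfolding Suc_n_h by simp
      finally show ?thesis using \<delta> wpos by (simp add: field_simps)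
    qed
    finally show ?thesis by (simp add: V_def)
  qed
  ultimately show ?thesis by (rule that)
qed

lemma special_unique:
  assumes "i < n" "j < n" "\<sigma> n (Suc i) < c" "c < \<sigma> n i" "\<sigma> n (Suc j) < c" "c < \<sigma> n j"
  shows "i = j"
  using \<sigma>_mono[of "Suc i" j n] \<sigma>_mono[of "Suc j" i n] assms by (cases i j rule: linorder_cases) auto

lemma special_count: "(\<Sum>i<n. sp n i) \<le> real (card Q)"
proof -
  let ?X = "{i. i < n \<and> special n i}"
  have "\<forall>i\<in>?X. \<exists>c\<in>Q. \<sigma> n (Suc i) < c \<and> c < \<sigma> n i" by (auto simp: special_def)
  then obtain c where c: "\<And>i. i \<in> ?X \<Longrightarrow> c i \<in> Q \<and> \<sigma> n (Suc i) < c i \<and> c i < \<sigma> n i" by metis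
  have "inj_on c ?X"
    by (rule inj_onI) (use c special_unique in \<open>metis (no_types, lifting) mem_Collect_eq\<close>)
  then have "card ?X \<le> card Q" using c Q by (intro card_inj_on_le[of c]) auto
  moreover have "(\<Sum>i<n. sp n i) = real (card ?X)"
  proof -
    have "(\<Sum>i<n. sp n i) = (\<Sum>i\<in>?X. 1)"
      by (rule sum.mono_neutral_cong_right) (auto simp: sp_def)
    then show ?thesis by simp
  qed
  ultimately show ?thesis by simp
qed

lemma gap: obtains g where "g > 0" "\<And>c c'. c \<in> Q \<Longrightarrow> c' \<in> Q \<Longrightarrow> c \<noteq> c' \<Longrightarrow> g \<le> \<bar>c - c'\<bar>"
proof -
  \<comment> \<open>The inserted 1 keeps the set nonempty when Q has fewer than two points.\<close>
  let ?S = "insert 1 ((\<lambda>(c, c'). \<bar>c - c'\<bar>) ` {(c, c') \<in> Q \<times> Q. c \<noteq> c'})"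
  have fin: "finite ?S" using Q by (auto intro: finite_subset[of _ "Q \<times> Q"])
  show ?thesis
  proof (rule that[of "Min ?S"])
    show "Min ?S > 0" using fin by (subst Min_gr_iff) auto
    show "Min ?S \<le> \<bar>c - c'\<bar>" if "c \<in> Q" "c' \<in> Q" "c \<noteq> c'" for c c'
      using fin that by (intro Min_le) auto
  qed
qed

lemma sum_s_bounded: obtains V where "\<And>n. (\<Sum>i<n. \<bar>s n i\<bar>) \<le> V"
proof -
  obtain V where V: "\<And>n. (\<Sum>i<n. bv n i) \<le> V" using total_bound by blast
  have "(\<Sum>i<n. \<bar>s n i\<bar>) \<le> V + real (card Q)" for n
  proof -
    have "(\<Sum>i<n. \<bar>s n i\<bar>) \<le> (\<Sum>i<n. bv n i + sp n i)" by (intro sum_mono s_le_bv_sp) auto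
    then show ?thesis using V[of n] special_count[of n] by (simp add: sum.distrib)
  qed
  then show ?thesis by (rule that)
qed

text \<open>The window length \<delta> is chosen first, for the near pairs, and then \<eta> so large
  that pairs further apart than \<delta> are damped enough. Both depend on \<epsilon> but not on
  n.\<close>

lemma pair_sum_small:
  assumes "\<epsilon> > 0"
  obtains \<eta> where "\<eta> > 0" "eventually (\<lambda>n. (\<Sum>i<n. \<Sum>j<i. \<bar>s n i\<bar> * \<bar>s n j\<bar> *
      exp (- (2 * \<eta> * h n * real (i - j)))) \<le> \<epsilon>) sequentially"
proof -
  obtain V where V: "V \<ge> 0" "\<And>n. (\<Sum>i<n. bv n i) \<le> V" using total_bound by blast
  let ?q = "real (card Q)"
  define D where "D = V + 2 * ?q + 1"
  define \<epsilon>1 where "\<epsilon>1 = \<epsilon> / (2 * D)"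
  have den: "D > 0" using V by (simp add: D_def add_nonneg_pos)
  have \<epsilon>1: "\<epsilon>1 > 0" using assms den by (simp add: \<epsilon>1_def)
  obtain \<delta>0 where \<delta>0: "\<delta>0 > 0" "\<And>n p w. real w * h n \<le> \<delta>0 \<Longrightarrow> (\<Sum>i\<in>{p..<p + w}. bv n i) \<le> \<epsilon>1"
    using window_bound[OF \<epsilon>1] by blast
  obtain g where g: "g > 0" "\<And>c c'. c \<in> Q \<Longrightarrow> c' \<in> Q \<Longrightarrow> c \<noteq> c' \<Longrightarrow> g \<le> \<bar>c - c'\<bar>"
    using gap by blast
  \<comment> \<open>Two special steps at index distance at most w would put two points of Q within
    (w + 2) h < 2 \<delta> of each other, hence closer than g.\<close>
  define \<delta> where "\<delta> = min \<delta>0 (g / 4)"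
  have \<delta>: "\<delta> > 0" "\<delta> \<le> \<delta>0" "\<delta> \<le> g / 4" using \<delta>0 g by (auto simp: \<delta>_def)
  define T where "T = (V + ?q)\<^sup>2 + 1"
  have T: "T > 0" by (simp add: T_def add_nonneg_pos)
  \<comment> \<open>Solves exp (- 2 \<eta> \<delta>) T \<le> \<epsilon> / 2; the maximum with 1 only
    ensures positivity.\<close>
  define \<eta> where "\<eta> = max 1 (ln (2 * T / \<epsilon>) / (2 * \<delta>))"
  have \<eta>: "\<eta> > 0" by (simp add: \<eta>_def)
  define e where "e = exp (- (2 * \<eta> * \<delta>))"
  have eT: "e * T \<le> \<epsilon> / 2"
  proof -
    have "ln (2 * T / \<epsilon>) / (2 * \<delta>) \<le> \<eta>" by (simp add: \<eta>_def)
    then have "ln (2 * T / \<epsilon>) \<le> 2 * \<eta> * \<delta>" using \<delta> by (simp add: pos_divide_le_eq mult_ac)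
    then have "exp (ln (2 * T / \<epsilon>)) \<le> exp (2 * \<eta> * \<delta>)" by simp
    then have "2 * T / \<epsilon> \<le> exp (2 * \<eta> * \<delta>)" using T assms by simp
    then show ?thesis using assms by (simp add: e_def exp_minus field_simps)
  qed
  have "eventually (\<lambda>n. h n < \<delta> / 2) sequentially" using \<delta> by (intro eventually_h_less) auto
  then have "eventually (\<lambda>n. (\<Sum>i<n. \<Sum>j<i. \<bar>s n i\<bar> * \<bar>s n j\<bar> *
      exp (- (2 * \<eta> * h n * real (i - j)))) \<le> \<epsilon>) sequentially"
  proof eventually_elim
    case (elim n)
    define w where "w = nat \<lfloor>\<delta> / h n\<rfloor>"
    have quot: "\<delta> / h n \<ge> 0" using \<delta> h_pos[of n] by simp
    have w1: "real w \<le> \<delta> / h n" and w2: "\<delta> / h n < real w + 1" using quot by (auto simp: w_def)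
    have wh: "real w * h n \<le> \<delta>" using w1 h_pos[of n] by (simp add: pos_le_divide_eq)
    have wh2: "\<delta> \<le> (real w + 1) * h n" using w2 h_pos[of n] by (simp add: pos_divide_less_eq)
    have "(\<Sum>i<n. \<Sum>j<i. \<bar>s n i\<bar> * \<bar>s n j\<bar> * exp (- (2 * \<eta> * h n * real (i - j))))
        \<le> (V + 2 * ?q) * \<epsilon>1 + e * (V + ?q)\<^sup>2"
    proof (rule pair_sum_bound[where bv = "bv n" and sp = "sp n" and w = w])
      fix i j assume ij: "j < i" "i \<le> j + w" "i < n"
      show "sp n i * sp n j = 0"
      proof (rule ccontr)
        assume "sp n i * sp n j \<noteq> 0"
        then have "special n i" "special n j" by (auto simp: sp_def split: if_splits)
        then obtain c c' where c: "c \<in> Q" "\<sigma> n (Suc j) < c" "c < \<sigma> n j"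
          and c': "c' \<in> Q" "\<sigma> n (Suc i) < c'" "c' < \<sigma> n i"
          unfolding special_def by blast
        have "\<sigma> n i \<le> \<sigma> n (Suc j)" using ij by (intro \<sigma>_mono) auto
        then have "c' < c" using c c' by simp
        then have "g \<le> c - c'" using g(2)[OF c(1) c'(1)] by simp
        also have "c - c' < \<sigma> n j - \<sigma> n (Suc i)" using c c' by simp
        also have "\<dots> < (real (Suc i - j) + 1) * h n" using ij by (intro \<sigma>_gap) auto
        also have "\<dots> \<le> (real w + 2) * h n" using ij h_pos[of n] by (intro mult_right_mono) auto
        also have "\<dots> \<le> \<delta> + 2 * (\<delta> / 2)" using wh elim by (simp add: algebra_simps)
        also have "\<dots> < g" using \<delta> g by simp
        finally show False .
      qed
    next
      fix i j assume ij: "j < i" "i < n"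
      show "0 \<le> exp (- (2 * \<eta> * h n * real (i - j))) \<and> exp (- (2 * \<eta> * h n * real (i - j))) \<le> 1"
        using \<eta> h_pos[of n] by simp
      assume "j + w < i"
      then have "(real w + 1) * h n \<le> real (i - j) * h n" using h_pos[of n] by (intro mult_right_mono) auto
      then have "\<delta> \<le> h n * real (i - j)" using wh2 by (simp add: mult.commute)
      then have "2 * \<eta> * \<delta> \<le> 2 * \<eta> * (h n * real (i - j))" using \<eta> by (intro mult_left_mono) auto
      then show "exp (- (2 * \<eta> * h n * real (i - j))) \<le> e" by (simp add: e_def mult.assoc)
    qed (use s_le_bv_sp bv_nonneg sp_nonneg V special_count \<delta>0(2) order_trans[OF wh \<delta>(2)] \<epsilon>1 in \<open>auto simp: e_def\<close>)
    also have "(V + 2 * ?q) * \<epsilon>1 \<le> \<epsilon> / 2"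
    proof -
      have "(V + 2 * ?q) * \<epsilon>1 \<le> D * \<epsilon>1" using \<epsilon>1 by (intro mult_right_mono) (auto simp: D_def)
      also have "\<dots> = \<epsilon> / 2" using den by (simp add: \<epsilon>1_def)
      finally show ?thesis .
    qed
    also have "e * (V + ?q)\<^sup>2 \<le> e * T" by (simp add: T_def e_def)
    also note eT
    finally show ?case by simp
  qed
  with \<eta> show ?thesis by (rule that)
qed

end

section \<open>Passing to the limit\<close>

lemma minus_ln_bounds:
  fixes x r :: real
  assumes "0 \<le> x" "x \<le> r" "r < 1"
  shows "0 \<le> - ln (1 - x)" "- ln (1 - x) \<le> x / (1 - r)"
proof -
  have "- ln (1 - x) = ln (1 / (1 - x))" using assms by (simp add: ln_div)
  also have "\<dots> \<le> 1 / (1 - x) - 1" using assms by (intro ln_le_minus_one) auto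
  also have "\<dots> = x / (1 - x)" using assms by (simp add: field_simps)
  also have "\<dots> \<le> x / (1 - r)" using assms by (intro frac_le) auto
  finally show "- ln (1 - x) \<le> x / (1 - r)" .
  have "ln (1 - x) \<le> ln 1" using assms by (intro ln_mono) auto
  then show "0 \<le> - ln (1 - x)" by simp
qed

context sampled_impedance
begin

section \<open>Limit of the logarithmic losses at the interfaces\<close>

lemma zlr: assumes "c \<in> Q" shows "zl c \<ge> m" "zr c \<ge> m"
proof -
  have c: "a < c" "c < b" using assms Qab by auto
  have "eventually (\<lambda>x. x \<in> {a<..<c}) (at_left c)" using c by (intro eventually_at_left_real)
  then have "eventually (\<lambda>x. m \<le> z x) (at_left c)" by eventually_elim (use bounds c in auto)
  then show "zl c \<ge> m" using zl[OF assms] by (intro tendsto_lowerbound) auto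
  have "eventually (\<lambda>x. x \<in> {c<..<b}) (at_right c)" using c by (intro eventually_at_right_real)
  then have "eventually (\<lambda>x. m \<le> z x) (at_right c)" by eventually_elim (use bounds c in auto)
  then show "zr c \<ge> m" using zr[OF assms] by (intro tendsto_lowerbound) auto
qed

text \<open>The step crossing c: the first sample to the left of c is its left end. The value is
  meaningful once c lies between the extreme samples, which holds for all fine grids.\<close>

definition "idx n c = (LEAST k. \<sigma> n k < c) - 1"

lemma idx:
  assumes "c \<in> Q" "\<sigma> n n < c" "c < \<sigma> n 0"
  shows "idx n c < n" "\<sigma> n (Suc (idx n c)) < c" "c < \<sigma> n (idx n c)"
proof -
  define k where "k = (LEAST k. \<sigma> n k < c)"
  have k1: "\<sigma> n k < c" unfolding k_def using assms(2) by (rule LeastI)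
  have k2: "k \<le> n" unfolding k_def using assms(2) by (rule Least_le)
  have "k \<noteq> 0" using k1 assms(3) by (metis less_asym)
  then obtain l where l: "k = Suc l" by (cases k) auto
  have "\<not> \<sigma> n l < c" using not_less_Least[of l "\<lambda>k. \<sigma> n k < c"] l unfolding k_def[symmetric] by simp
  moreover have "\<sigma> n l \<noteq> c" using \<sigma>(3)[of l n] assms(1) k2 l by auto
  ultimately show "idx n c < n" "\<sigma> n (Suc (idx n c)) < c" "c < \<sigma> n (idx n c)"
    using k1 k2 l unfolding idx_def k_def[symmetric] by auto
qed

lemma eventually_idx:
  assumes "c \<in> Q"
  shows "eventually (\<lambda>n. idx n c < n \<and> \<sigma> n (Suc (idx n c)) < c \<and> c < \<sigma> n (idx n c)) sequentially"
proof -
  have c: "a < c" "c < b" using assms Qab by auto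
  have "eventually (\<lambda>n. h n < c - a) sequentially" "eventually (\<lambda>n. h n < b - c) sequentially"
    using c by (auto intro: eventually_h_less)
  then show ?thesis
  proof eventually_elim
    case (elim n)
    have "\<sigma> n n < b - real n * h n" by (rule \<sigma>_bounds) simp
    also have "\<dots> = a + h n" using Suc_n_h[of n] by (simp add: algebra_simps)
    finally have "\<sigma> n n < c" using elim by simp
    moreover have "b - h n < \<sigma> n 0" using \<sigma>_bounds(1)[of 0 n] by simp
    then have "c < \<sigma> n 0" using elim by simp
    ultimately show ?case using idx[OF assms] by simp
  qed
qed

text \<open>Cells are numbered from the right, so index \<open>idx n c\<close> samples to the right
  of c and its successor to the left. Both samples are within 2 h of c and strictly on their sides,
  so the one-sided limits apply.\<close>

lemma z_idx_lim:
  assumes "c \<in> Q"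
  shows "(\<lambda>n. z (\<sigma> n (idx n c))) \<longlonglongrightarrow> zr c" "(\<lambda>n. z (\<sigma> n (Suc (idx n c)))) \<longlonglongrightarrow> zl c"
proof -
  have h0: "(\<lambda>n. 2 * h n) \<longlonglongrightarrow> 0" using tendsto_mult[OF tendsto_const[of 2] h_lim] by simp
  have ev: "eventually (\<lambda>n. \<sigma> n (Suc (idx n c)) < c \<and> c < \<sigma> n (idx n c)
      \<and> \<sigma> n (idx n c) - \<sigma> n (Suc (idx n c)) < 2 * h n) sequentially"
    using eventually_idx[OF assms]
  proof eventually_elim
    case (elim n)
    then show ?case using \<sigma>_gap[of "idx n c" "Suc (idx n c)" n] by simp
  qed
  have "(\<lambda>n. \<sigma> n (idx n c) - c) \<longlonglongrightarrow> 0"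
    by (rule Lim_null_comparison[OF _ h0]) (use ev in eventually_elim, auto)
  then have "(\<lambda>n. \<sigma> n (idx n c)) \<longlonglongrightarrow> c" by (rule LIM_zero_cancel)
  then have "filterlim (\<lambda>n. \<sigma> n (idx n c)) (at_right c) sequentially"
    unfolding filterlim_at using ev by (auto elim: eventually_mono)
  from filterlim_compose[OF zr[OF assms] this] show "(\<lambda>n. z (\<sigma> n (idx n c))) \<longlonglongrightarrow> zr c" .
  have "(\<lambda>n. \<sigma> n (Suc (idx n c)) - c) \<longlonglongrightarrow> 0"
    by (rule Lim_null_comparison[OF _ h0]) (use ev in eventually_elim, auto)
  then have "(\<lambda>n. \<sigma> n (Suc (idx n c))) \<longlonglongrightarrow> c" by (rule LIM_zero_cancel)
  then have "filterlim (\<lambda>n. \<sigma> n (Suc (idx n c))) (at_left c) sequentially"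
    unfolding filterlim_at using ev by (auto elim: eventually_mono)
  from filterlim_compose[OF zl[OF assms] this] show "(\<lambda>n. z (\<sigma> n (Suc (idx n c)))) \<longlonglongrightarrow> zl c" .
qed

definition "r c = (zl c - zr c) / (zl c + zr c)"

lemma r_less_1: "c \<in> Q \<Longrightarrow> (r c)\<^sup>2 < 1"
proof -
  assume "c \<in> Q"
  then have "\<bar>zl c - zr c\<bar> < zl c + zr c" using zlr[of c] m by (simp add: abs_if)
  then have "\<bar>r c\<bar> < 1" by (simp add: r_def)
  then show ?thesis by (simp add: abs_square_less_1)
qed

lemma s_idx_lim: "c \<in> Q \<Longrightarrow> (\<lambda>n. s n (idx n c)) \<longlonglongrightarrow> r c"
  unfolding s_def r_def using zlr[of c] m by (intro tendsto_intros z_idx_lim) auto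

definition "logloss n = (\<Sum>i<n. - ln (1 - (s n i)\<^sup>2))"

lemma logloss_summand:
  assumes "i < n"
  shows "0 \<le> - ln (1 - (s n i)\<^sup>2)" "- ln (1 - (s n i)\<^sup>2) \<le> (s n i)\<^sup>2 / (1 - \<rho>\<^sup>2)"
proof -
  have "(s n i)\<^sup>2 \<le> \<rho>\<^sup>2" using s_le[OF assms] \<rho> by (simp add: abs_le_square_iff[symmetric])
  moreover have "\<rho>\<^sup>2 < 1" using \<rho> by (simp add: abs_square_less_1)
  ultimately show "0 \<le> - ln (1 - (s n i)\<^sup>2)" "- ln (1 - (s n i)\<^sup>2) \<le> (s n i)\<^sup>2 / (1 - \<rho>\<^sup>2)"
    using minus_ln_bounds[of "(s n i)\<^sup>2" "\<rho>\<^sup>2"] by auto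
qed

text \<open>Each loss is of second order in the reflectivity. A sum of squares is at most the
  largest term times the total: the largest tends to 0 by \<open>window_bound\<close> with a window
  of one step, and the total stays bounded.\<close>

lemma nonspecial_logloss_lim:
  "(\<lambda>n. \<Sum>i\<in>{i. i < n \<and> \<not> special n i}. - ln (1 - (s n i)\<^sup>2)) \<longlonglongrightarrow> 0"
proof (rule tendstoI)
  fix e :: real assume e: "e > 0"
  obtain V where V: "V \<ge> 0" "\<And>n. (\<Sum>i<n. bv n i) \<le> V" using total_bound by blast
  have r1: "1 - \<rho>\<^sup>2 > 0" using \<rho> by (simp add: abs_square_less_1)
  define \<epsilon> where "\<epsilon> = e * (1 - \<rho>\<^sup>2) / (V + 1)"
  have \<epsilon>: "\<epsilon> > 0" using e r1 V by (simp add: \<epsilon>_def)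
  obtain \<delta> where \<delta>: "\<delta> > 0" "\<And>n p w. real w * h n \<le> \<delta> \<Longrightarrow> (\<Sum>i\<in>{p..<p + w}. bv n i) \<le> \<epsilon>"
    using window_bound[OF \<epsilon>] by blast
  have "eventually (\<lambda>n. h n < \<delta>) sequentially" using \<delta> by (intro eventually_h_less)
  then show "eventually (\<lambda>n. dist (\<Sum>i\<in>{i. i < n \<and> \<not> special n i}. - ln (1 - (s n i)\<^sup>2)) 0 < e) sequentially"
  proof eventually_elim
    case (elim n)
    let ?X = "{i. i < n \<and> \<not> special n i}"
    have bvle: "bv n i \<le> \<epsilon>" for i using \<delta>(2)[of 1 n i] elim by simp
    have "(\<Sum>i\<in>?X. - ln (1 - (s n i)\<^sup>2)) \<le> (\<Sum>i\<in>?X. bv n i * \<epsilon> / (1 - \<rho>\<^sup>2))"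
    proof (rule sum_mono)
      fix i assume i: "i \<in> ?X"
      have "(s n i)\<^sup>2 = bv n i * bv n i" using i by (simp add: bv_def power2_eq_square abs_mult_self_eq)
      also have "\<dots> \<le> bv n i * \<epsilon>" using bvle bv_nonneg by (intro mult_left_mono)
      finally have "(s n i)\<^sup>2 / (1 - \<rho>\<^sup>2) \<le> bv n i * \<epsilon> / (1 - \<rho>\<^sup>2)" using r1 by (simp add: divide_right_mono)
      then show "- ln (1 - (s n i)\<^sup>2) \<le> bv n i * \<epsilon> / (1 - \<rho>\<^sup>2)" using logloss_summand(2)[of i n] i by simp
    qed
    also have "\<dots> = (\<Sum>i\<in>?X. bv n i) * \<epsilon> / (1 - \<rho>\<^sup>2)"
      by (simp add: sum_distrib_right sum_divide_distrib)
    also have "(\<Sum>i\<in>?X. bv n i) \<le> (\<Sum>i<n. bv n i)" using bv_nonneg by (intro sum_mono2) auto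
    also have "\<dots> \<le> V" by (rule V)
    also have "V * \<epsilon> / (1 - \<rho>\<^sup>2) = V * e / (V + 1)" using r1 by (simp add: \<epsilon>_def)
    also have "\<dots> < e" using e V by (simp add: field_simps)
    finally have "(\<Sum>i\<in>?X. - ln (1 - (s n i)\<^sup>2)) < e"
      using \<epsilon> r1 by (simp add: divide_right_mono mult_right_mono)
    moreover have "0 \<le> (\<Sum>i\<in>?X. - ln (1 - (s n i)\<^sup>2))" using logloss_summand(1) by (intro sum_nonneg) auto
    ultimately show ?case by (simp add: dist_real_def)
  qed
qed

text \<open>For fine grids \<open>idx n\<close> is a bijection from Q to the special steps, so their
  losses form a sum over the fixed finite set Q with convergent terms.\<close>

lemma logloss_lim: "logloss \<longlonglongrightarrow> (\<Sum>c\<in>Q. - ln (1 - (r c)\<^sup>2))"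
proof -
  obtain g where g: "g > 0" "\<And>c c'. c \<in> Q \<Longrightarrow> c' \<in> Q \<Longrightarrow> c \<noteq> c' \<Longrightarrow> g \<le> \<bar>c - c'\<bar>"
    using gap by blast
  have "eventually (\<lambda>n. \<forall>c\<in>Q. idx n c < n \<and> \<sigma> n (Suc (idx n c)) < c \<and> c < \<sigma> n (idx n c)) sequentially"
    using Q eventually_idx by (simp add: eventually_ball_finite)
  \<comment> \<open>A step is shorter than 2 h < g, so it crosses at most one point of Q.\<close>
  moreover have "eventually (\<lambda>n. h n < g / 2) sequentially" using g by (intro eventually_h_less) auto
  ultimately have ev: "eventually (\<lambda>n. (\<Sum>i\<in>{i. i < n \<and> special n i}. - ln (1 - (s n i)\<^sup>2))
      = (\<Sum>c\<in>Q. - ln (1 - (s n (idx n c))\<^sup>2))) sequentially"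
  proof eventually_elim
    case (elim n)
    have "inj_on (idx n) Q"
    proof (rule inj_onI, rule ccontr)
      fix c c' assume c: "c \<in> Q" "c' \<in> Q" "idx n c = idx n c'" "c \<noteq> c'"
      have "\<sigma> n (idx n c) - \<sigma> n (Suc (idx n c)) < 2 * h n"
        using elim(1) c(1) \<sigma>_gap[of "idx n c" "Suc (idx n c)" n] by (simp add: Suc_le_eq)
      moreover have "\<sigma> n (Suc (idx n c)) < c" "c < \<sigma> n (idx n c)"
        "\<sigma> n (Suc (idx n c)) < c'" "c' < \<sigma> n (idx n c)"
        using bspec[OF elim(1) c(1)] bspec[OF elim(1) c(2)] c(3) by simp_all
      then have "\<bar>c - c'\<bar> < \<sigma> n (idx n c) - \<sigma> n (Suc (idx n c))" by linarith
      ultimately show False using g(2)[OF c(1,2,4)] elim by simp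
    qed
    moreover have "idx n ` Q = {i. i < n \<and> special n i}"
    proof (intro equalityI subsetI)
      fix i assume "i \<in> {i. i < n \<and> special n i}"
      then obtain c where c: "i < n" "c \<in> Q" "\<sigma> n (Suc i) < c" "c < \<sigma> n i" by (auto simp: special_def)
      then have "i = idx n c" using special_unique[of i n "idx n c" c] elim by auto
      then show "i \<in> idx n ` Q" using c by blast
    qed (use elim in \<open>auto simp: special_def\<close>)
    ultimately have "bij_betw (idx n) Q {i. i < n \<and> special n i}" by (simp add: bij_betw_def)
    from sum.reindex_bij_betw[OF this, of "\<lambda>i. - ln (1 - (s n i)\<^sup>2)"] show ?case by simp
  qed
  have "(\<lambda>n. \<Sum>c\<in>Q. - ln (1 - (s n (idx n c))\<^sup>2)) \<longlonglongrightarrow> (\<Sum>c\<in>Q. - ln (1 - (r c)\<^sup>2))"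
    using r_less_1 by (intro tendsto_intros s_idx_lim) force+
  then have sp: "(\<lambda>n. \<Sum>i\<in>{i. i < n \<and> special n i}. - ln (1 - (s n i)\<^sup>2)) \<longlonglongrightarrow> (\<Sum>c\<in>Q. - ln (1 - (r c)\<^sup>2))"
    by (rule Lim_transform_eventually) (use ev in eventually_elim, simp)
  have "logloss = (\<lambda>n. (\<Sum>i\<in>{i. i < n \<and> special n i}. - ln (1 - (s n i)\<^sup>2))
      + (\<Sum>i\<in>{i. i < n \<and> \<not> special n i}. - ln (1 - (s n i)\<^sup>2)))"
    unfolding logloss_def by (intro ext, subst sum.union_disjoint[symmetric]) (auto intro!: sum.cong)
  then show ?thesis using tendsto_add[OF sp nonspecial_logloss_lim] by simp
qed

text \<open>The floor is the number of the cell containing t, counted from the right; a grid point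
  belongs to the cell on its left.\<close>

definition "step n t = z (\<sigma> n (nat \<lfloor>(b - t) / h n\<rfloor>))"

lemma step_eq:
  assumes "b - real (Suc i) * h n < t" "t \<le> b - real i * h n"
  shows "step n t = z (\<sigma> n i)"
proof -
  have "real i \<le> (b - t) / h n" "(b - t) / h n < real i + 1"
    using assms h_pos[of n] by (simp_all add: field_simps)
  then have "\<lfloor>(b - t) / h n\<rfloor> = int i" by (simp add: floor_unique)
  then show ?thesis by (simp add: step_def)
qed

lemma step_index:
  assumes "a < t" "t < b"
  obtains i where "i \<le> n" "b - real (Suc i) * h n < t" "t \<le> b - real i * h n"
proof -
  define i where "i = nat \<lfloor>(b - t) / h n\<rfloor>"
  have quot: "(b - t) / h n \<ge> 0" using assms h_pos[of n] by simp
  have i: "real i \<le> (b - t) / h n" "(b - t) / h n < real i + 1" using quot by (auto simp: i_def)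
  have "(b - t) / h n < (b - a) / h n" using assms h_pos[of n] by (intro divide_strict_right_mono) auto
  also have "\<dots> = real (Suc n)" using Suc_n_h[of n] h_pos[of n] by (simp add: field_simps)
  finally have "i \<le> n" using i by simp
  moreover have "b - real (Suc i) * h n < t" "t \<le> b - real i * h n"
    using i h_pos[of n] by (simp_all add: field_simps)
  ultimately show ?thesis by (rule that)
qed

definition "grid n = (\<lambda>i. b - real i * h n) ` {..Suc n}"

text \<open>The bounds m and M are those of z for every n, which provides the common Lipschitz
  constant needed in \<open>terminal_solution_converges\<close>.\<close>

lemma impedance_step: "impedance a b m M (z (\<sigma> n n)) (z (\<sigma> n 0)) (step n) (grid n)"
proof
  show "finite (grid n)" by (simp add: grid_def)
  show "m \<le> step n x \<and> step n x \<le> M" if "a < x" "x < b" for x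
  proof -
    obtain i where "i \<le> n" "b - real (Suc i) * h n < x" "x \<le> b - real i * h n"
      using step_index[OF \<open>a < x\<close> \<open>x < b\<close>] .
    then show ?thesis using step_eq z\<sigma> by auto
  qed
  show "isCont (step n) x" if "a < x" "x < b" "x \<notin> grid n" for x
  proof -
    obtain i where i: "i \<le> n" "b - real (Suc i) * h n < x" "x \<le> b - real i * h n"
      using step_index[OF \<open>a < x\<close> \<open>x < b\<close>] .
    have "x \<noteq> b - real i * h n" using that(3) i(1) by (auto simp: grid_def)
    then have "x \<in> {b - real (Suc i) * h n<..<b - real i * h n}" using i by auto
    then have "eventually (\<lambda>t. t \<in> {b - real (Suc i) * h n<..<b - real i * h n}) (nhds x)"
      by (intro eventually_nhds_in_open) auto
    then have "eventually (\<lambda>t. step n t = z (\<sigma> n i)) (nhds x)"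
      by eventually_elim (rule step_eq, auto)
    then show ?thesis by (simp add: isCont_cong)
  qed
  have "eventually (\<lambda>t. t \<in> {a<..<a + h n}) (at_right a)" using h_pos[of n] by (intro eventually_at_right_real) simp
  then have "eventually (\<lambda>t. z (\<sigma> n n) = step n t) (at_right a)"
  proof eventually_elim
    case (elim t)
    show ?case by (rule step_eq[symmetric]) (use elim Suc_n_h[of n] in \<open>auto simp: algebra_simps\<close>)
  qed
  then show "(step n \<longlongrightarrow> z (\<sigma> n n)) (at_right a)" by (rule Lim_transform_eventually[OF tendsto_const])
  have "eventually (\<lambda>t. t \<in> {b - h n<..<b}) (at_left b)" using h_pos[of n] by (intro eventually_at_left_real) simp
  then have "eventually (\<lambda>t. z (\<sigma> n 0) = step n t) (at_left b)"
  proof eventually_elim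
    case (elim t)
    show ?case by (rule step_eq[symmetric]) (use elim in auto)
  qed
  then show "(step n \<longlongrightarrow> z (\<sigma> n 0)) (at_left b)" by (rule Lim_transform_eventually[OF tendsto_const])
qed (use ab m in auto)

lemma step_lim:
  assumes "a < t" "t < b" "t \<notin> Q"
  shows "(\<lambda>n. step n t) \<longlonglongrightarrow> z t"
proof -
  define i where "i n = (SOME i. i \<le> n \<and> b - real (Suc i) * h n < t \<and> t \<le> b - real i * h n)" for n
  have i: "i n \<le> n \<and> b - real (Suc (i n)) * h n < t \<and> t \<le> b - real (i n) * h n" for n
    unfolding i_def by (rule someI_ex) (use step_index[OF assms(1,2)] in blast)
  have "(\<lambda>n. \<sigma> n (i n) - t) \<longlonglongrightarrow> 0"
  proof (rule Lim_null_comparison[OF _ h_lim], intro always_eventually allI)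
    fix n show "norm (\<sigma> n (i n) - t) \<le> h n"
      using i[of n] \<sigma>_bounds[of "i n" n] by (auto simp: abs_le_iff algebra_simps)
  qed
  then have "(\<lambda>n. \<sigma> n (i n)) \<longlonglongrightarrow> t" by (rule LIM_zero_cancel)
  from isCont_tendsto_compose[OF cont[OF assms] this]
  have "(\<lambda>n. z (\<sigma> n (i n))) \<longlonglongrightarrow> z t" .
  moreover have "step n t = z (\<sigma> n (i n))" for n using i[of n] by (intro step_eq) auto
  ultimately show ?thesis by simp
qed

lemma z_ends_lim: "(\<lambda>n. z (\<sigma> n n)) \<longlonglongrightarrow> za" "(\<lambda>n. z (\<sigma> n 0)) \<longlonglongrightarrow> zb"
proof -
  have *: "a < \<sigma> n n \<and> \<sigma> n n < a + h n" "b - h n < \<sigma> n 0 \<and> \<sigma> n 0 < b" for n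
    using \<sigma>_in[of n n] \<sigma>_bounds[of n n] \<sigma>_in[of 0 n] \<sigma>_bounds[of 0 n] Suc_n_h[of n] by (auto simp: algebra_simps)
  have "(\<lambda>n. \<sigma> n n - a) \<longlonglongrightarrow> 0"
    by (rule Lim_null_comparison[OF _ h_lim], intro always_eventually allI) (use *(1) in \<open>auto simp: abs_le_iff less_imp_le algebra_simps\<close>)
  then have "(\<lambda>n. \<sigma> n n) \<longlonglongrightarrow> a" by (rule LIM_zero_cancel)
  then have "filterlim (\<lambda>n. \<sigma> n n) (at_right a) sequentially"
    unfolding filterlim_at using *(1) by (auto intro!: always_eventually)
  from filterlim_compose[OF lima this] show "(\<lambda>n. z (\<sigma> n n)) \<longlonglongrightarrow> za" .
  have "(\<lambda>n. \<sigma> n 0 - b) \<longlonglongrightarrow> 0"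
    by (rule Lim_null_comparison[OF _ h_lim], intro always_eventually allI) (use *(2) in \<open>auto simp: abs_le_iff less_imp_le algebra_simps\<close>)
  then have "(\<lambda>n. \<sigma> n 0) \<longlonglongrightarrow> b" by (rule LIM_zero_cancel)
  then have "filterlim (\<lambda>n. \<sigma> n 0) (at_left b) sequentially"
    unfolding filterlim_at using *(2) by (auto intro!: always_eventually)
  from filterlim_compose[OF limb this] show "(\<lambda>n. z (\<sigma> n 0)) \<longlonglongrightarrow> zb" .
qed

text \<open>Coefficients converge off Q and terminal data converge because the last sample tends to
  b; hence the states at a converge. The limiting incident wave is nonzero by the flux identity, so
  the quotients converge too.\<close>

lemma layer_refl_lim:
  assumes \<omega>: "\<omega> \<noteq> 0"
  shows "(\<lambda>n. layer_refl (s n) (h n) n (of_real \<omega>)) \<longlonglongrightarrow> gen_reflection_coeff a b z \<omega> 0"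
    and "cmod (gen_reflection_coeff a b z \<omega> 0) < 1"
proof -
  interpret st: impedance a b m M "z (\<sigma> n n)" "z (\<sigma> n 0)" "step n" "grid n" for n
    by (rule impedance_step)
  let ?K = "1 / m + \<omega>\<^sup>2 * M"
  obtain Y where Y: "terminal_solution a b (A \<omega>) (outgoing \<omega>) Y"
    using linear_ode.terminal_solution_exists[OF linear_ode_wave_op] by blast
  have "\<exists>Y. terminal_solution a b (wave_op a b (step n) \<omega>) (st.outgoing n \<omega>) Y" for n
    using linear_ode.terminal_solution_exists[OF st.linear_ode_wave_op] by blast
  then obtain Yn where Yn: "\<And>n. terminal_solution a b (wave_op a b (step n) \<omega>) (st.outgoing n \<omega>) (Yn n)"
    by metis
  have Ylim: "(\<lambda>n. Yn n a) \<longlonglongrightarrow> Y a"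
  proof (rule terminal_solution_converges[OF linear_ode_wave_op st.linear_ode_wave_op Y Yn negligible_finite[OF Q]])
    fix t y assume t: "t \<in> {a..b} - Q"
    show "(\<lambda>n. wave_op a b (step n) \<omega> t y) \<longlonglongrightarrow> A \<omega> t y"
    proof (cases "a < t \<and> t < b")
      case True
      then have "z t \<noteq> 0" using bounds[of t] m by auto
      then show ?thesis using True t unfolding wave_op_def
        by (auto intro!: tendsto_intros step_lim)
    next
      case False
      then show ?thesis by (auto simp: wave_op_def)
    qed
  next
    show "(\<lambda>n. st.outgoing n \<omega>) \<longlonglongrightarrow> outgoing \<omega>"
      unfolding st.outgoing_def outgoing_def by (intro tendsto_intros z_ends_lim)
  qed (use ab in auto)
  have L: "layer_refl (s n) (h n) n (of_real \<omega>) = bwd \<omega> (z (\<sigma> n n)) (Yn n a) / fwd \<omega> (z (\<sigma> n n)) (Yn n a)" for n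
  proof -
    have eq: "b - real (Suc n) * h n = a" using Suc_n_h[of n] by simp
    let ?R = "layer_refl (\<lambda>i. (z (\<sigma> n (Suc i)) - z (\<sigma> n i)) / (z (\<sigma> n (Suc i)) + z (\<sigma> n i))) (h n) n (of_real \<omega>)"
    have "fwd \<omega> (z (\<sigma> n n)) (Yn n (b - real (Suc n) * h n)) \<noteq> 0 \<and>
      bwd \<omega> (z (\<sigma> n n)) (Yn n (b - real (Suc n) * h n)) =
        ?R
          * fwd \<omega> (z (\<sigma> n n)) (Yn n (b - real (Suc n) * h n)) \<and>
      cmod (?R) \<le> 1"
    \<comment> \<open>There are n + 1 layers but n interfaces: layer n is the leftmost one, and its
      left end is a.\<close>
    proof (rule st.layered_reflection[OF \<omega> Yn, where zs = "\<lambda>i. z (\<sigma> n i)" and n = "Suc n"])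
      show "b - a = real (Suc n) * h n" by (rule Suc_n_h[symmetric])
      fix i assume i: "i < Suc n"
      show "z (\<sigma> n i) > 0" using z\<sigma>(1)[of i n] i m by simp
      show "step n x = z (\<sigma> n i)" if "b - real (Suc i) * h n < x" "x < b - real i * h n" for x
        using that by (intro step_eq) auto
      show "grid n \<inter> {b - real (Suc i) * h n<..<b - real i * h n} = {}"
      proof -
        have False if "real j * h n < real (Suc i) * h n" "real i * h n < real j * h n" for j
        proof -
          have "real j < real (Suc i)" "real i < real j"
            using that h_pos[of n] by (simp_all only: mult_less_cancel_right_pos)
          then show False unfolding of_nat_less_iff by simp
        qed
        then show ?thesis unfolding grid_def by fastforce
      qed
    qed (use h_pos in auto)
    then show ?thesis unfolding eq s_def[abs_def] by simp
  qed
  note refl = outgoing_solution_reflection[OF \<omega> Y]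
  have "(\<lambda>n. bwd \<omega> (z (\<sigma> n n)) (Yn n a) / fwd \<omega> (z (\<sigma> n n)) (Yn n a)) \<longlonglongrightarrow> bwd \<omega> za (Y a) / fwd \<omega> za (Y a)"
  proof (intro tendsto_divide)
    show "(\<lambda>n. bwd \<omega> (z (\<sigma> n n)) (Yn n a)) \<longlonglongrightarrow> bwd \<omega> za (Y a)"
      unfolding bwd_def using za m \<omega> by (intro tendsto_intros z_ends_lim Ylim) auto
    show "(\<lambda>n. fwd \<omega> (z (\<sigma> n n)) (Yn n a)) \<longlonglongrightarrow> fwd \<omega> za (Y a)"
      unfolding fwd_def using za m \<omega> by (intro tendsto_intros z_ends_lim Ylim) auto
  qed (rule refl)
  then show "(\<lambda>n. layer_refl (s n) (h n) n (of_real \<omega>)) \<longlonglongrightarrow> gen_reflection_coeff a b z \<omega> 0"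
    unfolding L gen_reflection_coeff_eq[OF \<omega> Y] .
  show "cmod (gen_reflection_coeff a b z \<omega> 0) < 1"
    unfolding gen_reflection_coeff_eq[OF \<omega> Y] by (rule refl)
qed

section \<open>Mean value of the loss\<close>

definition "loss \<omega> = - ln (1 - (cmod (gen_reflection_coeff a b z \<omega> 0))\<^sup>2)"
definition "loss_n n \<omega> = logloss n + 2 * Re (layer_log (s n) (h n) n (of_real \<omega>))"

lemma loss_n_lim: assumes "\<omega> \<noteq> 0" shows "(\<lambda>n. loss_n n \<omega>) \<longlonglongrightarrow> loss \<omega>"
proof -
  have "loss_n n \<omega> = - ln (1 - (cmod (layer_refl (s n) (h n) n (of_real \<omega>)))\<^sup>2)" for n
    using minus_ln_layer_refl[of n "s n" \<rho> "h n" n \<omega>] s_le \<rho> h_pos[of n]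
    by (simp add: loss_n_def logloss_def)
  moreover have "(cmod (gen_reflection_coeff a b z \<omega> 0))\<^sup>2 < 1"
    using layer_refl_lim(2)[OF assms] by (simp add: abs_square_less_1)
  ultimately show ?thesis unfolding loss_def
    by (simp del: ln_inverse) (intro tendsto_intros layer_refl_lim assms; simp)
qed

text \<open>The contour estimate, doubled because the loss contains twice the real part, gives 4
  \<eta> C + 4 L \<epsilon> for all fine grids. Here \<eta> and C do not depend on L, so letting n
  tend to infinity at fixed L preserves the bound.\<close>

lemma loss_mean_bound:
  assumes \<epsilon>: "\<epsilon> > 0"
  obtains B where "\<And>L. L > 0 \<Longrightarrow>
    \<bar>(LINT \<omega>:{-L..L}|lborel. loss \<omega>) - 2 * L * (\<Sum>c\<in>Q. - ln (1 - (r c)\<^sup>2))\<bar> \<le> B + 4 * L * \<epsilon>"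
proof -
  let ?S = "\<Sum>c\<in>Q. - ln (1 - (r c)\<^sup>2)"
  let ?g = "\<lambda>n \<omega>. Re (layer_log (s n) (h n) n (of_real \<omega>))"
  obtain V where V: "\<And>n. (\<Sum>i<n. \<bar>s n i\<bar>) \<le> V" using sum_s_bounded by blast
  define C where "C = V / (1 - \<rho>)"
  have C: "(\<Sum>i<n. \<bar>s n i\<bar>) / (1 - \<rho>) \<le> C" for n
    unfolding C_def using V \<rho> by (intro divide_right_mono) auto
  \<comment> \<open>Chosen to cancel the factor \<open>2 / (1 - \<rho>)\<^sup>2\<close> of
    \<open>norm_layer_log_le_pairs\<close>.\<close>
  have "\<epsilon> * (1 - \<rho>)\<^sup>2 / 2 > 0" using \<epsilon> \<rho> by simp
  from pair_sum_small[OF this] obtain \<eta> where \<eta>: "\<eta> > 0" and ev: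
    "eventually (\<lambda>n. (\<Sum>i<n. \<Sum>j<i. \<bar>s n i\<bar> * \<bar>s n j\<bar> * exp (- (2 * \<eta> * h n * real (i - j))))
      \<le> \<epsilon> * (1 - \<rho>)\<^sup>2 / 2) sequentially" by blast
  have hn: "0 \<le> h n" for n using h_pos[of n] by simp
  have gC: "\<bar>?g n \<omega>\<bar> \<le> C" for n \<omega>
    using norm_layer_log_le[of n "s n" \<rho> "h n" "of_real \<omega>"] s_le \<rho> hn[of n] C[of n]
      abs_Re_le_cmod[of "layer_log (s n) (h n) n (of_real \<omega>)"] by force
  have gcont: "continuous_on UNIV (?g n)" for n
    using norm_layer_log_le[of n "s n" \<rho> "h n"] s_le \<rho> hn[of n]
    by (intro integral_Re_layer_log_le(1)[of n "s n" \<rho> "h n" 1 1 "(\<Sum>i<n. \<bar>s n i\<bar>) / (1 - \<rho>)"]) auto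
  have loss_n_cont: "continuous_on UNIV (loss_n n)" for n
    unfolding loss_n_def[abs_def] by (intro continuous_intros gcont)
  have loss_n_int: "(LINT \<omega>:{-L..L}|lborel. loss_n n \<omega>) = 2 * L * logloss n + 2 * integral {-L..L} (?g n)"
    if "L > 0" for n L
  proof -
    have "set_integrable lborel {-L..L} (loss_n n)"
      by (rule borel_integrable_atLeastAtMost') (rule continuous_on_subset[OF loss_n_cont], simp)
    then have "(LINT \<omega>:{-L..L}|lborel. loss_n n \<omega>) = integral {-L..L} (loss_n n)"
      by (rule set_borel_integral_eq_integral(2))
    also have "\<dots> = integral {-L..L} (\<lambda>_. logloss n) + integral {-L..L} (\<lambda>\<omega>. 2 * ?g n \<omega>)"
      unfolding loss_n_def[abs_def]
      by (intro integral_add integrable_continuous_real continuous_intros continuous_on_subset[OF gcont]) auto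
    finally show ?thesis using that by simp
  qed
  have n_bound: "eventually (\<lambda>n. \<forall>L>0. \<bar>(LINT \<omega>:{-L..L}|lborel. loss_n n \<omega>) - 2 * L * logloss n\<bar>
      \<le> 4 * \<eta> * C + 4 * L * \<epsilon>) sequentially"
    using ev
  proof (eventually_elim, intro allI impI)
    fix n :: nat and L :: real
    assume pair: "(\<Sum>i<n. \<Sum>j<i. \<bar>s n i\<bar> * \<bar>s n j\<bar> * exp (- (2 * \<eta> * h n * real (i - j)))) \<le> \<epsilon> * (1 - \<rho>)\<^sup>2 / 2"
      and L: "L > 0"
    have "\<bar>integral {-L..L} (?g n)\<bar> \<le> 2 * \<eta> * ((\<Sum>i<n. \<bar>s n i\<bar>) / (1 - \<rho>)) + 2 * L * \<epsilon>"
    proof (rule integral_Re_layer_log_le(2)[OF _ _ _ \<eta> L])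
      fix w :: complex assume w: "Im w = \<eta>"
      have "cmod (layer_log (s n) (h n) n w) \<le> 2 / (1 - \<rho>)\<^sup>2 *
          (\<Sum>i<n. \<Sum>j<i. \<bar>s n i\<bar> * \<bar>s n j\<bar> * exp (- (2 * Im w * h n * real (i - j))))"
        by (rule norm_layer_log_le_pairs) (use s_le \<rho> hn w \<eta> in auto)
      also have "\<dots> \<le> 2 / (1 - \<rho>)\<^sup>2 * (\<epsilon> * (1 - \<rho>)\<^sup>2 / 2)"
        unfolding w using pair by (intro mult_left_mono) auto
      also have "\<dots> = \<epsilon>" using \<rho> by simp
      finally show "cmod (layer_log (s n) (h n) n w) \<le> \<epsilon>" .
    qed (use s_le \<rho> hn in auto)
    also have "\<dots> \<le> 2 * \<eta> * C + 2 * L * \<epsilon>" using C[of n] \<eta> by (intro add_right_mono mult_left_mono) auto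
    finally show "\<bar>(LINT \<omega>:{-L..L}|lborel. loss_n n \<omega>) - 2 * L * logloss n\<bar> \<le> 4 * \<eta> * C + 4 * L * \<epsilon>"
      using loss_n_int[OF L, of n] by simp
  qed
  obtain T where T: "\<And>n. norm (logloss n) \<le> T"
    using convergent_imp_Bseq[OF convergentI[OF logloss_lim]] by (auto simp: Bseq_def)
  have conv: "(\<lambda>n. LINT \<omega>:{-L..L}|lborel. loss_n n \<omega>) \<longlonglongrightarrow> (LINT \<omega>:{-L..L}|lborel. loss \<omega>)" for L
    unfolding set_lebesgue_integral_def
  proof (rule integral_dominated_convergence[where w = "\<lambda>\<omega>. indicator {-L..L} \<omega> *\<^sub>R (T + 2 * C)"])
    have ms: "loss_n n \<in> borel_measurable borel" for n
      by (rule borel_measurable_continuous_onI[OF loss_n_cont])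
    \<comment> \<open>Convergence is available only for nonzero \<omega>. Measurability is obtained
      with the value at 0 replaced, and the original value is then restored at that single
      point.\<close>
    have "(\<lambda>\<omega>. if \<omega> = 0 then 0 else loss \<omega>) \<in> borel_measurable borel"
    proof (rule borel_measurable_LIMSEQ_real)
      show "(\<lambda>n. if \<omega> = 0 then 0 else loss_n n \<omega>) \<longlonglongrightarrow> (if \<omega> = 0 then 0 else loss \<omega>)" for \<omega>
        using loss_n_lim[of \<omega>] by simp
      show "(\<lambda>\<omega>. if \<omega> = 0 then 0 else loss_n n \<omega>) \<in> borel_measurable borel" for n
        using ms[of n] by measurable
    qed
    then have "(\<lambda>\<omega>. if \<omega> = 0 then loss 0 else (if \<omega> = 0 then 0 else loss \<omega>)) \<in> borel_measurable borel"
      by measurable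
    moreover have "(\<lambda>\<omega>. if \<omega> = 0 then loss 0 else (if \<omega> = 0 then 0 else loss \<omega>)) = loss" by auto
    ultimately have ml: "loss \<in> borel_measurable borel" by simp
    show "(\<lambda>\<omega>. indicat_real {-L..L} \<omega> *\<^sub>R loss \<omega>) \<in> borel_measurable lborel" using ml by measurable
    show "(\<lambda>\<omega>. indicat_real {-L..L} \<omega> *\<^sub>R loss_n n \<omega>) \<in> borel_measurable lborel" for n using ms[of n] by measurable
    show "integrable lborel (\<lambda>\<omega>. indicat_real {-L..L} \<omega> *\<^sub>R (T + 2 * C))"
      by (intro integrable_scaleR_left integrable_real_indicator) (auto simp: emeasure_lborel_Icc_eq)
    have "AE \<omega> in lborel. \<omega> \<noteq> (0::real)" by (rule AE_lborel_singleton)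
    then show "AE \<omega> in lborel. (\<lambda>n. indicat_real {-L..L} \<omega> *\<^sub>R loss_n n \<omega>) \<longlonglongrightarrow> indicat_real {-L..L} \<omega> *\<^sub>R loss \<omega>"
      by eventually_elim (intro tendsto_intros loss_n_lim)
    show "AE \<omega> in lborel. norm (indicat_real {-L..L} \<omega> *\<^sub>R loss_n n \<omega>) \<le> indicat_real {-L..L} \<omega> *\<^sub>R (T + 2 * C)" for n
    proof (rule AE_I2)
      fix \<omega> :: real
      have "\<bar>loss_n n \<omega>\<bar> \<le> T + 2 * C" using T[of n] gC[of n \<omega>] by (auto simp: loss_n_def abs_if split: if_splits)
      then show "norm (indicat_real {-L..L} \<omega> *\<^sub>R loss_n n \<omega>) \<le> indicat_real {-L..L} \<omega> *\<^sub>R (T + 2 * C)"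
        by (auto simp: indicator_def)
    qed
  qed
  show ?thesis
  proof (rule that[of "4 * \<eta> * C"])
    fix L :: real assume L: "L > 0"
    have lim: "(\<lambda>n. \<bar>(LINT \<omega>:{-L..L}|lborel. loss_n n \<omega>) - 2 * L * logloss n\<bar>)
        \<longlonglongrightarrow> \<bar>(LINT \<omega>:{-L..L}|lborel. loss \<omega>) - 2 * L * ?S\<bar>"
      by (intro tendsto_intros conv logloss_lim)
    show "\<bar>(LINT \<omega>:{-L..L}|lborel. loss \<omega>) - 2 * L * ?S\<bar> \<le> 4 * \<eta> * C + 4 * L * \<epsilon>"
      by (rule tendsto_upperbound[OF lim]) (use n_bound L in \<open>auto elim: eventually_mono\<close>)
  qed
qed

lemma loss_mean_limit:
  "((\<lambda>L. 1 / (2 * L) * (LINT \<omega>:{-L..L}|lborel. - ln (1 - (cmod (gen_reflection_coeff a b z \<omega> 0))\<^sup>2)))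
     \<longlongrightarrow> (\<Sum>c\<in>Q. - ln (1 - (r c)\<^sup>2))) at_top"
proof (rule tendstoI)
  let ?S = "\<Sum>c\<in>Q. - ln (1 - (r c)\<^sup>2)"
  fix e :: real assume e: "e > 0"
  then have "e / 8 > 0" by simp
  then obtain B where B: "\<And>L. L > 0 \<Longrightarrow>
    \<bar>(LINT \<omega>:{-L..L}|lborel. loss \<omega>) - 2 * L * ?S\<bar> \<le> B + 4 * L * (e / 8)"
    using loss_mean_bound by blast
  \<comment> \<open>Makes B < L e; together with 4 L (e / 8) = L e / 2 the error stays below 2 L e
    before division by 2 L.\<close>
  have "eventually (\<lambda>L. L > max 0 (B / e)) at_top" by (rule eventually_gt_at_top)
  then show "eventually (\<lambda>L. dist (1 / (2 * L) * (LINT \<omega>:{-L..L}|lborel.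
      - ln (1 - (cmod (gen_reflection_coeff a b z \<omega> 0))\<^sup>2))) ?S < e) at_top"
  proof eventually_elim
    case (elim L)
    define I where "I = (LINT \<omega>:{-L..L}|lborel. loss \<omega>)"
    have L: "L > 0" "B < L * e" using elim e by (simp_all add: pos_divide_less_eq)
    have "\<bar>I - 2 * L * ?S\<bar> < 2 * L * e"
    proof -
      have "\<bar>I - 2 * L * ?S\<bar> \<le> B + 4 * L * (e / 8)" unfolding I_def by (rule B[OF L(1)])
      also have "\<dots> < L * e + 4 * L * (e / 8)" using L(2) by simp
      also have "\<dots> \<le> 2 * L * e" using L(1) e by (simp add: algebra_simps)
      finally show ?thesis .
    qed
    moreover have "1 / (2 * L) * I - ?S = (I - 2 * L * ?S) / (2 * L)" using L by (simp add: field_simps)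
    ultimately have "\<bar>1 / (2 * L) * I - ?S\<bar> < e"
      using L by (simp only: abs_divide) (simp add: pos_divide_less_eq mult_ac)
    then show ?case by (simp add: dist_real_def I_def loss_def)
  qed
qed

end

section \<open>Piecewise absolutely continuous impedances\<close>

lemma partition_intervals_refine:
  fixes a b :: real
  assumes ab: "a < b" and P: "finite P" "P \<subseteq> Q" "Q \<subseteq> {a<..<b}"
    and I: "I \<in> partition_intervals a b Q"
  obtains J where "J \<in> partition_intervals a b P" "I \<subseteq> J"
proof -
  obtain l r where lr: "I = {l<..<r}" "l \<in> insert a (insert b Q)" "r \<in> insert a (insert b Q)"
    "l < r" "{l<..<r} \<inter> Q = {}"
    using I by (auto simp: partition_intervals_def)
  have al: "a \<le> l" using lr(2) ab P(3) by auto
  have rb: "r \<le> b" using lr(3) ab P(3) by auto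
  let ?S = "{q \<in> insert a P. q \<le> l}"
  let ?T = "{q \<in> insert b P. r \<le> q}"
  have f: "finite ?S" "a \<in> ?S" "finite ?T" "b \<in> ?T" using P al rb by auto
  define u where "u = Max ?S"
  define v where "v = Min ?T"
  have u: "u \<in> ?S" unfolding u_def using f by (intro Max_in) auto
  have v: "v \<in> ?T" unfolding v_def using f by (intro Min_in) auto
  have max: "q \<le> u" if "q \<in> ?S" for q unfolding u_def using f that by (intro Max_ge)
  have min: "v \<le> q" if "q \<in> ?T" for q unfolding v_def using f that by (intro Min_le)
  have "q \<notin> {u<..<v}" if "q \<in> P" for q
  proof
    assume q: "q \<in> {u<..<v}"
    have "q \<notin> {l<..<r}" using lr(5) that P(2) by blast
    then have "q \<le> l \<or> r \<le> q" by auto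
    then show False using max[of q] min[of q] q that by auto
  qed
  then have "{u<..<v} \<inter> P = {}" by blast
  moreover have "u < v" using u v lr by auto
  ultimately have "{u<..<v} \<in> partition_intervals a b P"
    unfolding partition_intervals_def using u v by blast
  moreover have "I \<subseteq> {u<..<v}" using u v lr by auto
  ultimately show ?thesis by (rule that)
qed

lemma partition_intervals_open_interval:
  assumes "I \<in> partition_intervals a b P"
  shows "open I" "is_interval I" "bounded I"
  using assms by (auto simp: partition_intervals_def is_interval_oo)

lemma abs_cont_on_Ioo_limits:
  fixes f :: "real \<Rightarrow> real"
  assumes "abs_cont_on {u<..<v} f" "u < v"
  obtains l r where "(f \<longlongrightarrow> l) (at_right u)" "(f \<longlongrightarrow> r) (at_left v)"
proof -
  have cl: "closure {u<..<v} = {u..v}" using assms by simp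
  have "uniformly_continuous_on {u<..<v} f"
    using assms by (intro abs_cont_on_uniformly_continuous) (simp_all add: is_interval_oo)
  then obtain g where g: "uniformly_continuous_on {u..v} g" "\<And>x. x \<in> {u<..<v} \<Longrightarrow> f x = g x"
    using uniformly_continuous_on_extension_on_closure[of "{u<..<v}" f] unfolding cl by metis
  have c: "continuous_on {u..v} g" using g(1) by (rule uniformly_continuous_imp_continuous)
  have "(g \<longlongrightarrow> g u) (at_right u)" using c assms(2) by (rule continuous_on_Icc_at_rightD)
  then have 1: "(f \<longlongrightarrow> g u) (at_right u)"
    by (rule Lim_transform_eventually)
      (use eventually_at_right_real[OF assms(2)] in eventually_elim, simp add: g(2))
  have "(g \<longlongrightarrow> g v) (at_left v)" using c assms(2) by (rule continuous_on_Icc_at_leftD)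
  then have 2: "(f \<longlongrightarrow> g v) (at_left v)"
    by (rule Lim_transform_eventually)
      (use eventually_at_left_real[OF assms(2)] in eventually_elim, simp add: g(2))
  from 1 2 show ?thesis by (rule that)
qed

lemma AE_eq_frequently:
  fixes f g :: "real \<Rightarrow> 'b"
  assumes ae: "AE x in lborel. x \<in> {a<..<b} \<longrightarrow> f x = g x" and uv: "u < v" "{u<..<v} \<subseteq> {a<..<b}"
  obtains x where "x \<in> {u<..<v}" "f x = g x"
proof -
  obtain N where N: "negligible N" "\<And>x. x \<notin> N \<Longrightarrow> x \<in> {a<..<b} \<longrightarrow> f x = g x"
    using negligible_of_AE_lborel[OF ae] by blast
  have "\<not> {u<..<v} \<subseteq> N"
    using negligible_subset[OF N(1)] open_not_negligible[of "{u<..<v}"] uv(1) by auto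
  then show ?thesis using that N(2) uv(2) by blast
qed

text \<open>The factorisation of \<zeta> is given only almost everywhere. One-sided limits do not
  see null sets, because every one-sided neighbourhood contains a point where both functions
  agree.\<close>

lemma AE_eq_limits_eq:
  fixes f g :: "real \<Rightarrow> real"
  assumes ae: "AE x in lborel. x \<in> {a<..<b} \<longrightarrow> f x = g x" and c: "a < c" "c < b"
  shows "(f \<longlongrightarrow> l) (at_left c) \<Longrightarrow> (g \<longlongrightarrow> l') (at_left c) \<Longrightarrow> l = l'"
    and "(f \<longlongrightarrow> l) (at_right c) \<Longrightarrow> (g \<longlongrightarrow> l') (at_right c) \<Longrightarrow> l = l'"
proof -
  show "l = l'" if "(f \<longlongrightarrow> l) (at_left c)" "(g \<longlongrightarrow> l') (at_left c)"
  proof (rule ccontr)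
    assume "l \<noteq> l'"
    have "((\<lambda>x. f x - g x) \<longlongrightarrow> l - l') (at_left c)" by (intro tendsto_intros that)
    then have "eventually (\<lambda>x. f x - g x \<noteq> 0) (at_left c)"
      using \<open>l \<noteq> l'\<close> by (intro tendsto_imp_eventually_ne) auto
    then obtain d where d: "d < c" "\<And>x. d < x \<Longrightarrow> x < c \<Longrightarrow> f x \<noteq> g x"
      unfolding eventually_at_left_field by auto
    obtain x where "x \<in> {max a d<..<c}" "f x = g x"
      by (rule AE_eq_frequently[OF ae, of "max a d" c]) (use c d in auto)
    then show False using d by auto
  qed
  show "l = l'" if "(f \<longlongrightarrow> l) (at_right c)" "(g \<longlongrightarrow> l') (at_right c)"
  proof (rule ccontr)
    assume "l \<noteq> l'"
    have "((\<lambda>x. f x - g x) \<longlongrightarrow> l - l') (at_right c)" by (intro tendsto_intros that)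
    then have "eventually (\<lambda>x. f x - g x \<noteq> 0) (at_right c)"
      using \<open>l \<noteq> l'\<close> by (intro tendsto_imp_eventually_ne) auto
    then obtain d where d: "d > c" "\<And>x. c < x \<Longrightarrow> x < d \<Longrightarrow> f x \<noteq> g x"
      unfolding eventually_at_right_field by auto
    obtain x where "x \<in> {c<..<min b d}" "f x = g x"
      by (rule AE_eq_frequently[OF ae, of c "min b d"]) (use c d in auto)
    then show False using d by auto
  qed
qed

text \<open>Uniform continuity on each bounded open piece supplies the upper bound and all one-sided
  limits. A sample point exists in each cell because an open interval is not contained in the finite
  set Q.\<close>

lemma Cpw_sampled_impedance:
  assumes ab: "a < b" and Q: "finite Q" "Q \<subseteq> {a<..<b}"
    and m: "m > 0" "\<And>x. x \<in> {a<..<b} \<Longrightarrow> m \<le> z x"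
    and ac: "\<And>I. I \<in> partition_intervals a b Q \<Longrightarrow> abs_cont_on I z"
  obtains M za zb zl zr \<sigma> where "sampled_impedance a b m M za zb z Q zl zr \<sigma>"
proof -
  note bb = partition_intervals_open_interval
  have uc: "uniformly_continuous_on I z" if "I \<in> partition_intervals a b Q" for I
    using ac that bb(2) by (intro abs_cont_on_uniformly_continuous)
  have cover: "\<exists>I\<in>partition_intervals a b Q. x \<in> I" if "x \<in> {a<..<b}" "x \<notin> Q" for x
    using partition_interval_containing[OF Q(1), of a x x b] that by auto
  have "bounded (z ` {a<..<b})"
  proof (rule bounded_subset)
    show "bounded ((\<Union>I\<in>partition_intervals a b Q. z ` I) \<union> z ` Q)"
      using finite_partition_intervals[OF Q(1)] Q(1) uc bb(3)
      by (simp add: bounded_UN bounded_uniformly_continuous_image finite_imp_bounded)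
    show "z ` {a<..<b} \<subseteq> (\<Union>I\<in>partition_intervals a b Q. z ` I) \<union> z ` Q" using cover by blast
  qed
  then obtain M where M: "\<And>x. x \<in> {a<..<b} \<Longrightarrow> \<bar>z x\<bar> \<le> M"
    unfolding bounded_iff by (auto simp del: greaterThanLessThan_iff)
  have left: "\<exists>l. (z \<longlongrightarrow> l) (at_left c)" if cQ: "c \<in> insert b Q" for c
  proof -
    obtain u where "u < c" "{u<..<c} \<in> partition_intervals a b Q"
      using partition_interval_left[OF Q cQ ab] by blast
    then show ?thesis using abs_cont_on_Ioo_limits[OF ac] by blast
  qed
  have right: "\<exists>l. (z \<longlongrightarrow> l) (at_right c)" if cQ: "c \<in> insert a Q" for c
  proof -
    obtain v where "c < v" "{c<..<v} \<in> partition_intervals a b Q"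
      using partition_interval_right[OF Q cQ ab] by blast
    then show ?thesis using abs_cont_on_Ioo_limits[OF ac] by blast
  qed
  obtain zl where zl: "\<And>c. c \<in> insert b Q \<Longrightarrow> (z \<longlongrightarrow> zl c) (at_left c)" using left by metis
  obtain zr where zr: "\<And>c. c \<in> insert a Q \<Longrightarrow> (z \<longlongrightarrow> zr c) (at_right c)" using right by metis
  define B where "B n i x \<longleftrightarrow> b - real (Suc i) * ((b - a) / real (Suc n)) < x \<and>
      x < b - real i * ((b - a) / real (Suc n)) \<and> x \<notin> Q" for n i x
  have "\<exists>x. B n i x" for n i
  proof -
    let ?l = "b - real (Suc i) * ((b - a) / real (Suc n))" and ?r = "b - real i * ((b - a) / real (Suc n))"
    have "real i * ((b - a) / real (Suc n)) < real (Suc i) * ((b - a) / real (Suc n))"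
      using ab by (intro mult_strict_right_mono divide_pos_pos) auto
    then have "infinite {?l<..<?r}" by (intro infinite_Ioo) simp
    then have "\<not> {?l<..<?r} \<subseteq> Q" using Q(1) finite_subset by blast
    then obtain x where "x \<in> {?l<..<?r}" "x \<notin> Q" by blast
    then show ?thesis unfolding B_def greaterThanLessThan_iff by blast
  qed
  then have \<sigma>: "B n i (SOME x. B n i x)" for n i by (rule someI_ex)
  define \<sigma> where "\<sigma> n i = (SOME x. B n i x)" for n i
  have \<sigma>': "b - real (Suc i) * ((b - a) / real (Suc n)) < \<sigma> n i"
    "\<sigma> n i < b - real i * ((b - a) / real (Suc n))" "\<sigma> n i \<notin> Q" for n i
    using \<sigma>[of n i] unfolding B_def[of n i "SOME x. B n i x"] \<sigma>_def by blast+
  have "isCont z x" if xx: "a < x" "x < b" "x \<notin> Q" for x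
  proof -
    obtain I where I: "I \<in> partition_intervals a b Q" "x \<in> I" using cover[of x] xx by auto
    then have "continuous_on I z" using uniformly_continuous_imp_continuous[OF uc] by blast
    then show ?thesis using I bb(1) by (simp add: continuous_on_eq_continuous_at)
  qed
  then have "sampled_impedance a b m M (zr a) (zl b) z Q zl zr \<sigma>"
    using ab Q m M zl zr ac \<sigma>' by unfold_locales (auto simp: abs_le_iff)
  then show ?thesis by (rule that)
qed

lemma step_limits:
  assumes ab: "a < b" and P: "finite P" "P \<subseteq> {a<..<b}"
    and const: "\<And>I. I \<in> partition_intervals a b P \<Longrightarrow> f constant_on I"
    and pos: "\<And>x. x \<in> {a<..<b} \<Longrightarrow> f x > (0::real)" and c: "c \<in> {a<..<b}"
  obtains l r where "(f \<longlongrightarrow> l) (at_left c)" "(f \<longlongrightarrow> r) (at_right c)" "l > 0" "r > 0"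
    "c \<notin> P \<Longrightarrow> l = r"
proof -
  \<comment> \<open>Adjoining c makes it an end point of two partition intervals, so f is constant
    on either side of c even when c is not in P.\<close>
  have fin: "finite (insert c P)" "insert c P \<subseteq> {a<..<b}" using P c by auto
  obtain u where u: "u < c" "a \<le> u" "{u<..<c} \<in> partition_intervals a b (insert c P)"
    using partition_interval_left[OF fin _ ab, of c] by auto
  obtain v where v: "c < v" "v \<le> b" "{c<..<v} \<in> partition_intervals a b (insert c P)"
    using partition_interval_right[OF fin _ ab, of c] by auto
  have sub: "P \<subseteq> insert c P" by auto
  have "f constant_on {u<..<c}" "f constant_on {c<..<v}"
    using partition_intervals_refine[OF ab P(1) sub fin(2) u(3)] partition_intervals_refine[OF ab P(1) sub fin(2) v(3)]
      const constant_on_subset by metis+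
  then obtain l r where l: "\<And>x. x \<in> {u<..<c} \<Longrightarrow> f x = l" and r: "\<And>x. x \<in> {c<..<v} \<Longrightarrow> f x = r"
    unfolding constant_on_def by metis
  have 1: "(f \<longlongrightarrow> l) (at_left c)"
    by (rule Lim_transform_eventually[OF tendsto_const])
      (use eventually_at_left_real[OF u(1)] in eventually_elim, simp add: l)
  have 2: "(f \<longlongrightarrow> r) (at_right c)"
    by (rule Lim_transform_eventually[OF tendsto_const])
      (use eventually_at_right_real[OF v(1)] in eventually_elim, simp add: r)
  have m1: "(u + c) / 2 \<in> {u<..<c}" and m2: "(c + v) / 2 \<in> {c<..<v}" using u v by auto
  have 3: "l > 0" using pos[of "(u + c) / 2"] l[OF m1] m1 u c by auto
  have 4: "r > 0" using pos[of "(c + v) / 2"] r[OF m2] m2 v c by auto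
  have 5: "l = r" if cP: "c \<notin> P"
  proof -
    obtain I where I: "I \<in> partition_intervals a b P" "{c..c} \<subseteq> I"
      using partition_interval_containing[OF P(1), of a c c b] c cP by auto
    then obtain k where k: "\<And>x. x \<in> I \<Longrightarrow> f x = k" using const[OF I(1)] unfolding constant_on_def by blast
    have "eventually (\<lambda>x. x \<in> I) (nhds c)"
      using I partition_intervals_open_interval(1)[OF I(1)] by (intro eventually_nhds_in_open) auto
    then have ev: "eventually (\<lambda>x. k = f x) (nhds c)" by eventually_elim (simp add: k)
    have "(f \<longlongrightarrow> k) (at_left c)" "(f \<longlongrightarrow> k) (at_right c)"
      using ev by (auto intro!: Lim_transform_eventually[OF tendsto_const] simp: eventually_at_filter elim: eventually_mono)
    then have "l = k" "r = k"
      using tendsto_unique[OF _ 1] tendsto_unique[OF _ 2] by auto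
    then show ?thesis by simp
  qed
  from 1 2 3 4 5 show ?thesis by (rule that)
qed

theorem theorem12:
  fixes x0 x1 :: real and \<zeta> \<zeta>1 \<zeta>2 :: "real \<Rightarrow> real" and n :: nat and y r :: "nat \<Rightarrow> real"
  assumes "x0 < x1"
    and "\<zeta> \<in> Cpw_pos x0 x1 - C_pos x0 x1"
    and "no_removable_discontinuity x0 x1 \<zeta>"
    and "continuous_on {x0<..<x1} \<zeta>1"
    and "\<zeta>2 \<in> Step_pos x0 x1"
    and "AE x in lborel. x \<in> {x0<..<x1} \<longrightarrow> \<zeta> x = \<zeta>1 x * \<zeta>2 x"
    and "n \<ge> 1"
    and "bij_betw y {1..n} (jump_points x0 x1 \<zeta>2)"
    and "\<And>j. j \<in> {1..n} \<Longrightarrow> r j = reflectivity \<zeta>2 (y j)"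
  shows "((\<lambda>L::real. 1 / (2 * L) *
            (LINT \<omega>:{-L..L}|lborel. - ln (1 - (cmod (gen_reflection_coeff x0 x1 \<zeta> \<omega> 0))\<^sup>2)))
          \<longlongrightarrow> (\<Sum>j=1..n. - ln (1 - (r j)\<^sup>2))) at_top"
proof -
  let ?X = "{x0<..<x1}"
  obtain m where m: "m > 0" "\<And>x. x \<in> ?X \<Longrightarrow> \<zeta> x > m"
    using assms(2) by (auto simp: Cpw_pos_def Reg_pos_def)
  obtain P1 where P1: "finite P1" "P1 \<subseteq> ?X" "\<And>I. I \<in> partition_intervals x0 x1 P1 \<Longrightarrow> abs_cont_on I \<zeta>"
    using assms(2) by (auto simp: Cpw_pos_def)
  obtain P2 where P2: "finite P2" "P2 \<subseteq> ?X" "\<And>I. I \<in> partition_intervals x0 x1 P2 \<Longrightarrow> \<zeta>2 constant_on I"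
    using assms(5) by (auto simp: Step_pos_def Step_def)
  have pos2: "\<zeta>2 x > 0" if "x \<in> ?X" for x using assms(5) that by (auto simp: Step_pos_def)
  \<comment> \<open>The common refinement serves both purposes: \<zeta> is absolutely continuous
    between its points, and every jump of \<zeta>2 is one of them.\<close>
  define Q where "Q = P1 \<union> P2"
  have Q: "finite Q" "Q \<subseteq> ?X" using P1 P2 by (auto simp: Q_def)
  have "abs_cont_on I \<zeta>" if I: "I \<in> partition_intervals x0 x1 Q" for I
  proof -
    have "P1 \<subseteq> Q" by (simp add: Q_def)
    from partition_intervals_refine[OF assms(1) P1(1) this Q(2) I] obtain J
      where "J \<in> partition_intervals x0 x1 P1" "I \<subseteq> J" .
    then show ?thesis using abs_cont_on_subset P1(3) by blast
  qed
  then obtain M za zb zl zr \<sigma> where "sampled_impedance x0 x1 m M za zb \<zeta> Q zl zr \<sigma>"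
    using Cpw_sampled_impedance[OF assms(1) Q m(1), of \<zeta>] m(2) by (metis less_imp_le)
  then interpret S: sampled_impedance x0 x1 m M za zb \<zeta> Q zl zr \<sigma> .
  let ?J = "jump_points x0 x1 \<zeta>2"
  \<comment> \<open>At c the one-sided limits of \<zeta> are those of \<zeta>2 times the common
    factor \<zeta>1 c, which cancels in the reflectivity.\<close>
  have key: "(c \<in> Q \<longrightarrow> S.r c = reflectivity \<zeta>2 c) \<and> (c \<in> ?J \<longrightarrow> c \<in> Q)
      \<and> (c \<notin> ?J \<longrightarrow> reflectivity \<zeta>2 c = 0)" if c: "c \<in> ?X" for c
  proof -
    obtain l2 r2 where lr: "(\<zeta>2 \<longlongrightarrow> l2) (at_left c)" "(\<zeta>2 \<longlongrightarrow> r2) (at_right c)" "l2 > 0" "r2 > 0"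
      "c \<notin> P2 \<Longrightarrow> l2 = r2"
      using step_limits[OF assms(1) P2 pos2 c] by blast
    have Lim: "Lim (at_left c) \<zeta>2 = l2" "Lim (at_right c) \<zeta>2 = r2"
      using lr by (auto intro!: tendsto_Lim)
    have refl: "reflectivity \<zeta>2 c = (l2 - r2) / (l2 + r2)" by (simp add: reflectivity_def Lim)
    have J: "c \<in> ?J \<longleftrightarrow> l2 \<noteq> r2" using c by (simp add: jump_points_def Lim)
    have "S.r c = reflectivity \<zeta>2 c" if cQ: "c \<in> Q"
    proof -
      have "isCont \<zeta>1 c" using assms(4) c by (simp add: continuous_on_eq_continuous_at)
      then have z1: "(\<zeta>1 \<longlongrightarrow> \<zeta>1 c) (at_left c)" "(\<zeta>1 \<longlongrightarrow> \<zeta>1 c) (at_right c)"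
        by (auto simp: isCont_def intro: filterlim_mono[OF _ order_refl at_le])
      have c': "x0 < c" "c < x1" using c by auto
      have zz: "zl c = \<zeta>1 c * l2" "zr c = \<zeta>1 c * r2"
        using AE_eq_limits_eq(1)[OF assms(6) c' S.zl[OF cQ] tendsto_mult[OF z1(1) lr(1)]]
          AE_eq_limits_eq(2)[OF assms(6) c' S.zr[OF cQ] tendsto_mult[OF z1(2) lr(2)]] by auto
      \<comment> \<open>The lower bound m on \<zeta> is what excludes \<zeta>1 c = 0.\<close>
      have "zl c > 0" using S.zlr(1)[OF cQ] m(1) by simp
      then have "\<zeta>1 c \<noteq> 0" using zz by auto
      then show ?thesis unfolding S.r_def refl zz
        by (simp add: right_diff_distrib[symmetric] distrib_left[symmetric])
    qed
    moreover have "c \<in> Q" if "c \<in> ?J" using that J lr(5) by (auto simp: Q_def)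
    moreover have "reflectivity \<zeta>2 c = 0" if "c \<notin> ?J" using that J by (simp add: refl)
    ultimately show ?thesis by blast
  qed
  have JX: "?J \<subseteq> ?X" by (auto simp: jump_points_def)
  have JQ: "?J \<subseteq> Q" using key JX by blast
  have "(\<Sum>j=1..n. - ln (1 - (r j)\<^sup>2)) = (\<Sum>j\<in>{1..n}. - ln (1 - (reflectivity \<zeta>2 (y j))\<^sup>2))"
    using assms(9) by (intro sum.cong) auto
  also have "\<dots> = (\<Sum>c\<in>?J. - ln (1 - (reflectivity \<zeta>2 c)\<^sup>2))"
    by (rule sum.reindex_bij_betw[OF assms(8)])
  also have "\<dots> = (\<Sum>c\<in>?J. - ln (1 - (S.r c)\<^sup>2))"
    using key JQ JX by (intro sum.cong) auto
  \<comment> \<open>Points of Q that are not jumps of \<zeta>2 have reflectivity 0 and contribute ln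
    1.\<close>
  also have "\<dots> = (\<Sum>c\<in>Q. - ln (1 - (S.r c)\<^sup>2))"
    using key JQ Q by (intro sum.mono_neutral_left) auto
  finally show ?thesis using S.loss_mean_limit by simp
qed

end
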